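(* Let $n\ge2$ and let $T$ be any one of the following operators: $M$ or a $k$-fold iteration $M^k$ ($k\in\mathbb{N}$); $M_{L^{n',1}}$; $\mathcal M_{\mathbb{S}^{n-1}}$; $M_\Omega$ with $\Omega\in L^{n,\infty}(\mathbb{S}^{n-1})$; $T_\Omega$ or $T^\star_\Omega$ with $\Omega\in L^{n,\infty}(\mathbb{S}^{n-1})$ of mean zero on $\mathbb{S}^{n-1}$ (all these operators are defined in the context). If $0<p<\infty$ and $w\in A_\infty$, then there is a constant $C$ (independent of $f$) such that for every $f\in C_c^\infty(\mathbb{R}^n)$, $$\|Tf\|_{L^p(w)}\le C\,\|M_1(|\nabla f|)\|_{L^p(w)}.$$
   Context: A weight is a nonnegative locally integrable function; $\|f\|_{L^p(w)}=(\int|f|^pw\,dx)^{1/p}$. $A_\infty=\bigcup_{s>1}A_s$, where $w\in A_s$ means $\sup_Q\left(\frac1{|Q|}\int_Qw\right)\left(\frac1{|Q|}\int_Qw^{1-s'}\right)^{s-1}<\infty$, $s'=\frac s{s-1}$, and $Q$ denotes cubes with sides parallel to the axes. $M_1g(x)=\sup_{Q\ni x}\ell(Q)\frac1{|Q|}\int_Q|g|$ is the fractional maximal function of order 1, with $\ell(Q)$ the side length. Notation for the operators: $n'=\frac n{n-1}$; $\sigma$ is surface measure on $\mathbb{S}^{n-1}$; $\Omega$ is homogeneous of degree zero on $\mathbb{R}^n\setminus\{0\}$, and $\Omega\in L^{n,\infty}(\mathbb{S}^{n-1})$ means $\sup_{t>0}t\,\sigma(\{y'\in\mathbb{S}^{n-1}:|\Omega(y')|>t\})^{1/n}<\infty$.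 Operators: - Hardy–Littlewood maximal operator $Mf(x)=\sup_{Q\ni x}\frac1{|Q|}\int_Q|f|$, and $M^k$ its $k$-fold composition. - Lorentz maximal operator $M_{L^{n',1}}f(x)=\sup_{Q\ni x}\|f\|_{L^{n',1}(Q)}$, where $\|f\|_{L^{n',1}(Q)}=|Q|^{-1/n'}\,n'\int_0^\infty|\{y\in Q:|f(y)|>t\}|^{1/n'}\,dt$. - Spherical maximal operator $\mathcal M_{\mathbb{S}^{n-1}}f(x)=\sup_{t>0}\left|\int_{\mathbb{S}^{n-1}}f(x-ty')\,d\sigma(y')\right|$. - Rough maximal operator $M_\Omega f(x)=\sup_{t>0}\frac1{t^n}\int_{|y|<t}|\Omega(y)f(x-y)|\,dy$. - Rough singular integral $T_\Omega f(x)=\mathrm{p.v.}\int_{\mathbb{R}^n}\frac{\Omega(y)}{|y|^n}f(x-y)\,dy$. - Maximal rough singular integral $T^\star_\Omega f(x)=\sup_{t>0}\left|\int_{|y|>t}\frac{\Omega(y)}{|y|^n}f(x-y)\,dy\right|$. *)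

theory Defs
  imports "HOL-Analysis.Analysis"
begin

text \<open>
  Nonnegative quantities (averages, maximal functions, norms) take values in \<^typ>\<open>ennreal\<close>, so that
  suprema and integrals need no finiteness side conditions. Integrals are taken with respect to the
  complete measure \<^const>\<open>lebesgue\<close>: weights and kernels are only Lebesgue measurable.
\<close>

text \<open>Powers of extended nonnegative reals with \<open>0\<close> raised to a negative power equal to \<open>\<infinity>\<close>;
  the real function \<^const>\<open>powr\<close> would give \<open>0\<close> instead.\<close>

definition epowr :: "ennreal \<Rightarrow> real \<Rightarrow> ennreal" where
  "epowr x a =
    (if a = 0 then 1
     else if x = 0 then (if a > 0 then 0 else \<infinity>)
     else if x = \<infinity> then (if a > 0 then \<infinity> else 0)
     else ennreal (enn2real x powr a))"

definition conj_exponent :: "real \<Rightarrow> real" where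
  "conj_exponent s = s / (s - 1)"


subsection \<open>Cubes, averages and maximal operators\<close>

definition cube :: "'a::euclidean_space \<Rightarrow> real \<Rightarrow> 'a set" where
  "cube a l = cbox a (a + l *\<^sub>R One)"

definition average :: "'a::euclidean_space set \<Rightarrow> ('a \<Rightarrow> ennreal) \<Rightarrow> ennreal" where
  "average Q g = (\<integral>\<^sup>+y\<in>Q. g y \<partial>lebesgue) / emeasure lebesgue Q"

definition cubes_containing :: "'a::euclidean_space \<Rightarrow> ('a \<times> real) set" where
  "cubes_containing x = {(a, l). l > 0 \<and> x \<in> cube a l}"

definition HL_maximal :: "('a::euclidean_space \<Rightarrow> ennreal) \<Rightarrow> 'a \<Rightarrow> ennreal" where
  "HL_maximal g x = (SUP (a, l)\<in>cubes_containing x. average (cube a l) g)"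

definition fractional_maximal_1 :: "('a::euclidean_space \<Rightarrow> ennreal) \<Rightarrow> 'a \<Rightarrow> ennreal" where
  "fractional_maximal_1 g x =
    (SUP (a, l)\<in>cubes_containing x. ennreal l * average (cube a l) g)"

text \<open>The normalised norm of \<open>L\<^bsup>q,1\<^esup>(Q)\<close>.\<close>

definition lorentz_norm :: "real \<Rightarrow> 'a::euclidean_space set \<Rightarrow> ('a \<Rightarrow> ennreal) \<Rightarrow> ennreal" where
  "lorentz_norm q Q g =
    epowr (emeasure lebesgue Q) (- 1 / q) * ennreal q *
    (\<integral>\<^sup>+t\<in>{0<..}. epowr (emeasure lebesgue {y \<in> Q. g y > ennreal t}) (1 / q) \<partial>lborel)"

definition lorentz_maximal :: "real \<Rightarrow> ('a::euclidean_space \<Rightarrow> ennreal) \<Rightarrow> 'a \<Rightarrow> ennreal" where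
  "lorentz_maximal q g x = (SUP (a, l)\<in>cubes_containing x. lorentz_norm q (cube a l) g)"


subsection \<open>Weights\<close>

definition weight :: "('a::euclidean_space \<Rightarrow> real) \<Rightarrow> bool" where
  "weight w \<longleftrightarrow> (\<forall>x. 0 \<le> w x) \<and> (\<forall>K. compact K \<longrightarrow> set_integrable lebesgue K w)"

definition A_const :: "real \<Rightarrow> ('a::euclidean_space \<Rightarrow> real) \<Rightarrow> ennreal" where
  "A_const s w =
    (SUP (a, l)\<in>UNIV \<times> {0<..}.
       average (cube a l) (\<lambda>x. ennreal (w x)) *
       epowr (average (cube a l) (\<lambda>x. epowr (ennreal (w x)) (1 - conj_exponent s))) (s - 1))"

definition A_class :: "real \<Rightarrow> ('a::euclidean_space \<Rightarrow> real) set" where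
  "A_class s = {w. weight w \<and> A_const s w < \<infinity>}"

definition A_infinity :: "('a::euclidean_space \<Rightarrow> real) set" where
  "A_infinity = (\<Union>s\<in>{1<..}. A_class s)"

definition weighted_Lp_norm ::
    "real \<Rightarrow> ('a::euclidean_space \<Rightarrow> real) \<Rightarrow> ('a \<Rightarrow> ennreal) \<Rightarrow> ennreal" where
  "weighted_Lp_norm p w g = epowr (\<integral>\<^sup>+x. epowr (g x) p * ennreal (w x) \<partial>lebesgue) (1 / p)"


subsection \<open>Test functions\<close>

text \<open>Continuous differentiability of order \<open>k\<close>, by recursion on the partial derivatives.\<close>

fun C_k :: "nat \<Rightarrow> ('a::euclidean_space \<Rightarrow> 'b::real_normed_vector) \<Rightarrow> bool" where
  "C_k 0 f \<longleftrightarrow> continuous_on UNIV f"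
| "C_k (Suc k) f \<longleftrightarrow> f differentiable_on UNIV \<and>
     (\<forall>i\<in>Basis. C_k k (\<lambda>x. frechet_derivative f (at x) i))"

definition smooth_compactly_supported ::
    "('a::euclidean_space \<Rightarrow> 'b::real_normed_vector) \<Rightarrow> bool" where
  "smooth_compactly_supported f \<longleftrightarrow> (\<forall>k. C_k k f) \<and> compact (closure {x. f x \<noteq> 0})"

definition gradient_norm :: "('a::euclidean_space \<Rightarrow> 'b::real_normed_vector) \<Rightarrow> 'a \<Rightarrow> real" where
  "gradient_norm f x = sqrt (\<Sum>i\<in>Basis. (norm (frechet_derivative f (at x) i))\<^sup>2)"


subsection \<open>The sphere\<close>

text \<open>Surface measure on the unit sphere of a space of dimension \<open>n\<close>: \<open>\<sigma>(E)\<close> is \<open>n\<close> times the volume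
  of the cone \<open>{ry | y \<in> E, 0 < r \<le> 1}\<close>, which is the normalisation for which integration in polar
  coordinates reads \<open>dx = r\<^bsup>n-1\<^esup> dr d\<sigma>\<close>. The push-forward below is along \<^const>\<open>sgn\<close>, the radial projection
  \<open>x \<mapsto> x / |x|\<close>; the measure is completed so that non-Borel null sets are measurable.\<close>

definition sphere_measure :: "'a::euclidean_space measure" where
  "sphere_measure = completion (scale_measure (of_nat DIM('a))
     (distr (restrict_space lborel (cball 0 1 - {0})) (restrict_space borel (sphere 0 1)) sgn))"

lemma space_sphere_measure [simp]: "space sphere_measure = sphere 0 1"
  by (simp add: sphere_measure_def space_restrict_space space_scale_measure)

lemma emeasure_sphere_measure:
  fixes E :: "'a::euclidean_space set"
  assumes "E \<in> sets borel" "E \<subseteq> sphere 0 1"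
  shows "emeasure sphere_measure E =
    of_nat DIM('a) * emeasure lborel {x \<in> cball 0 1. x \<noteq> 0 \<and> sgn x \<in> E}"
proof -
  let ?R = "restrict_space lborel (cball 0 1 - {0::'a})"
  let ?S = "restrict_space borel (sphere 0 (1::real)) :: 'a measure"
  have "(sgn :: 'a \<Rightarrow> 'a) \<in> borel_measurable borel"
    unfolding sgn_div_norm by measurable
  then have m: "(sgn :: 'a \<Rightarrow> 'a) \<in> measurable ?R ?S"
    by (intro measurable_restrict_space2 measurable_restrict_space1)
       (auto simp: space_restrict_space norm_sgn)
  have E: "E \<in> sets ?S"
    using assms by (auto simp: sets_restrict_space image_iff)
  have "emeasure sphere_measure E = of_nat DIM('a) * emeasure ?R (sgn -` E \<inter> space ?R)"
    using E m by (simp add: sphere_measure_def emeasure_distr)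
  also have "sgn -` E \<inter> space ?R = {x \<in> cball 0 1. x \<noteq> 0 \<and> sgn x \<in> E}"
    by (auto simp: space_restrict_space)
  also have "emeasure ?R \<dots> = emeasure lborel {x \<in> cball 0 1. x \<noteq> 0 \<and> sgn x \<in> E}"
    by (rule emeasure_restrict_space) auto
  finally show ?thesis .
qed

definition homogeneous_degree_0 :: "('a::real_vector \<Rightarrow> 'b) \<Rightarrow> bool" where
  "homogeneous_degree_0 \<Omega> \<longleftrightarrow> (\<forall>c>0. \<forall>x. x \<noteq> 0 \<longrightarrow> \<Omega> (c *\<^sub>R x) = \<Omega> x)"

definition weak_Lp_sphere :: "real \<Rightarrow> ('a::euclidean_space \<Rightarrow> complex) set" where
  "weak_Lp_sphere q = {\<Omega>. \<Omega> \<in> borel_measurable sphere_measure \<and>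
     (SUP t\<in>{0<..}. ennreal t *
        epowr (emeasure sphere_measure {y \<in> sphere 0 1. norm (\<Omega> y) > t}) (1 / q)) < \<infinity>}"

definition mean_zero_sphere :: "('a::euclidean_space \<Rightarrow> complex) \<Rightarrow> bool" where
  "mean_zero_sphere \<Omega> \<longleftrightarrow> (\<integral>y. \<Omega> y \<partial>sphere_measure) = 0"

definition spherical_maximal :: "('a::euclidean_space \<Rightarrow> complex) \<Rightarrow> 'a \<Rightarrow> ennreal" where
  "spherical_maximal f x =
    (SUP t\<in>{0<..}. ennreal (norm (\<integral>y. f (x - t *\<^sub>R y) \<partial>sphere_measure)))"


subsection \<open>Rough operators\<close>

definition rough_maximal ::
    "('a::euclidean_space \<Rightarrow> complex) \<Rightarrow> ('a \<Rightarrow> complex) \<Rightarrow> 'a \<Rightarrow> ennreal" where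
  "rough_maximal \<Omega> f x =
    (SUP t\<in>{0<..}. (\<integral>\<^sup>+y\<in>ball 0 t. ennreal (norm (\<Omega> y * f (x - y))) \<partial>lebesgue) /
       ennreal (t ^ DIM('a)))"

definition truncated_integral ::
    "('a::euclidean_space \<Rightarrow> complex) \<Rightarrow> real \<Rightarrow> ('a \<Rightarrow> complex) \<Rightarrow> 'a \<Rightarrow> complex" where
  "truncated_integral \<Omega> t f x =
    (LINT y:{y. norm y > t}|lebesgue. \<Omega> y / of_real (norm y ^ DIM('a)) * f (x - y))"

definition rough_singular ::
    "('a::euclidean_space \<Rightarrow> complex) \<Rightarrow> ('a \<Rightarrow> complex) \<Rightarrow> 'a \<Rightarrow> complex" where
  "rough_singular \<Omega> f x = Lim (at_right 0) (\<lambda>t. truncated_integral \<Omega> t f x)"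

definition rough_singular_maximal ::
    "('a::euclidean_space \<Rightarrow> complex) \<Rightarrow> ('a \<Rightarrow> complex) \<Rightarrow> 'a \<Rightarrow> ennreal" where
  "rough_singular_maximal \<Omega> f x = (SUP t\<in>{0<..}. ennreal (norm (truncated_integral \<Omega> t f x)))"

end

theory Submission
  imports Defs
begin

text \<open>
  Every operator in the list is dominated pointwise, on smooth compactly supported functions, by the
  Riesz potential \<open>I\<^sub>1 g(x) = \<integral> g(y) |x - y|\<^bsup>1-n\<^esup> dy\<close> of \<open>g = |\<nabla>f|\<close>. The theorem then follows from the
  inequality of Muckenhoupt and Wheeden, which bounds \<open>I\<^sub>1 g\<close> by the fractional maximal function \<open>M\<^sub>1 g\<close>
  in \<open>L\<^sup>p(w)\<close> for \<open>w \<in> A\<^sub>\<infinity>\<close> and all \<open>0 < p < \<infinity>\<close>.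

  \<^emph>\<open>The pointwise bounds.\<close> Integrating the gradient along segments that start at a point \<open>x\<close> of a cube
  \<open>Q\<close> bounds the mean oscillation of \<open>f\<close> about \<open>f(x)\<close> by the potential of the gradient on \<open>Q\<close>. Letting
  \<open>Q\<close> grow gives \<open>|f| \<le> C I\<^sub>1 g\<close>, and since the kernel is an \<open>A\<^sub>1\<close> weight the iterated maximal functions
  of \<open>f\<close> obey the same bound. Applied to truncations of \<open>|f - c|\<close>, the oscillation estimate yields the
  Sobolev--Poincare inequality \<open>lorentz_poincare\<close> at the endpoint \<open>L\<^bsup>n',1\<^esup>(Q)\<close>, where \<open>n' = n/(n-1)\<close>.
  It controls the Lorentz maximal function. As \<open>L\<^bsup>n',1\<^esup>\<close> is dual to \<open>L\<^bsup>n,\<infinity>\<^esup>\<close>, it also controls the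
  pairing of \<open>f - c\<close> with a kernel in \<open>L\<^bsup>n,\<infinity>\<^esup>\<close> on each dyadic shell about \<open>x\<close>; for the singular integrals
  the vanishing mean of the kernel allows subtracting the constant \<open>c\<close> on every shell, and the bounds for the
  shells add up to \<open>I\<^sub>1 g(x)\<close>. The spherical means are bounded by \<open>I\<^sub>1 g\<close> through integration along rays
  and polar coordinates.

  \<^emph>\<open>The weighted inequality.\<close> The potential is comparable to a sum over dyadic scales \<open>h\<close> of terms
  \<open>a\<^sub>h(x) = h\<^bsup>1-n\<^esup> \<integral>\<^bsub>3Q\<^esub> g\<close>, where \<open>Q\<close> is the dyadic cube of side \<open>h\<close> containing \<open>x\<close>, and each term is at
  most a constant times \<open>M\<^sub>1 g(x)\<close>. Over a dyadic cube the mean of the terms of all smaller scales is at most a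
  constant times the top term, so by Chebyshev's inequality the top term dominates the sum on half of the cube
  (\<open>dyadic_mass_sum_half\<close>). The \<open>A\<^sub>\<infinity>\<close> condition makes this half comparable to the cube in \<open>w\<close>-measure
  (\<open>A_infinity_half_comparable\<close>). A stopping-time argument, arranged as an induction on the scale
  (\<open>sum_adapted_le_maximal\<close>), then bounds the \<open>L\<^sup>1(w)\<close> norm of the sum by that of its largest term.
  Applying the same estimate to the increments of the \<open>p\<close>-th powers of the partial sums, which inherit the
  domination by the top term, gives all exponents \<open>p\<close> at once.
\<close>

section \<open>The Riesz kernel and polar coordinates\<close>

text \<open>The real power makes the kernel vanish at the origin instead of being infinite there. Since a point is
  a null set this does not change any integral, but lower bounds hold only away from the origin.\<close>

definition riesz_kernel :: "'a::euclidean_space \<Rightarrow> ennreal" where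
  "riesz_kernel z = ennreal (norm z powr (1 - real DIM('a)))"

lemma riesz_kernel_measurable [measurable]: "riesz_kernel \<in> borel_measurable borel"
  unfolding riesz_kernel_def by measurable

lemma pred_in_cball [measurable (raw)]:
  fixes f :: "_ \<Rightarrow> 'a::euclidean_space"
  assumes [measurable]: "f \<in> borel_measurable M"
  shows "Measurable.pred M (\<lambda>x. f x \<in> cball a r)"
  by simp

lemma nn_integral_dilation:
  fixes f :: "'a::euclidean_space \<Rightarrow> ennreal"
  assumes [measurable]: "f \<in> borel_measurable borel" and "c \<noteq> 0"
  shows "(\<integral>\<^sup>+x. f x \<partial>lborel) = ennreal (\<bar>c\<bar> ^ DIM('a)) * (\<integral>\<^sup>+x. f (t + c *\<^sub>R x) \<partial>lborel)"
  by (subst lborel_affine[OF \<open>c \<noteq> 0\<close>, of t])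
     (simp add: nn_integral_density nn_integral_distr nn_integral_cmult)

lemma nn_integral_powr_tail:
  fixes a q :: real
  assumes "0 < a" "0 < q"
  shows "(\<integral>\<^sup>+s. ennreal (s powr (- q - 1)) * indicator {a..} s \<partial>lborel) = ennreal (a powr (- q) / q)"
proof -
  have lim: "((\<lambda>s. - (s powr (- q) / q)) \<longlongrightarrow> - (0 / q)) at_top"
    using \<open>0 < q\<close> by (intro tendsto_minus tendsto_divide tendsto_const tendsto_neg_powr filterlim_ident) auto
  have "(\<integral>\<^sup>+s. ennreal (s powr (- q - 1)) * indicator {a..} s \<partial>lborel) = ennreal (- (0 / q) - - (a powr (- q) / q))"
  proof (rule nn_integral_FTC_atLeast[OF _ _ _ lim])
    fix x :: real assume "a \<le> x"
    then have "x > 0" using assms by simp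
    then show "((\<lambda>s. - (s powr (- q) / q)) has_real_derivative x powr (- q - 1)) (at x)"
      using \<open>0 < q\<close> by (auto intro!: derivative_eq_intros)
  qed auto
  then show ?thesis by simp
qed

text \<open>Dilating \<open>z\<close> turns the left side into an integral of \<open>u \<mapsto> u\<^bsup>-n-1\<^esup>\<close> over
  \<open>u \<ge> |y| / D\<close>; this one computation yields both integration in polar coordinates and the potential
  estimate for oscillations on a cube.\<close>

lemma nn_integral_rays_ball:
  fixes G :: "'a::euclidean_space \<Rightarrow> ennreal"
  assumes [measurable]: "G \<in> borel_measurable borel" and "D > 0"
  shows "(\<integral>\<^sup>+u\<in>{0<..}. (\<integral>\<^sup>+z\<in>cball 0 D. G (u *\<^sub>R z) * ennreal (norm z) \<partial>lborel) \<partial>lborel)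
    = ennreal (D ^ DIM('a) / DIM('a)) * (\<integral>\<^sup>+y. G y * riesz_kernel y \<partial>lborel)"
proof -
  let ?n = "real DIM('a)"
  have n: "?n \<ge> 1" using DIM_positive[where 'a='a] by linarith
  have 1: "(\<integral>\<^sup>+z\<in>cball 0 D. G (u *\<^sub>R z) * ennreal (norm z) \<partial>lborel)
    = (\<integral>\<^sup>+y. G y * ennreal (norm y) * (ennreal (u powr (- ?n - 1)) * indicator {norm y / D..} u) \<partial>lborel)"
    if "u > 0" for u
  proof -
    have "(\<integral>\<^sup>+z\<in>cball 0 D. G (u *\<^sub>R z) * ennreal (norm z) \<partial>lborel) =
       ennreal (\<bar>1/u\<bar> ^ DIM('a)) * (\<integral>\<^sup>+y. G (u *\<^sub>R (0 + (1/u) *\<^sub>R y)) * ennreal (norm (0 + (1/u) *\<^sub>R y)) * indicator (cball 0 D) (0 + (1/u) *\<^sub>R y) \<partial>lborel)"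
      by (rule nn_integral_dilation, measurable) (use that in simp_all)
    also have "\<dots> = (\<integral>\<^sup>+y. ennreal (\<bar>1/u\<bar> ^ DIM('a)) * (G (u *\<^sub>R (0 + (1/u) *\<^sub>R y)) * ennreal (norm (0 + (1/u) *\<^sub>R y)) * indicator (cball 0 D) (0 + (1/u) *\<^sub>R y)) \<partial>lborel)"
      by (rule nn_integral_cmult[symmetric]) measurable
    also have "\<dots> = (\<integral>\<^sup>+y. G y * ennreal (norm y) * (ennreal (u powr (- ?n - 1)) * indicator {norm y / D..} u) \<partial>lborel)"
    proof (rule nn_integral_cong)
      fix y :: 'a
      have p: "\<bar>1/u\<bar> ^ DIM('a) * (norm y / u) = norm y * u powr (- ?n - 1)"
        using that by (simp add: powr_diff powr_minus powr_realpow field_simps)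
      have "ennreal (\<bar>1/u\<bar> ^ DIM('a)) * ennreal (norm y / u) = ennreal (norm y) * ennreal (u powr (- ?n - 1))"
        using that p by (simp flip: ennreal_mult')
      moreover have "(0 + (1/u) *\<^sub>R y \<in> cball 0 D) = (u \<in> {norm y / D..})"
        using that \<open>D > 0\<close> by (simp add: field_simps)
      moreover have "norm (0 + (1/u) *\<^sub>R y) = norm y / u" using that by simp
      ultimately show "ennreal (\<bar>1/u\<bar> ^ DIM('a)) * (G (u *\<^sub>R (0 + (1/u) *\<^sub>R y)) * ennreal (norm (0 + (1/u) *\<^sub>R y)) * indicator (cball 0 D) (0 + (1/u) *\<^sub>R y)) = G y * ennreal (norm y) * (ennreal (u powr (- ?n - 1)) * indicator {norm y / D..} u)"
        using that by (auto simp: indicator_def mult_ac)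
    qed
    finally show ?thesis .
  qed
  have "(\<integral>\<^sup>+u\<in>{0<..}. (\<integral>\<^sup>+z\<in>cball 0 D. G (u *\<^sub>R z) * ennreal (norm z) \<partial>lborel) \<partial>lborel)
    = (\<integral>\<^sup>+u. (\<integral>\<^sup>+y. G y * ennreal (norm y) * (ennreal (u powr (- ?n - 1)) * indicator {norm y / D..} u) * indicator {0<..} u \<partial>lborel) \<partial>lborel)"
  proof (rule nn_integral_cong)
    fix u :: real
    show "(\<integral>\<^sup>+z\<in>cball 0 D. G (u *\<^sub>R z) * ennreal (norm z) \<partial>lborel) * indicator {0<..} u
      = (\<integral>\<^sup>+y. G y * ennreal (norm y) * (ennreal (u powr (- ?n - 1)) * indicator {norm y / D..} u) * indicator {0<..} u \<partial>lborel)"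
      using 1[of u] by (cases "u > 0") simp_all
  qed
  also have "\<dots> = (\<integral>\<^sup>+y. (\<integral>\<^sup>+u. G y * ennreal (norm y) * (ennreal (u powr (- ?n - 1)) * indicator {norm y / D..} u) * indicator {0<..} u \<partial>lborel) \<partial>lborel)"
  proof -
    have "(\<lambda>(u, y). G y * ennreal (norm y) * (ennreal (u powr (- ?n - 1)) * (if norm y / D \<le> u then 1 else 0)) * indicator {0<..} u)
      \<in> borel_measurable (lborel \<Otimes>\<^sub>M lborel)" by measurable
    then have "(\<lambda>(u, y). G y * ennreal (norm y) * (ennreal (u powr (- ?n - 1)) * indicator {norm y / D..} u) * indicator {0<..} u)
      \<in> borel_measurable (lborel \<Otimes>\<^sub>M lborel)" by (simp add: indicator_def of_bool_def)
    from lborel_pair.Fubini'[OF this] show ?thesis by simp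
  qed
  also have "\<dots> = (\<integral>\<^sup>+y. ennreal (D ^ DIM('a) / DIM('a)) * (G y * riesz_kernel y) \<partial>lborel)"
  proof (rule nn_integral_cong)
    fix y :: 'a
    show "(\<integral>\<^sup>+u. G y * ennreal (norm y) * (ennreal (u powr (- ?n - 1)) * indicator {norm y / D..} u) * indicator {0<..} u \<partial>lborel) = ennreal (D ^ DIM('a) / DIM('a)) * (G y * riesz_kernel y)"
    proof (cases "y = 0")
      case False
      have "norm y / D > 0" using False \<open>D > 0\<close> by simp
      then have "(\<integral>\<^sup>+u. G y * ennreal (norm y) * (ennreal (u powr (- ?n - 1)) * indicator {norm y / D..} u) * indicator {0<..} u \<partial>lborel)
        = (\<integral>\<^sup>+u. G y * ennreal (norm y) * (ennreal (u powr (- ?n - 1)) * indicator {norm y / D..} u) \<partial>lborel)"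
        by (intro nn_integral_cong) (auto simp: indicator_def)
      also have "\<dots> = G y * ennreal (norm y) * ennreal ((norm y / D) powr (- ?n) / ?n)"
        using False \<open>D > 0\<close> n by (subst nn_integral_cmult) (auto simp: nn_integral_powr_tail)
      also have "\<dots> = G y * ennreal (norm y * ((norm y / D) powr (- ?n) / ?n))"
        using n by (subst mult.assoc, subst ennreal_mult[symmetric]) auto
      also have "norm y * ((norm y / D) powr (- ?n) / ?n) = D ^ DIM('a) / DIM('a) * norm y powr (1 - ?n)"
        using False \<open>D > 0\<close> by (simp add: powr_diff powr_minus powr_divide powr_realpow field_simps)
      also have "ennreal (D ^ DIM('a) / DIM('a) * norm y powr (1 - ?n)) = ennreal (D ^ DIM('a) / DIM('a)) * riesz_kernel y"
        unfolding riesz_kernel_def using \<open>D > 0\<close> by (subst ennreal_mult) auto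
      finally show ?thesis by (simp only: mult_ac)
    qed (simp add: riesz_kernel_def)
  qed
  also have "\<dots> = ennreal (D ^ DIM('a) / DIM('a)) * (\<integral>\<^sup>+y. G y * riesz_kernel y \<partial>lborel)"
    by (rule nn_integral_cmult) auto
  finally show ?thesis .
qed


lemma sgn_borel_measurable [measurable]: "(sgn :: 'a::euclidean_space \<Rightarrow> 'a) \<in> borel_measurable borel"
  unfolding sgn_div_norm by measurable

lemma nn_integral_sphere_measure:
  fixes h :: "'a::euclidean_space \<Rightarrow> ennreal"
  assumes [measurable]: "h \<in> borel_measurable borel"
  shows "(\<integral>\<^sup>+y. h y \<partial>sphere_measure) =
    of_nat DIM('a) * (\<integral>\<^sup>+z\<in>cball 0 1 - {0}. h (sgn z) \<partial>lborel)"
proof -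
  let ?R = "restrict_space lborel (cball 0 1 - {0::'a})"
  let ?S = "restrict_space borel (sphere 0 (1::real)) :: 'a measure"
  have m: "(sgn :: 'a \<Rightarrow> 'a) \<in> measurable ?R ?S"
    by (intro measurable_restrict_space2 measurable_restrict_space1)
       (auto simp: space_restrict_space norm_sgn)
  have h: "h \<in> borel_measurable ?S"
    by (intro measurable_restrict_space1) simp
  have "(\<integral>\<^sup>+y. h y \<partial>sphere_measure) = of_nat DIM('a) * (\<integral>\<^sup>+y. h y \<partial>distr ?R ?S sgn)"
    unfolding sphere_measure_def using h by (simp add: nn_integral_completion nn_integral_scale_measure)
  also have "(\<integral>\<^sup>+y. h y \<partial>distr ?R ?S sgn) = (\<integral>\<^sup>+z. h (sgn z) \<partial>?R)"
    by (rule nn_integral_distr[OF m]) (use h in simp)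
  also have "\<dots> = (\<integral>\<^sup>+z\<in>cball 0 1 - {0}. h (sgn z) \<partial>lborel)"
    by (rule nn_integral_restrict_space) auto
  finally show ?thesis .
qed

text \<open>With \<open>s = u |z|\<close> the integral over the ray through \<open>z\<close> becomes one over \<open>u\<close> with weight \<open>|z|\<close>, and the
  surface measure, being the image of the measure on the ball, turns the double integral into that of
  \<open>nn_integral_rays_ball\<close>.\<close>

lemma nn_integral_polar:
  fixes G :: "'a::euclidean_space \<Rightarrow> ennreal"
  assumes [measurable]: "G \<in> borel_measurable borel"
  shows "(\<integral>\<^sup>+y. (\<integral>\<^sup>+s\<in>{0<..}. G (s *\<^sub>R y) \<partial>lborel) \<partial>sphere_measure) = (\<integral>\<^sup>+z. G z * riesz_kernel z \<partial>lborel)"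
proof -
  let ?n = "real DIM('a)"
  have ray: "(\<integral>\<^sup>+s\<in>{0<..}. G (s *\<^sub>R sgn z) \<partial>lborel) = (\<integral>\<^sup>+u\<in>{0<..}. G (u *\<^sub>R z) * ennreal (norm z) \<partial>lborel)"
    if "z \<noteq> 0" for z :: 'a
  proof -
    have "(\<integral>\<^sup>+s\<in>{0<..}. G (s *\<^sub>R sgn z) \<partial>lborel) =
      ennreal \<bar>norm z\<bar> * (\<integral>\<^sup>+u. G ((0 + norm z * u) *\<^sub>R sgn z) * indicator {0<..} (0 + norm z * u) \<partial>lborel)"
      by (rule nn_integral_real_affine, measurable) (use that in simp)
    also have "\<dots> = (\<integral>\<^sup>+u. ennreal \<bar>norm z\<bar> * (G ((0 + norm z * u) *\<^sub>R sgn z) * indicator {0<..} (0 + norm z * u)) \<partial>lborel)"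
      by (rule nn_integral_cmult[symmetric]) measurable
    also have "\<dots> = (\<integral>\<^sup>+u\<in>{0<..}. G (u *\<^sub>R z) * ennreal (norm z) \<partial>lborel)"
      using that by (intro nn_integral_cong) (auto simp: sgn_div_norm indicator_def mult_ac zero_less_mult_iff)
    finally show ?thesis .
  qed
  have "(\<integral>\<^sup>+y. (\<integral>\<^sup>+s\<in>{0<..}. G (s *\<^sub>R y) \<partial>lborel) \<partial>sphere_measure)
    = of_nat DIM('a) * (\<integral>\<^sup>+z\<in>cball 0 1 - {0}. (\<integral>\<^sup>+s\<in>{0<..}. G (s *\<^sub>R sgn z) \<partial>lborel) \<partial>lborel)"
    by (rule nn_integral_sphere_measure) measurable
  also have "(\<integral>\<^sup>+z\<in>cball 0 1 - {0}. (\<integral>\<^sup>+s\<in>{0<..}. G (s *\<^sub>R sgn z) \<partial>lborel) \<partial>lborel)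
    = (\<integral>\<^sup>+z. (\<integral>\<^sup>+u. G (u *\<^sub>R z) * ennreal (norm z) * indicator {0<..} u * indicator (cball 0 1) z \<partial>lborel) \<partial>lborel)"
  proof (rule nn_integral_cong)
    fix z :: 'a
    show "(\<integral>\<^sup>+s\<in>{0<..}. G (s *\<^sub>R sgn z) \<partial>lborel) * indicator (cball 0 1 - {0}) z
      = (\<integral>\<^sup>+u. G (u *\<^sub>R z) * ennreal (norm z) * indicator {0<..} u * indicator (cball 0 1) z \<partial>lborel)"
      using ray[of z] by (cases "z = 0"; cases "z \<in> cball 0 1") simp_all
  qed
  also have "\<dots> = (\<integral>\<^sup>+u. (\<integral>\<^sup>+z. G (u *\<^sub>R z) * ennreal (norm z) * indicator {0<..} u * indicator (cball 0 1) z \<partial>lborel) \<partial>lborel)"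
  proof -
    have "(\<lambda>(z, u). G (u *\<^sub>R z) * ennreal (norm z) * indicator {0<..} u * indicator (cball 0 1) z)
      \<in> borel_measurable (lborel \<Otimes>\<^sub>M lborel)" by measurable
    from lborel_pair.Fubini'[OF this] show ?thesis by simp
  qed
  also have "\<dots> = (\<integral>\<^sup>+u\<in>{0<..}. (\<integral>\<^sup>+z\<in>cball 0 1. G (u *\<^sub>R z) * ennreal (norm z) \<partial>lborel) \<partial>lborel)"
  proof (rule nn_integral_cong)
    fix u :: real
    show "(\<integral>\<^sup>+z. G (u *\<^sub>R z) * ennreal (norm z) * indicator {0<..} u * indicator (cball 0 1) z \<partial>lborel)
      = (\<integral>\<^sup>+z\<in>cball 0 1. G (u *\<^sub>R z) * ennreal (norm z) \<partial>lborel) * indicator {0<..} u"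
      by (cases "u > 0") simp_all
  qed
  also have "\<dots> = ennreal (1 / ?n) * (\<integral>\<^sup>+y. G y * riesz_kernel y \<partial>lborel)"
    using nn_integral_rays_ball[of G 1] by simp
  finally have "(\<integral>\<^sup>+y. (\<integral>\<^sup>+s\<in>{0<..}. G (s *\<^sub>R y) \<partial>lborel) \<partial>sphere_measure) =
    (ennreal ?n * ennreal (1 / ?n)) * (\<integral>\<^sup>+y. G y * riesz_kernel y \<partial>lborel)"
    by (simp add: mult.assoc ennreal_of_nat_eq_real_of_nat)
  also have "ennreal ?n * ennreal (1 / ?n) = 1"
    using DIM_positive[where 'a='a] by (subst ennreal_mult[symmetric]) auto
  finally show ?thesis by simp
qed

lemma emeasure_sphere_measure_finite: "emeasure (sphere_measure :: 'a::euclidean_space measure) (sphere 0 1) < \<infinity>"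
proof -
  have "emeasure (sphere_measure :: 'a measure) (sphere 0 1) =
    of_nat DIM('a) * emeasure lborel {x \<in> cball 0 1. x \<noteq> 0 \<and> sgn x \<in> sphere (0::'a) 1}"
    by (rule emeasure_sphere_measure) auto
  also have "\<dots> \<le> of_nat DIM('a) * emeasure lborel (cball (0::'a) 1)"
    by (intro mult_left_mono emeasure_mono) auto
  also have "\<dots> < \<infinity>"
    using emeasure_lborel_cball_finite[of "0::'a" 1] by (simp add: ennreal_mult_less_top of_nat_less_top)
  finally show ?thesis .
qed

lemma nn_integral_riesz_kernel_cball:
  assumes "R \<ge> 0"
  shows "(\<integral>\<^sup>+z\<in>cball 0 R. riesz_kernel (z :: 'a::euclidean_space) \<partial>lborel) = ennreal R * emeasure (sphere_measure :: 'a measure) (sphere 0 1)"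
proof -
  have "(\<integral>\<^sup>+(z::'a). indicator (cball 0 R) z * riesz_kernel z \<partial>lborel)
    = (\<integral>\<^sup>+y. (\<integral>\<^sup>+s\<in>{0<..}. indicator (cball 0 R) (s *\<^sub>R y) \<partial>lborel) \<partial>(sphere_measure :: 'a measure))"
    by (rule nn_integral_polar[symmetric]) simp
  also have "\<dots> = (\<integral>\<^sup>+y. ennreal R \<partial>(sphere_measure :: 'a measure))"
  proof (rule nn_integral_cong)
    fix y :: 'a assume "y \<in> space sphere_measure"
    then have "norm y = 1" by simp
    then have "(\<integral>\<^sup>+s\<in>{0<..}. indicator (cball 0 R) (s *\<^sub>R y) \<partial>lborel) = (\<integral>\<^sup>+s. indicator {0<..R} s \<partial>lborel)"
      by (intro nn_integral_cong) (auto simp: indicator_def)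
    also have "\<dots> = ennreal R" using assms by simp
    finally show "(\<integral>\<^sup>+s\<in>{0<..}. indicator (cball 0 R) (s *\<^sub>R y) \<partial>lborel) = ennreal R" .
  qed
  finally show ?thesis by (simp add: mult.commute)
qed

text \<open>Among sets of given measure the ball centred at \<open>x\<close> is the worst case, up to a constant:
  outside the ball of radius \<open>|E|\<^bsup>1/n\<^esup>\<close> the kernel is at most \<open>|E|\<^bsup>(1-n)/n\<^esup>\<close>.\<close>

lemma nn_integral_riesz_kernel_set:
  obtains C :: real where "C > 0" and
    "\<And>(E :: 'a::euclidean_space set) x. E \<in> sets borel \<Longrightarrow> emeasure lborel E < \<infinity> \<Longrightarrow>
      (\<integral>\<^sup>+y\<in>E. riesz_kernel (y - x) \<partial>lborel) \<le> ennreal (C * measure lborel E powr (1 / DIM('a)))"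
proof
  let ?n = "real DIM('a)"
  define s where "s = measure (sphere_measure :: 'a measure) (sphere 0 1)"
  have s: "emeasure (sphere_measure :: 'a measure) (sphere 0 1) = ennreal s"
    unfolding s_def using emeasure_sphere_measure_finite[where 'a='a]
    by (simp add: emeasure_eq_ennreal_measure)
  have n: "?n \<ge> 1" using DIM_positive[where 'a='a] by linarith
  show "s + 1 > 0" by (simp add: s_def add_nonneg_pos)
  fix E :: "'a set" and x
  assume [measurable]: "E \<in> sets borel" and fin: "emeasure lborel E < \<infinity>"
  define m where "m = measure lborel E"
  have m: "emeasure lborel E = ennreal m" "m \<ge> 0" using fin by (auto simp: m_def emeasure_eq_ennreal_measure)
  show "(\<integral>\<^sup>+y\<in>E. riesz_kernel (y - x) \<partial>lborel) \<le> ennreal ((s + 1) * m powr (1 / ?n))"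
  proof (cases "m = 0")
    case True
    then have "E \<in> null_sets lborel" using m by (simp add: null_sets_def)
    then have "(\<integral>\<^sup>+y\<in>E. riesz_kernel (y - x) \<partial>lborel) = 0"
      by (simp add: nn_integral_null_set)
    then show ?thesis by simp
  next
    case False
    then have "m > 0" using m by simp
    define R where "R = m powr (1 / ?n)"
    have "R > 0" unfolding R_def using \<open>m > 0\<close> by simp
    have RR: "R powr (1 - ?n) * m = R"
      unfolding R_def using \<open>m > 0\<close> n by (simp add: powr_powr field_simps powr_diff flip: powr_add)
    have "(\<integral>\<^sup>+y\<in>E. riesz_kernel (y - x) \<partial>lborel) \<le>
      (\<integral>\<^sup>+y. indicator (cball 0 R) (y - x) * riesz_kernel (y - x) + ennreal (R powr (1 - ?n)) * indicator E y \<partial>lborel)"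
    proof (rule nn_integral_mono)
      fix y :: 'a
      have "riesz_kernel (y - x) \<le> ennreal (R powr (1 - ?n))" if "norm (y - x) > R"
        unfolding riesz_kernel_def using that \<open>R > 0\<close> n by (intro ennreal_leI powr_mono2') auto
      then show "riesz_kernel (y - x) * indicator E y \<le> indicator (cball 0 R) (y - x) * riesz_kernel (y - x) + ennreal (R powr (1 - ?n)) * indicator E y"
        by (auto simp: indicator_def not_le)
    qed
    also have "\<dots> = (\<integral>\<^sup>+y. indicator (cball 0 R) (y - x) * riesz_kernel (y - x) \<partial>lborel) + ennreal (R powr (1 - ?n)) * ennreal m"
      by (subst nn_integral_add) (auto simp: nn_integral_cmult m)
    also have "(\<integral>\<^sup>+y. indicator (cball 0 R) (y - x) * riesz_kernel (y - x) \<partial>lborel) = (\<integral>\<^sup>+z\<in>cball 0 R. riesz_kernel (z :: 'a) \<partial>lborel)"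
    proof -
      have "(\<integral>\<^sup>+y. indicator (cball 0 R) (y - x) * riesz_kernel (y - x) \<partial>lborel) = ennreal (\<bar>1\<bar> ^ DIM('a)) * (\<integral>\<^sup>+z. indicator (cball 0 R) (x + 1 *\<^sub>R z - x) * riesz_kernel (x + 1 *\<^sub>R z - x) \<partial>lborel)"
        by (rule nn_integral_dilation) simp_all
      then show ?thesis by (simp add: mult.commute)
    qed
    also have "\<dots> = ennreal (R * s)"
      using \<open>R > 0\<close> by (simp add: nn_integral_riesz_kernel_cball s ennreal_mult s_def)
    also have "ennreal (R * s) + ennreal (R powr (1 - ?n)) * ennreal m = ennreal ((s + 1) * m powr (1 / ?n))"
      using \<open>R > 0\<close> \<open>m > 0\<close> RR by (simp add: R_def[symmetric] s_def ennreal_mult[symmetric] algebra_simps flip: ennreal_plus)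
    finally show ?thesis .
  qed
qed

section \<open>Upper gradients\<close>

text \<open>Functions with a bound for their increments along segments. In contrast to a bound for the derivative,
  this is inherited by truncations. The parameter intervals are open so that passing to a part of a segment
  needs no discussion of end points.\<close>

definition upper_gradient :: "('a::euclidean_space \<Rightarrow> 'b::real_normed_vector) \<Rightarrow> ('a \<Rightarrow> ennreal) \<Rightarrow> bool" where
  "upper_gradient h G \<longleftrightarrow> (\<forall>x v a b. a \<le> b \<longrightarrow>
     ennreal (norm (h (x + b *\<^sub>R v) - h (x + a *\<^sub>R v))) \<le>
       (\<integral>\<^sup>+s\<in>{a<..<b}. G (x + s *\<^sub>R v) * ennreal (norm v) \<partial>lborel))"

lemma upper_gradientD:
  assumes "upper_gradient h G" "a \<le> b"
  shows "ennreal (norm (h (x + b *\<^sub>R v) - h (x + a *\<^sub>R v))) \<le>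
       (\<integral>\<^sup>+s\<in>{a<..<b}. G (x + s *\<^sub>R v) * ennreal (norm v) \<partial>lborel)"
  using assms unfolding upper_gradient_def by blast

lemma upper_gradient_norm_diff:
  assumes "upper_gradient h G"
  shows "upper_gradient (\<lambda>x. norm (h x - c)) G"
  unfolding upper_gradient_def
proof (intro allI impI)
  fix x v and a b :: real assume "a \<le> b"
  have "norm (norm (h (x + b *\<^sub>R v) - c) - norm (h (x + a *\<^sub>R v) - c)) \<le> norm (h (x + b *\<^sub>R v) - h (x + a *\<^sub>R v))"
    using norm_triangle_ineq3[of "h (x + b *\<^sub>R v) - c" "h (x + a *\<^sub>R v) - c"] by simp
  then show "ennreal (norm (norm (h (x + b *\<^sub>R v) - c) - norm (h (x + a *\<^sub>R v) - c))) \<le>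
     (\<integral>\<^sup>+s\<in>{a<..<b}. G (x + s *\<^sub>R v) * ennreal (norm v) \<partial>lborel)"
    using upper_gradientD[OF assms \<open>a \<le> b\<close>, of x v] by (meson ennreal_leI order_trans)
qed

lemma clamp_increment_upward:
  fixes \<phi> :: "real \<Rightarrow> real"
  assumes "a \<le> b" and cont: "continuous_on {a..b} \<phi>"
    and bound: "\<And>c d. a \<le> c \<Longrightarrow> c \<le> d \<Longrightarrow> d \<le> b \<Longrightarrow> ennreal \<bar>\<phi> d - \<phi> c\<bar> \<le> (\<integral>\<^sup>+s\<in>{c<..<d}. \<gamma> s \<partial>lborel)"
    and "\<alpha> \<le> \<beta>" and lt: "max \<alpha> (min \<beta> (\<phi> a)) < max \<alpha> (min \<beta> (\<phi> b))"
  shows "ennreal (max \<alpha> (min \<beta> (\<phi> b)) - max \<alpha> (min \<beta> (\<phi> a))) \<le>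
    (\<integral>\<^sup>+s\<in>{a<..<b}. \<gamma> s * indicator {\<alpha><..<\<beta>} (\<phi> s) \<partial>lborel)"
proof -
  define A where "A = max \<alpha> (min \<beta> (\<phi> a))"
  define B where "B = max \<alpha> (min \<beta> (\<phi> b))"
  have AB: "\<alpha> \<le> A" "A < B" "B \<le> \<beta>" "\<phi> a \<le> A" "B \<le> \<phi> b"
    using lt \<open>\<alpha> \<le> \<beta>\<close> unfolding A_def B_def by (auto simp: max_def min_def split: if_splits)
  have "closed {s\<in>{a..b}. B \<le> \<phi> s}"
    using continuous_on_closed_Collect_le[OF continuous_on_const cont, of B] by simp
  then have "compact {s\<in>{a..b}. B \<le> \<phi> s}"
    by (auto simp: compact_eq_bounded_closed intro: bounded_subset[OF bounded_closed_interval[of a b]])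
  moreover have "{s\<in>{a..b}. B \<le> \<phi> s} \<noteq> {}" using AB \<open>a \<le> b\<close> by auto
  \<comment> \<open>\<open>b'\<close> is the first time at which the upper end value is reached, and \<open>a'\<close> the last time before \<open>b'\<close>
    at which \<open>\<phi>\<close> is not above the lower one.\<close>
  ultimately obtain b' where b': "a \<le> b'" "b' \<le> b" "B \<le> \<phi> b'"
    and bmin: "\<And>t. a \<le> t \<Longrightarrow> t \<le> b \<Longrightarrow> B \<le> \<phi> t \<Longrightarrow> b' \<le> t"
    using compact_attains_inf[of "{s\<in>{a..b}. B \<le> \<phi> s}"] by auto
  have "closed {s\<in>{a..b'}. \<phi> s \<le> A}"
    using b' continuous_on_closed_Collect_le[OF continuous_on_subset[OF cont] continuous_on_const, of "{a..b'}" A] by simp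
  then have "compact {s\<in>{a..b'}. \<phi> s \<le> A}"
    by (auto simp: compact_eq_bounded_closed intro: bounded_subset[OF bounded_closed_interval[of a b']])
  moreover have "{s\<in>{a..b'}. \<phi> s \<le> A} \<noteq> {}" using AB b' by auto
  ultimately obtain a' where a': "a \<le> a'" "a' \<le> b'" "\<phi> a' \<le> A"
    and amax: "\<And>t. a \<le> t \<Longrightarrow> t \<le> b' \<Longrightarrow> \<phi> t \<le> A \<Longrightarrow> t \<le> a'"
    using compact_attains_sup[of "{s\<in>{a..b'}. \<phi> s \<le> A}"] by auto
  have "ennreal (B - A) \<le> ennreal \<bar>\<phi> b' - \<phi> a'\<bar>"
    using a' b' by (intro ennreal_leI) auto
  also have "\<dots> \<le> (\<integral>\<^sup>+s\<in>{a'<..<b'}. \<gamma> s \<partial>lborel)"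
    using a' b' by (intro bound) auto
  also have "\<dots> \<le> (\<integral>\<^sup>+s\<in>{a<..<b}. \<gamma> s * indicator {\<alpha><..<\<beta>} (\<phi> s) \<partial>lborel)"
  proof (rule nn_integral_mono)
    fix s
    have "\<alpha> < \<phi> s \<and> \<phi> s < \<beta>" if "a' < s" "s < b'"
      using amax[of s] bmin[of s] that a' b' AB by force
    then show "\<gamma> s * indicator {a'<..<b'} s \<le> \<gamma> s * indicator {\<alpha><..<\<beta>} (\<phi> s) * indicator {a<..<b} s"
      using a' b' by (auto simp: indicator_def)
  qed
  finally show ?thesis by (simp add: A_def B_def)
qed

text \<open>A part of the segment on which \<open>u\<close> passes from one truncated end value to the other, without meeting them
  in between, lies in the region \<open>\<alpha> < u < \<beta>\<close>, and the increment of \<open>u\<close> over this part is that of the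
  truncation over the whole segment.\<close>

lemma upper_gradient_truncation:
  fixes u :: "'a::euclidean_space \<Rightarrow> real"
  assumes u: "upper_gradient u G" and cont: "continuous_on UNIV u" and "\<alpha> \<le> \<beta>"
  shows "upper_gradient (\<lambda>x. max \<alpha> (min \<beta> (u x))) (\<lambda>x. G x * indicator {\<alpha><..<\<beta>} (u x))"
  unfolding upper_gradient_def
proof (intro allI impI)
  fix x v :: 'a and a b :: real assume "a \<le> b"
  define \<phi> where "\<phi> = (\<lambda>s. u (x + s *\<^sub>R v))"
  define \<gamma> where "\<gamma> = (\<lambda>s. G (x + s *\<^sub>R v) * ennreal (norm v))"
  have cphi: "continuous_on {a..b} \<phi>"
    unfolding \<phi>_def by (rule continuous_on_compose2[OF cont]) (auto intro!: continuous_intros)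
  have bound: "ennreal \<bar>\<phi> d - \<phi> c\<bar> \<le> (\<integral>\<^sup>+s\<in>{c<..<d}. \<gamma> s \<partial>lborel)" if "c \<le> d" for c d
    using upper_gradientD[OF u that, of x v] by (simp add: \<phi>_def \<gamma>_def)
  have eq: "(\<integral>\<^sup>+s\<in>{a<..<b}. G (x + s *\<^sub>R v) * indicator {\<alpha><..<\<beta>} (u (x + s *\<^sub>R v)) * ennreal (norm v) \<partial>lborel) =
     (\<integral>\<^sup>+s\<in>{a<..<b}. \<gamma> s * indicator {\<alpha><..<\<beta>} (\<phi> s) \<partial>lborel)"
    by (simp add: \<phi>_def \<gamma>_def mult_ac)
  consider "max \<alpha> (min \<beta> (\<phi> a)) < max \<alpha> (min \<beta> (\<phi> b))" | "max \<alpha> (min \<beta> (\<phi> b)) < max \<alpha> (min \<beta> (\<phi> a))"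
    | "max \<alpha> (min \<beta> (\<phi> a)) = max \<alpha> (min \<beta> (\<phi> b))" by linarith
  then have "ennreal \<bar>max \<alpha> (min \<beta> (\<phi> b)) - max \<alpha> (min \<beta> (\<phi> a))\<bar> \<le>
     (\<integral>\<^sup>+s\<in>{a<..<b}. \<gamma> s * indicator {\<alpha><..<\<beta>} (\<phi> s) \<partial>lborel)"
  proof cases
    case 1
    show ?thesis
      using clamp_increment_upward[OF \<open>a \<le> b\<close> cphi bound \<open>\<alpha> \<le> \<beta>\<close> 1] 1
      by (simp only: abs_of_pos diff_gt_0_iff_gt)
  next
    case 2
    have neg: "max (-\<beta>) (min (-\<alpha>) (-t)) = - max \<alpha> (min \<beta> t)" for t
      using \<open>\<alpha> \<le> \<beta>\<close> by (auto simp: max_def min_def)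
    have "ennreal (max (-\<beta>) (min (-\<alpha>) (-\<phi> b)) - max (-\<beta>) (min (-\<alpha>) (-\<phi> a))) \<le>
      (\<integral>\<^sup>+s\<in>{a<..<b}. \<gamma> s * indicator {-\<beta><..<-\<alpha>} (- \<phi> s) \<partial>lborel)"
    proof (rule clamp_increment_upward)
      show "continuous_on {a..b} (\<lambda>s. - \<phi> s)" using cphi by (intro continuous_intros)
      show "ennreal \<bar>- \<phi> d - - \<phi> c\<bar> \<le> (\<integral>\<^sup>+s\<in>{c<..<d}. \<gamma> s \<partial>lborel)" if "c \<le> d" for c d
        using bound[OF that] by (simp add: abs_minus_commute)
    qed (use 2 \<open>a \<le> b\<close> \<open>\<alpha> \<le> \<beta>\<close> neg in auto)
    moreover have "indicator {-\<beta><..<-\<alpha>} (- t) = (indicator {\<alpha><..<\<beta>} t :: ennreal)" for t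
      by (auto simp: indicator_def)
    ultimately show ?thesis
      using 2 by (simp only: neg abs_of_neg diff_less_0_iff_less minus_diff_eq minus_diff_minus)
  qed simp
  then show "ennreal (norm (max \<alpha> (min \<beta> (u (x + b *\<^sub>R v))) - max \<alpha> (min \<beta> (u (x + a *\<^sub>R v))))) \<le>
     (\<integral>\<^sup>+s\<in>{a<..<b}. G (x + s *\<^sub>R v) * indicator {\<alpha><..<\<beta>} (u (x + s *\<^sub>R v)) * ennreal (norm v) \<partial>lborel)"
    unfolding eq by (simp add: \<phi>_def)
qed

section \<open>The Poincare inequality on cubes\<close>

lemma emeasure_cube: "l \<ge> 0 \<Longrightarrow> emeasure lborel (cube (a::'a::euclidean_space) l) = ennreal (l ^ DIM('a))"
  by (simp add: cube_def emeasure_lborel_cbox_eq inner_add_left)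

lemma measure_cube: "l \<ge> 0 \<Longrightarrow> measure lborel (cube (a::'a::euclidean_space) l) = l ^ DIM('a)"
  by (simp add: measure_def emeasure_cube)

lemma cube_measurable [measurable, simp]: "cube a l \<in> sets borel"
  by (simp add: cube_def)

lemma measure_subset_cube:
  fixes A :: "'a::euclidean_space set"
  assumes "A \<subseteq> cube a l" "A \<in> sets borel" and "l \<ge> 0"
  shows "emeasure lborel A = ennreal (measure lborel A)" and "measure lborel A \<le> l ^ DIM('a)"
proof -
  have le: "emeasure lborel A \<le> ennreal (l ^ DIM('a))"
    using emeasure_mono[of A "cube a l" lborel] assms by (simp add: emeasure_cube)
  then have "emeasure lborel A < \<infinity>" using le_less_trans by fastforce
  then show 2: "emeasure lborel A = ennreal (measure lborel A)" by (simp add: emeasure_eq_ennreal_measure)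
  show "measure lborel A \<le> l ^ DIM('a)" using le \<open>l \<ge> 0\<close> by (simp add: 2)
qed

lemma measure_level_set_cube:
  fixes u :: "'a::euclidean_space \<Rightarrow> real"
  assumes [measurable]: "u \<in> borel_measurable borel" and "l \<ge> 0"
  shows "emeasure lborel {y\<in>cube a l. t < u y} = ennreal (measure lborel {y\<in>cube a l. t < u y})"
    and "measure lborel {y\<in>cube a l. t < u y} \<le> l ^ DIM('a)"
  by (rule measure_subset_cube[OF _ _ \<open>l \<ge> 0\<close>]; auto)+

lemma convex_cube: "convex (cube a l)"
  by (simp add: cube_def)

lemma mem_cube: "y \<in> cube (a::'a::euclidean_space) l \<longleftrightarrow> (\<forall>i\<in>Basis. a \<bullet> i \<le> y \<bullet> i \<and> y \<bullet> i \<le> a \<bullet> i + l)"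
  by (simp add: cube_def mem_box inner_add_left)

lemma norm_diff_cube_le:
  fixes x z :: "'a::euclidean_space" and l :: real
  assumes "x \<in> cube a l" "z \<in> cube a l"
  shows "norm (z - x) \<le> DIM('a) * l"
proof -
  have "norm (z - x) \<le> (\<Sum>i\<in>Basis. \<bar>(z - x) \<bullet> i\<bar>)" by (rule norm_le_l1)
  also have "\<dots> \<le> (\<Sum>i\<in>(Basis::'a set). l)"
    using assms by (intro sum_mono) (force simp: mem_cube inner_diff_left abs_le_iff)
  finally show ?thesis by simp
qed

lemma riesz_kernel_minus: "riesz_kernel (x - y) = riesz_kernel (y - x)"
  by (simp add: riesz_kernel_def norm_minus_commute)

text \<open>The segment from \<open>x\<close> to a point \<open>z\<close> of the cube stays in the cube; integrating the gradient along these
  segments and over \<open>z\<close> weights each point \<open>y\<close> with the kernel, because points near \<open>x\<close> lie on more of them.\<close>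

lemma oscillation_on_cube_le_potential:
  fixes h :: "'a::euclidean_space \<Rightarrow> 'b::real_normed_vector"
  assumes h: "upper_gradient h G" and [measurable]: "G \<in> borel_measurable borel"
    and "l > 0" and x: "x \<in> cube a l"
  shows "(\<integral>\<^sup>+z\<in>cube a l. ennreal (norm (h z - h x)) \<partial>lborel) \<le>
    ennreal (real DIM('a) ^ DIM('a) / DIM('a) * l ^ DIM('a)) * (\<integral>\<^sup>+y\<in>cube a l. G y * riesz_kernel (y - x) \<partial>lborel)"
proof -
  let ?Q = "cube a l"
  define D where "D = real DIM('a) * l"
  have "D > 0" using \<open>l > 0\<close> by (simp add: D_def)
  define H where "H = (\<lambda>y. G (x + y) * indicator ?Q (x + y))"
  have [measurable]: "H \<in> borel_measurable borel" unfolding H_def by measurable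
  have "(\<integral>\<^sup>+z\<in>?Q. ennreal (norm (h z - h x)) \<partial>lborel) \<le>
    (\<integral>\<^sup>+z\<in>?Q. (\<integral>\<^sup>+s\<in>{0<..<1}. G (x + s *\<^sub>R (z - x)) * ennreal (norm (z - x)) \<partial>lborel) \<partial>lborel)"
    using upper_gradientD[OF h, of 0 1 x "z - x" for z] by (intro nn_integral_mono mult_right_mono) simp_all
  also have "\<dots> = ennreal (\<bar>1\<bar> ^ DIM('a)) * (\<integral>\<^sup>+z. (\<integral>\<^sup>+s\<in>{0<..<1}. G (x + s *\<^sub>R (x + 1 *\<^sub>R z - x)) * ennreal (norm (x + 1 *\<^sub>R z - x)) \<partial>lborel)
      * indicator ?Q (x + 1 *\<^sub>R z) \<partial>lborel)"
    by (rule nn_integral_dilation) measurable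
  also have "\<dots> = (\<integral>\<^sup>+z. (\<integral>\<^sup>+s\<in>{0<..<1}. G (x + s *\<^sub>R z) * ennreal (norm z) \<partial>lborel) * indicator ?Q (x + z) \<partial>lborel)"
    by simp
  also have "\<dots> = (\<integral>\<^sup>+z. (\<integral>\<^sup>+s. G (x + s *\<^sub>R z) * ennreal (norm z) * indicator {0<..<1} s * indicator ?Q (x + z) \<partial>lborel) \<partial>lborel)"
    by (intro nn_integral_cong nn_integral_multc[symmetric]) auto
  also have "\<dots> \<le> (\<integral>\<^sup>+z. (\<integral>\<^sup>+s. H (s *\<^sub>R z) * ennreal (norm z) * indicator {0<..} s * indicator (cball 0 D) z \<partial>lborel) \<partial>lborel)"
  proof (intro nn_integral_mono)
    fix z :: 'a and s :: real
    have "x + s *\<^sub>R z \<in> ?Q" "norm z \<le> D" if "x + z \<in> ?Q" "0 < s" "s < 1"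
    proof -
      have "(1 - s) *\<^sub>R x + s *\<^sub>R (x + z) \<in> ?Q"
        using convex_cube[of a l] x that by (intro convexD) auto
      then show "x + s *\<^sub>R z \<in> ?Q" by (simp add: algebra_simps)
      show "norm z \<le> D" using norm_diff_cube_le[OF x that(1)] by (simp add: D_def)
    qed
    then show "G (x + s *\<^sub>R z) * ennreal (norm z) * indicator {0<..<1} s * indicator ?Q (x + z)
      \<le> H (s *\<^sub>R z) * ennreal (norm z) * indicator {0<..} s * indicator (cball 0 D) z"
      by (auto simp: indicator_def H_def)
  qed
  also have "\<dots> = (\<integral>\<^sup>+s. (\<integral>\<^sup>+z. H (s *\<^sub>R z) * ennreal (norm z) * indicator {0<..} s * indicator (cball 0 D) z \<partial>lborel) \<partial>lborel)"
  proof -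
    have "(\<lambda>(z, s). H (s *\<^sub>R z) * ennreal (norm z) * indicator {0<..} s * indicator (cball 0 D) z)
      \<in> borel_measurable (lborel \<Otimes>\<^sub>M lborel)" by measurable
    from lborel_pair.Fubini'[OF this] show ?thesis by simp
  qed
  also have "\<dots> = (\<integral>\<^sup>+s\<in>{0<..}. (\<integral>\<^sup>+z\<in>cball 0 D. H (s *\<^sub>R z) * ennreal (norm z) \<partial>lborel) \<partial>lborel)"
  proof (rule nn_integral_cong)
    fix s :: real
    show "(\<integral>\<^sup>+z. H (s *\<^sub>R z) * ennreal (norm z) * indicator {0<..} s * indicator (cball 0 D) z \<partial>lborel)
      = (\<integral>\<^sup>+z\<in>cball 0 D. H (s *\<^sub>R z) * ennreal (norm z) \<partial>lborel) * indicator {0<..} s"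
      by (cases "s > 0") simp_all
  qed
  also have "\<dots> = ennreal (D ^ DIM('a) / DIM('a)) * (\<integral>\<^sup>+y. H y * riesz_kernel y \<partial>lborel)"
    by (rule nn_integral_rays_ball) (use \<open>D > 0\<close> in auto)
  also have "(\<integral>\<^sup>+y. H y * riesz_kernel y \<partial>lborel) = (\<integral>\<^sup>+y\<in>?Q. G y * riesz_kernel (y - x) \<partial>lborel)"
  proof -
    have "(\<integral>\<^sup>+y\<in>?Q. G y * riesz_kernel (y - x) \<partial>lborel) =
      ennreal (\<bar>1\<bar> ^ DIM('a)) * (\<integral>\<^sup>+y. G (x + 1 *\<^sub>R y) * riesz_kernel (x + 1 *\<^sub>R y - x) * indicator ?Q (x + 1 *\<^sub>R y) \<partial>lborel)"
      by (rule nn_integral_dilation) auto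
    then show ?thesis by (simp add: H_def mult_ac)
  qed
  finally show ?thesis by (simp add: D_def power_mult_distrib)
qed

text \<open>Fubini's theorem moves the integral over \<open>E\<close> onto the kernel. For \<open>E\<close> the whole cube this is the
  \<open>L\<^sup>1\<close> Poincare inequality; for superlevel sets it gives the weak-type estimate below.\<close>

lemma oscillation_over_subset_of_cube_le:
  obtains C :: real where "C > 0" and
    "\<And>(h :: 'a::euclidean_space \<Rightarrow> 'b::real_normed_vector) G a l E. upper_gradient h G \<Longrightarrow> continuous_on UNIV h \<Longrightarrow> G \<in> borel_measurable borel \<Longrightarrow> l > 0 \<Longrightarrow>
      E \<in> sets borel \<Longrightarrow> E \<subseteq> cube a l \<Longrightarrow>
      (\<integral>\<^sup>+x\<in>E. (\<integral>\<^sup>+z\<in>cube a l. ennreal (norm (h z - h x)) \<partial>lborel) \<partial>lborel) \<le>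
        ennreal (C * l ^ DIM('a) * measure lborel E powr (1 / DIM('a))) * (\<integral>\<^sup>+y\<in>cube a l. G y \<partial>lborel)"
proof -
  let ?n = "real DIM('a)"
  obtain C1 where C1: "C1 > 0"
    "\<And>(E :: 'a set) x. E \<in> sets borel \<Longrightarrow> emeasure lborel E < \<infinity> \<Longrightarrow>
      (\<integral>\<^sup>+y\<in>E. riesz_kernel (y - x) \<partial>lborel) \<le> ennreal (C1 * measure lborel E powr (1 / DIM('a)))"
    using nn_integral_riesz_kernel_set by blast
  define c where "c = ?n ^ DIM('a) / ?n"
  have "c > 0" by (simp add: c_def)
  show thesis
  proof (rule that[of "c * C1"])
    show "c * C1 > 0" using \<open>c > 0\<close> C1 by simp
    fix h :: "'a \<Rightarrow> 'b" and G a l and E :: "'a set"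
    assume h: "upper_gradient h G" and "continuous_on UNIV h" and [measurable]: "G \<in> borel_measurable borel"
      and "l > 0" and [measurable]: "E \<in> sets borel" and E: "E \<subseteq> cube a l"
    let ?Q = "cube a l :: 'a set"
    have Efin: "emeasure lborel E < \<infinity>"
      using measure_subset_cube(1)[OF E] \<open>l > 0\<close> by simp
    have "(\<integral>\<^sup>+x\<in>E. (\<integral>\<^sup>+z\<in>?Q. ennreal (norm (h z - h x)) \<partial>lborel) \<partial>lborel) \<le>
      (\<integral>\<^sup>+x. ennreal (c * l ^ DIM('a)) * ((\<integral>\<^sup>+y. G y * riesz_kernel (y - x) * indicator ?Q y \<partial>lborel) * indicator E x) \<partial>lborel)"
    proof (rule nn_integral_mono)
      fix x :: 'a
      show "(\<integral>\<^sup>+z\<in>?Q. ennreal (norm (h z - h x)) \<partial>lborel) * indicator E x \<le>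
        ennreal (c * l ^ DIM('a)) * ((\<integral>\<^sup>+y. G y * riesz_kernel (y - x) * indicator ?Q y \<partial>lborel) * indicator E x)"
        using oscillation_on_cube_le_potential[OF h \<open>G \<in> borel_measurable borel\<close> \<open>l > 0\<close>, of x a] E
        by (cases "x \<in> E") (auto simp: c_def)
    qed
    also have "\<dots> = ennreal (c * l ^ DIM('a)) * (\<integral>\<^sup>+x. (\<integral>\<^sup>+y. G y * riesz_kernel (y - x) * indicator ?Q y \<partial>lborel) * indicator E x \<partial>lborel)"
      by (rule nn_integral_cmult) measurable
    also have "(\<integral>\<^sup>+x. (\<integral>\<^sup>+y. G y * riesz_kernel (y - x) * indicator ?Q y \<partial>lborel) * indicator E x \<partial>lborel)
      = (\<integral>\<^sup>+x. (\<integral>\<^sup>+y. G y * riesz_kernel (y - x) * indicator ?Q y * indicator E x \<partial>lborel) \<partial>lborel)"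
      by (intro nn_integral_cong nn_integral_multc[symmetric]) measurable
    also have "\<dots> = (\<integral>\<^sup>+y. (\<integral>\<^sup>+x. G y * riesz_kernel (y - x) * indicator ?Q y * indicator E x \<partial>lborel) \<partial>lborel)"
    proof -
      have "(\<lambda>(x, y). G y * riesz_kernel (y - x) * indicator ?Q y * indicator E x) \<in> borel_measurable (lborel \<Otimes>\<^sub>M lborel)"
        by measurable
      from lborel_pair.Fubini'[OF this] show ?thesis by simp
    qed
    also have "\<dots> \<le> (\<integral>\<^sup>+y. ennreal (C1 * measure lborel E powr (1 / ?n)) * (G y * indicator ?Q y) \<partial>lborel)"
    proof (rule nn_integral_mono)
      fix y :: 'a
      have "(\<integral>\<^sup>+x. G y * riesz_kernel (y - x) * indicator ?Q y * indicator E x \<partial>lborel)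
        = (\<integral>\<^sup>+x. (G y * indicator ?Q y) * (riesz_kernel (x - y) * indicator E x) \<partial>lborel)"
        by (intro nn_integral_cong) (simp add: riesz_kernel_minus[of y] mult_ac)
      also have "\<dots> = (G y * indicator ?Q y) * (\<integral>\<^sup>+x\<in>E. riesz_kernel (x - y) \<partial>lborel)"
        by (rule nn_integral_cmult) measurable
      also have "\<dots> \<le> (G y * indicator ?Q y) * ennreal (C1 * measure lborel E powr (1 / ?n))"
        by (intro mult_left_mono C1 Efin) auto
      finally show "(\<integral>\<^sup>+x. G y * riesz_kernel (y - x) * indicator ?Q y * indicator E x \<partial>lborel)
        \<le> ennreal (C1 * measure lborel E powr (1 / ?n)) * (G y * indicator ?Q y)"
        by (simp add: mult.commute)
    qed
    also have "\<dots> = ennreal (C1 * measure lborel E powr (1 / ?n)) * (\<integral>\<^sup>+y\<in>?Q. G y \<partial>lborel)"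
      by (rule nn_integral_cmult) measurable
    finally have "(\<integral>\<^sup>+x\<in>E. (\<integral>\<^sup>+z\<in>?Q. ennreal (norm (h z - h x)) \<partial>lborel) \<partial>lborel) \<le>
      ennreal (c * l ^ DIM('a)) * (ennreal (C1 * measure lborel E powr (1 / ?n)) * (\<integral>\<^sup>+y\<in>?Q. G y \<partial>lborel))"
      by (simp add: mult_left_mono)
    also have "\<dots> = ennreal (c * C1 * l ^ DIM('a) * measure lborel E powr (1 / DIM('a))) * (\<integral>\<^sup>+y\<in>?Q. G y \<partial>lborel)"
    proof -
      have "ennreal (c * l ^ DIM('a)) * ennreal (C1 * measure lborel E powr (1 / ?n)) = ennreal (c * C1 * l ^ DIM('a) * measure lborel E powr (1 / DIM('a)))"
        using \<open>c > 0\<close> \<open>l > 0\<close> C1(1) by (subst ennreal_mult[symmetric]) (auto simp: mult_ac)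
      then show ?thesis by (simp flip: mult.assoc)
    qed
    finally show "(\<integral>\<^sup>+x\<in>E. (\<integral>\<^sup>+z\<in>?Q. ennreal (norm (h z - h x)) \<partial>lborel) \<partial>lborel) \<le> ennreal (c * C1 * l ^ DIM('a) * measure lborel E powr (1 / DIM('a))) * (\<integral>\<^sup>+y\<in>?Q. G y \<partial>lborel)" .
  qed
qed

lemma dyadic_intervals:
  fixes c :: real
  assumes "c > 0"
  shows disjoint_dyadic_intervals: "disjoint_family (\<lambda>i. {c * 2 ^ i<..c * 2 ^ Suc i})"
    and UN_dyadic_intervals: "(\<Union>i. {c * 2 ^ i<..c * 2 ^ Suc i}) = {c<..}"
proof -
  have mono: "c * 2 ^ Suc i \<le> c * 2 ^ j" if "i < j" for i j :: nat
    using assms that by (intro mult_left_mono power_increasing) auto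
  show "disjoint_family (\<lambda>i. {c * 2 ^ i<..c * 2 ^ Suc i})"
  proof (unfold disjoint_family_on_def, intro ballI impI)
    fix i j :: nat assume "i \<noteq> j"
    then consider "i < j" | "j < i" by linarith
    then show "{c * 2 ^ i<..c * 2 ^ Suc i} \<inter> {c * 2 ^ j<..c * 2 ^ Suc j} = {}"
      using mono[of i j] mono[of j i] by cases force+
  qed
  show "(\<Union>i. {c * 2 ^ i<..c * 2 ^ Suc i}) = {c<..}"
  proof (intro equalityI subsetI)
    fix t assume "t \<in> (\<Union>i. {c * 2 ^ i<..c * 2 ^ Suc i})"
    then obtain i where "c * 2 ^ i < t" by auto
    moreover have "c * 1 \<le> c * 2 ^ i" using assms by (intro mult_left_mono) auto
    ultimately show "t \<in> {c<..}" by simp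
  next
    fix t assume t: "t \<in> {c<..}"
    obtain N :: nat where "t / c < 2 ^ N" using real_arch_pow[of 2 "t / c"] by auto
    then have ex: "t \<le> c * 2 ^ N" using assms by (simp add: field_simps)
    define m where "m = (LEAST N. t \<le> c * 2 ^ N)"
    have m: "t \<le> c * 2 ^ m" unfolding m_def by (rule LeastI[of _ N]) (rule ex)
    have "m \<noteq> 0" using m t by (intro notI) simp
    then obtain i where i: "m = Suc i" using not0_implies_Suc by blast
    have "\<not> t \<le> c * 2 ^ i" using not_less_Least[of i "\<lambda>N. t \<le> c * 2 ^ N"] i unfolding m_def by simp
    then show "t \<in> (\<Union>i. {c * 2 ^ i<..c * 2 ^ Suc i})" using m i by (intro UN_I[of i]) auto
  qed
qed

text \<open>The truncation at heights \<open>\<alpha>\<close> and \<open>\<beta>\<close> takes its least value on half of the cube, so at a point where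
  \<open>u > \<beta>\<close> its mean oscillation is at least \<open>(\<beta> - \<alpha>) / 2\<close>. Integrating over all such points and cancelling a
  power of the measure of this set gives the claim.\<close>

lemma weak_type_truncation:
  obtains C :: real where "C > 0" and
    "\<And>(u :: 'a::euclidean_space \<Rightarrow> real) G a l \<alpha> \<beta>. upper_gradient u G \<Longrightarrow> continuous_on UNIV u \<Longrightarrow> G \<in> borel_measurable borel \<Longrightarrow> l > 0 \<Longrightarrow>
      \<alpha> < \<beta> \<Longrightarrow> measure lborel {x\<in>cube a l. \<alpha> < u x} \<le> l ^ DIM('a) / 2 \<Longrightarrow>
      ennreal ((\<beta> - \<alpha>) * measure lborel {x\<in>cube a l. \<beta> < u x} powr (1 - 1 / DIM('a))) \<le>
        ennreal C * (\<integral>\<^sup>+y\<in>cube a l. G y * indicator {\<alpha><..\<beta>} (u y) \<partial>lborel)"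
proof -
  let ?n = "real DIM('a)"
  obtain C0 :: real where "C0 > 0" and C0:
    "\<And>(h :: 'a \<Rightarrow> real) G a l E. upper_gradient h G \<Longrightarrow> continuous_on UNIV h \<Longrightarrow> G \<in> borel_measurable borel \<Longrightarrow> l > 0 \<Longrightarrow>
      E \<in> sets borel \<Longrightarrow> E \<subseteq> cube a l \<Longrightarrow>
      (\<integral>\<^sup>+x\<in>E. (\<integral>\<^sup>+z\<in>cube a l. ennreal (norm (h z - h x)) \<partial>lborel) \<partial>lborel) \<le>
        ennreal (C0 * l ^ DIM('a) * measure lborel E powr (1 / DIM('a))) * (\<integral>\<^sup>+y\<in>cube a l. G y \<partial>lborel)"
    using oscillation_over_subset_of_cube_le[where 'a='a and 'b=real] by blast
  show thesis
  proof (rule that[of "2 * C0"])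
    show "2 * C0 > 0" using \<open>C0 > 0\<close> by simp
    fix u :: "'a \<Rightarrow> real" and G a l \<alpha> \<beta>
    assume u: "upper_gradient u G" and cont: "continuous_on UNIV u" and [measurable]: "G \<in> borel_measurable borel"
      and "l > 0" and "\<alpha> < \<beta>" and half: "measure lborel {x\<in>cube a l. \<alpha> < u x} \<le> l ^ DIM('a) / 2"
    let ?Q = "cube a l :: 'a set"
    define E where "E = {x\<in>?Q. \<beta> < u x}"
    define H where "H = (\<lambda>y. G y * indicator {\<alpha><..<\<beta>} (u y))"
    define h where "h = (\<lambda>x. max \<alpha> (min \<beta> (u x)))"
    have [measurable]: "u \<in> borel_measurable borel" using cont by (rule borel_measurable_continuous_onI)
    have Em [measurable]: "E \<in> sets borel" unfolding E_def by measurable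
    have [measurable]: "H \<in> borel_measurable borel" unfolding H_def by measurable
    have h: "upper_gradient h H" unfolding h_def H_def using u cont \<open>\<alpha> < \<beta>\<close> by (intro upper_gradient_truncation) auto
    have hc: "continuous_on UNIV h" unfolding h_def by (intro continuous_intros cont)
    have sub: "emeasure lborel A = ennreal (measure lborel A)" if "A \<subseteq> ?Q" "A \<in> sets borel" for A
      using measure_subset_cube(1)[OF that] \<open>l > 0\<close> by simp
    define m where "m = measure lborel E"
    have m: "emeasure lborel E = ennreal m" "0 \<le> m" using sub[of E] Em by (auto simp: E_def m_def)
    define K where "K = {z\<in>?Q. u z \<le> \<alpha>}"
    have Km [measurable]: "K \<in> sets borel" unfolding K_def by measurable
    have mK: "l ^ DIM('a) / 2 \<le> measure lborel K"
    proof -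
      have "l ^ DIM('a) = measure lborel ({x\<in>?Q. \<alpha> < u x} \<union> K)"
        using \<open>l > 0\<close> by (subst measure_cube[of l a, symmetric]) (auto simp: K_def intro!: arg_cong[where f="measure lborel"])
      also have "\<dots> \<le> measure lborel {x\<in>?Q. \<alpha> < u x} + measure lborel K"
        by (rule measure_Un_le) auto
      finally show ?thesis using half by simp
    qed
    have low: "ennreal ((\<beta> - \<alpha>) * (l ^ DIM('a) / 2)) \<le> (\<integral>\<^sup>+z\<in>?Q. ennreal (norm (h z - h x)) \<partial>lborel)" if "x \<in> E" for x
    proof -
      have "ennreal ((\<beta> - \<alpha>) * (l ^ DIM('a) / 2)) \<le> ennreal ((\<beta> - \<alpha>) * measure lborel K)"
        using mK \<open>\<alpha> < \<beta>\<close> by (intro ennreal_leI mult_left_mono) auto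
      also have "\<dots> = (\<integral>\<^sup>+z. ennreal (\<beta> - \<alpha>) * indicator K z \<partial>lborel)"
        using \<open>\<alpha> < \<beta>\<close> sub[of K] Km by (simp add: nn_integral_cmult ennreal_mult K_def)
      also have "\<dots> \<le> (\<integral>\<^sup>+z\<in>?Q. ennreal (norm (h z - h x)) \<partial>lborel)"
        using that \<open>\<alpha> < \<beta>\<close> by (intro nn_integral_mono) (auto simp: indicator_def K_def E_def h_def)
      finally show ?thesis .
    qed
    have "ennreal ((\<beta> - \<alpha>) * (l ^ DIM('a) / 2) * m) = (\<integral>\<^sup>+x. ennreal ((\<beta> - \<alpha>) * (l ^ DIM('a) / 2)) * indicator E x \<partial>lborel)"
      using m \<open>\<alpha> < \<beta>\<close> \<open>l > 0\<close> by (simp add: nn_integral_cmult flip: ennreal_mult)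
    also have "\<dots> \<le> (\<integral>\<^sup>+x\<in>E. (\<integral>\<^sup>+z\<in>?Q. ennreal (norm (h z - h x)) \<partial>lborel) \<partial>lborel)"
      using low by (intro nn_integral_mono) (auto simp: indicator_def)
    also have "\<dots> \<le> ennreal (C0 * l ^ DIM('a) * m powr (1 / ?n)) * (\<integral>\<^sup>+y\<in>?Q. H y \<partial>lborel)"
      unfolding m_def using \<open>l > 0\<close> by (intro C0 h hc) (auto simp: E_def)
    finally have main: "ennreal ((\<beta> - \<alpha>) * (l ^ DIM('a) / 2) * m) \<le> ennreal (C0 * l ^ DIM('a) * m powr (1 / ?n)) * (\<integral>\<^sup>+y\<in>?Q. H y \<partial>lborel)" .
    have "ennreal ((\<beta> - \<alpha>) * m powr (1 - 1 / ?n)) \<le> ennreal (2 * C0) * (\<integral>\<^sup>+y\<in>?Q. H y \<partial>lborel)"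
    proof (cases "m = 0")
      case False
      then have "m > 0" using m by simp
      define k where "k = 2 / (l ^ DIM('a) * m powr (1 / ?n))"
      have "k > 0" using \<open>m > 0\<close> \<open>l > 0\<close> by (simp add: k_def)
      have "ennreal ((\<beta> - \<alpha>) * m powr (1 - 1 / ?n)) = ennreal k * ennreal ((\<beta> - \<alpha>) * (l ^ DIM('a) / 2) * m)"
      proof -
        have "m powr (1 - 1 / ?n) * m powr (1 / ?n) = m"
          using \<open>m > 0\<close> by (simp flip: powr_add)
        then have "m powr (1 - 1 / ?n) = m / m powr (1 / ?n)"
          using \<open>m > 0\<close> by (simp add: nonzero_eq_divide_eq)
        then have "(\<beta> - \<alpha>) * m powr (1 - 1 / ?n) = k * ((\<beta> - \<alpha>) * (l ^ DIM('a) / 2) * m)"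
          using \<open>l > 0\<close> by (simp add: k_def)
        then show ?thesis
          using \<open>m > 0\<close> \<open>l > 0\<close> \<open>\<alpha> < \<beta>\<close> \<open>k > 0\<close> by (simp flip: ennreal_mult)
      qed
      also have "\<dots> \<le> ennreal k * (ennreal (C0 * l ^ DIM('a) * m powr (1 / ?n)) * (\<integral>\<^sup>+y\<in>?Q. H y \<partial>lborel))"
        by (intro mult_left_mono main) simp
      also have "\<dots> = ennreal (2 * C0) * (\<integral>\<^sup>+y\<in>?Q. H y \<partial>lborel)"
      proof -
        have "ennreal k * ennreal (C0 * l ^ DIM('a) * m powr (1 / ?n)) = ennreal (2 * C0)"
          using \<open>m > 0\<close> \<open>l > 0\<close> \<open>C0 > 0\<close> \<open>k > 0\<close> by (subst ennreal_mult[symmetric]) (auto simp: k_def)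
        then show ?thesis by (simp flip: mult.assoc)
      qed
      finally show ?thesis .
    qed simp
    also have "\<dots> \<le> ennreal (2 * C0) * (\<integral>\<^sup>+y\<in>?Q. G y * indicator {\<alpha><..\<beta>} (u y) \<partial>lborel)"
      by (intro mult_left_mono nn_integral_mono) (auto simp: H_def indicator_def)
    finally show "ennreal ((\<beta> - \<alpha>) * measure lborel {x\<in>?Q. \<beta> < u x} powr (1 - 1 / DIM('a))) \<le>
        ennreal (2 * C0) * (\<integral>\<^sup>+y\<in>?Q. G y * indicator {\<alpha><..\<beta>} (u y) \<partial>lborel)"
      by (simp add: m_def E_def)
  qed
qed

lemma term_le_suminf: "F i \<le> (\<Sum>i. F i)" for F :: "nat \<Rightarrow> ennreal"
  using sum_le_suminf[of F "{i}"] by simp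

lemma nn_integral_powr_le_dyadic_sum:
  fixes V :: "real \<Rightarrow> real" and q :: real
  assumes "\<And>s t. s \<le> t \<Longrightarrow> V t \<le> V s" "\<And>t. 0 \<le> V t" and "0 \<le> q" "\<mu> > 0" and top: "V 0 \<le> M"
  shows "(\<integral>\<^sup>+t\<in>{0<..}. ennreal (V t powr q) \<partial>lborel) \<le>
    ennreal (\<mu> * M powr q) + (\<Sum>i. ennreal (\<mu> * 2 ^ i * V (\<mu> * 2 ^ i) powr q))"
proof -
  let ?I = "\<lambda>i. {\<mu> * 2 ^ i<..\<mu> * 2 ^ Suc i}"
  have "(\<integral>\<^sup>+t\<in>{0<..}. ennreal (V t powr q) \<partial>lborel) \<le>
    (\<integral>\<^sup>+t. ennreal (M powr q) * indicator {0<..\<mu>} t + (\<Sum>i. ennreal (V (\<mu> * 2 ^ i) powr q) * indicator (?I i) t) \<partial>lborel)"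
  proof (rule nn_integral_mono)
    fix t :: real
    have "\<exists>i. t \<in> ?I i" if "\<mu> < t"
    proof -
      have "t \<in> (\<Union>i. ?I i)" unfolding UN_dyadic_intervals[OF \<open>\<mu> > 0\<close>] using that by simp
      then show ?thesis by blast
    qed
    then consider "t \<le> 0" | "0 < t" "t \<le> \<mu>" | i where "t \<in> ?I i"
      by (meson not_le)
    then show "ennreal (V t powr q) * indicator {0<..} t \<le> ennreal (M powr q) * indicator {0<..\<mu>} t + (\<Sum>i. ennreal (V (\<mu> * 2 ^ i) powr q) * indicator (?I i) t)"
    proof cases
      case 2
      have "V t \<le> M" using assms(1)[of 0 t] 2 top by linarith
      then have "V t powr q \<le> M powr q" using assms by (intro powr_mono2) auto
      then show ?thesis using 2 by (auto simp: ennreal_leI intro: add_increasing2)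
    next
      case 3
      have "V t powr q \<le> V (\<mu> * 2 ^ i) powr q" using assms 3 by (intro powr_mono2) auto
      then have "ennreal (V t powr q) * indicator {0<..} t \<le> ennreal (V (\<mu> * 2 ^ i) powr q) * indicator (?I i) t"
        using 3 by (auto simp: indicator_def ennreal_leI)
      also have "\<dots> \<le> (\<Sum>i. ennreal (V (\<mu> * 2 ^ i) powr q) * indicator (?I i) t)"
        by (rule term_le_suminf)
      finally show ?thesis by (rule order_trans) (rule add_increasing, auto)
    qed simp
  qed
  also have "\<dots> = ennreal (M powr q) * ennreal \<mu> + (\<Sum>i. ennreal (V (\<mu> * 2 ^ i) powr q) * ennreal (\<mu> * 2 ^ i))"
    using \<open>\<mu> > 0\<close> by (simp add: nn_integral_add nn_integral_cmult nn_integral_suminf)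
  finally show ?thesis using \<open>\<mu> > 0\<close> by (simp add: ennreal_mult mult_ac)
qed

text \<open>A weak-type bound suffices for the stronger \<open>L\<^bsup>n',1\<^esup>\<close> estimate: applied to the truncations of
  \<open>norm (f - c)\<close> between the heights \<open>\<mu> 2\<^sup>i\<close> and \<open>\<mu> 2\<^bsup>i+1\<^esup>\<close>, its right sides involve the gradient on
  disjoint sets and can be summed (Maz'ya's truncation method). The initial height \<open>\<mu>\<close> must be large enough that
  \<open>norm (f - c) \<le> \<mu>\<close> on half of the cube; the \<open>L\<^sup>1\<close> inequality shows how small it may be chosen.\<close>

lemma lorentz_poincare:
  obtains C :: real where "C > 0" and
    "\<And>(f :: 'a::euclidean_space \<Rightarrow> 'b::real_normed_vector) G a l. upper_gradient f G \<Longrightarrow> continuous_on UNIV f \<Longrightarrow> G \<in> borel_measurable borel \<Longrightarrow> l > 0 \<Longrightarrow>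
      \<exists>c. (\<integral>\<^sup>+x\<in>cube a l. ennreal (norm (f x - c)) \<partial>lborel) \<le> ennreal (C * l) * (\<integral>\<^sup>+y\<in>cube a l. G y \<partial>lborel) \<and>
        (\<integral>\<^sup>+t\<in>{0<..}. ennreal (measure lborel {x\<in>cube a l. t < norm (f x - c)} powr (1 - 1 / DIM('a))) \<partial>lborel)
          \<le> ennreal C * (\<integral>\<^sup>+y\<in>cube a l. G y \<partial>lborel)"
proof -
  let ?n = "real DIM('a)"
  have n: "?n \<ge> 1" using DIM_positive[where 'a='a] by linarith
  obtain C0 :: real where "C0 > 0" and C0:
    "\<And>(h :: 'a \<Rightarrow> 'b) G a l E. upper_gradient h G \<Longrightarrow> continuous_on UNIV h \<Longrightarrow> G \<in> borel_measurable borel \<Longrightarrow> l > 0 \<Longrightarrow>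
      E \<in> sets borel \<Longrightarrow> E \<subseteq> cube a l \<Longrightarrow>
      (\<integral>\<^sup>+x\<in>E. (\<integral>\<^sup>+z\<in>cube a l. ennreal (norm (h z - h x)) \<partial>lborel) \<partial>lborel) \<le>
        ennreal (C0 * l ^ DIM('a) * measure lborel E powr (1 / DIM('a))) * (\<integral>\<^sup>+y\<in>cube a l. G y \<partial>lborel)"
    using oscillation_over_subset_of_cube_le[where 'a='a and 'b='b] by blast
  obtain C1 :: real where "C1 > 0" and C1:
    "\<And>(u :: 'a \<Rightarrow> real) G a l \<alpha> \<beta>. upper_gradient u G \<Longrightarrow> continuous_on UNIV u \<Longrightarrow> G \<in> borel_measurable borel \<Longrightarrow> l > 0 \<Longrightarrow>
      \<alpha> < \<beta> \<Longrightarrow> measure lborel {x\<in>cube a l. \<alpha> < u x} \<le> l ^ DIM('a) / 2 \<Longrightarrow>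
      ennreal ((\<beta> - \<alpha>) * measure lborel {x\<in>cube a l. \<beta> < u x} powr (1 - 1 / DIM('a))) \<le>
        ennreal C1 * (\<integral>\<^sup>+y\<in>cube a l. G y * indicator {\<alpha><..\<beta>} (u y) \<partial>lborel)"
    using weak_type_truncation[where 'a='a] by blast
  define C where "C = 4 * C0 + 2 * C1"
  show thesis
  proof (rule that[of C])
    show "C > 0" using \<open>C0 > 0\<close> \<open>C1 > 0\<close> by (simp add: C_def)
    fix f :: "'a \<Rightarrow> 'b" and G a and l :: real
    assume f: "upper_gradient f G" and cont: "continuous_on UNIV f" and [measurable]: "G \<in> borel_measurable borel"
      and "l > 0"
    let ?Q = "cube a l :: 'a set"
    define \<Gamma> where "\<Gamma> = (\<integral>\<^sup>+y\<in>?Q. G y \<partial>lborel)"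
    show "\<exists>c. (\<integral>\<^sup>+x\<in>?Q. ennreal (norm (f x - c)) \<partial>lborel) \<le> ennreal (C * l) * (\<integral>\<^sup>+y\<in>?Q. G y \<partial>lborel) \<and>
        (\<integral>\<^sup>+t\<in>{0<..}. ennreal (measure lborel {x\<in>?Q. t < norm (f x - c)} powr (1 - 1 / DIM('a))) \<partial>lborel)
          \<le> ennreal C * (\<integral>\<^sup>+y\<in>?Q. G y \<partial>lborel)"
    proof (cases "\<Gamma> = \<infinity>")
      case True
      then show ?thesis using \<open>C > 0\<close> \<open>l > 0\<close> unfolding \<Gamma>_def[symmetric]
        by (simp add: ennreal_mult_top)
    next
      case False
      then obtain \<gamma> where \<gamma>: "\<Gamma> = ennreal \<gamma>" "\<gamma> \<ge> 0" by (cases \<Gamma>) auto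
      have dbl: "(\<integral>\<^sup>+x\<in>?Q. (\<integral>\<^sup>+z\<in>?Q. ennreal (norm (f z - f x)) \<partial>lborel) \<partial>lborel) \<le> ennreal (C0 * l ^ DIM('a) * l * \<gamma>)"
      proof -
        have "(l ^ DIM('a)) powr (1 / ?n) = l" using \<open>l > 0\<close> n by (simp add: powr_powr flip: powr_realpow)
        then show ?thesis
          using C0[OF f cont _ \<open>l > 0\<close>, of ?Q a] \<open>C0 > 0\<close> \<open>l > 0\<close> \<gamma> unfolding \<Gamma>_def[symmetric]
          by (simp add: measure_cube flip: ennreal_mult)
      qed
      \<comment> \<open>The average over \<open>x\<close> of the inner integral obeys the bound, so some \<open>x\<close> does.\<close>
      obtain x0 where x0: "(\<integral>\<^sup>+z\<in>?Q. ennreal (norm (f z - f x0)) \<partial>lborel) \<le> ennreal (C0 * l * \<gamma>)"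
      proof (rule ccontr)
        assume neg: "\<not> thesis"
        have gt: "(\<integral>\<^sup>+z\<in>?Q. ennreal (norm (f z - f x)) \<partial>lborel) > ennreal (C0 * l * \<gamma>)" for x
          using neg that by (meson not_le)
        have fm [measurable]: "(\<lambda>x. \<integral>\<^sup>+z\<in>?Q. ennreal (norm (f z - f x)) \<partial>lborel) \<in> borel_measurable borel"
        proof -
          have "continuous_on UNIV (\<lambda>p. norm (f (snd p) - f (fst p)))"
            by (intro continuous_intros continuous_on_compose2[OF cont]) auto
          then have [measurable]: "(\<lambda>p. norm (f (snd p) - f (fst p))) \<in> borel_measurable (borel \<Otimes>\<^sub>M borel)"
            unfolding borel_prod by (rule borel_measurable_continuous_onI)
          have "(\<lambda>(x, z). ennreal (norm (f z - f x)) * indicator ?Q z) \<in> borel_measurable (borel \<Otimes>\<^sub>M lborel)"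
            by (simp add: case_prod_beta)
          then show ?thesis using lborel.borel_measurable_nn_integral by fastforce
        qed
        have Qpos: "emeasure lborel ?Q \<noteq> 0" using \<open>l > 0\<close> by (simp add: emeasure_cube)
        have "(\<integral>\<^sup>+x. ennreal (C0 * l * \<gamma>) * indicator ?Q x \<partial>lborel) < (\<integral>\<^sup>+x\<in>?Q. (\<integral>\<^sup>+z\<in>?Q. ennreal (norm (f z - f x)) \<partial>lborel) \<partial>lborel)"
        proof (rule nn_integral_less)
          show "(\<integral>\<^sup>+x. ennreal (C0 * l * \<gamma>) * indicator ?Q x \<partial>lborel) \<noteq> \<infinity>"
            using \<open>l > 0\<close> by (simp add: nn_integral_cmult emeasure_cube ennreal_mult_eq_top_iff)
          show "AE x in lborel. ennreal (C0 * l * \<gamma>) * indicator ?Q x \<le> (\<integral>\<^sup>+z\<in>?Q. ennreal (norm (f z - f x)) \<partial>lborel) * indicator ?Q x"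
            using gt by (intro AE_I2 mult_right_mono) (auto intro: less_imp_le)
          show "\<not> (AE x in lborel. (\<integral>\<^sup>+z\<in>?Q. ennreal (norm (f z - f x)) \<partial>lborel) * indicator ?Q x \<le> ennreal (C0 * l * \<gamma>) * indicator ?Q x)"
          proof
            assume "AE x in lborel. (\<integral>\<^sup>+z\<in>?Q. ennreal (norm (f z - f x)) \<partial>lborel) * indicator ?Q x \<le> ennreal (C0 * l * \<gamma>) * indicator ?Q x"
            then have "AE x in lborel. x \<notin> ?Q"
              
              proof eventually_elim
                case (elim x)
                show "x \<notin> ?Q"
                proof
                  assume "x \<in> ?Q"
                  with elim gt[of x] show False by simp
                qed
              qed
            then have "emeasure lborel ?Q = 0" using AE_iff_measurable[of ?Q lborel "\<lambda>x. x \<notin> ?Q"] by simp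
            with Qpos show False by simp
          qed
        qed measurable
        also have "\<dots> \<le> ennreal (C0 * l ^ DIM('a) * l * \<gamma>)" by (rule dbl)
        also have "\<dots> = (\<integral>\<^sup>+x. ennreal (C0 * l * \<gamma>) * indicator ?Q x \<partial>lborel)"
          using \<open>l > 0\<close> \<open>C0 > 0\<close> \<gamma> by (simp add: nn_integral_cmult emeasure_cube flip: ennreal_mult)
        finally show False by simp
      qed
      define c where "c = f x0"
      define u where "u = (\<lambda>x. norm (f x - c))"
      have u: "upper_gradient u G" unfolding u_def by (rule upper_gradient_norm_diff[OF f])
      have uc: "continuous_on UNIV u" unfolding u_def by (intro continuous_intros cont)
      have [measurable]: "u \<in> borel_measurable borel" using uc by (rule borel_measurable_continuous_onI)
      define V where "V = (\<lambda>t. measure lborel {x\<in>?Q. t < u x})"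
      have Vem: "emeasure lborel {x\<in>?Q. t < u x} = ennreal (V t)" "V t \<le> l ^ DIM('a)" for t
        unfolding V_def using measure_level_set_cube[of u l a t] \<open>l > 0\<close> by auto
      have Vpos: "0 \<le> V t" for t by (simp add: V_def)
      have Vmono: "V t \<le> V s" if "s \<le> t" for s t
      proof -
        have "ennreal (V t) \<le> ennreal (V s)"
          unfolding Vem(1)[symmetric] using that by (intro emeasure_mono) auto
        then show ?thesis using Vpos by simp
      qed
      have int_u: "(\<integral>\<^sup>+x\<in>?Q. ennreal (u x) \<partial>lborel) \<le> ennreal (C0 * l * \<gamma>)" using x0 by (simp add: u_def c_def)
      have cheb: "V \<mu> \<le> l ^ DIM('a) / 2" if "\<mu> > 0" "2 * C0 * l * \<gamma> \<le> \<mu> * l ^ DIM('a)" for \<mu>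
      proof -
        have "ennreal (\<mu> * V \<mu>) = (\<integral>\<^sup>+x. ennreal \<mu> * indicator {x\<in>?Q. \<mu> < u x} x \<partial>lborel)"
          using that Vpos by (simp add: nn_integral_cmult Vem ennreal_mult)
        also have "\<dots> \<le> (\<integral>\<^sup>+x\<in>?Q. ennreal (u x) \<partial>lborel)"
          by (intro nn_integral_mono) (auto simp: indicator_def intro!: ennreal_leI)
        also note int_u
        finally have "\<mu> * V \<mu> \<le> C0 * l * \<gamma>" using \<open>C0 > 0\<close> \<open>l > 0\<close> \<gamma> by simp
        also have "\<dots> \<le> \<mu> * (l ^ DIM('a) / 2)" using that by simp
        finally show ?thesis using that by simp
      qed
      have bound: "(\<integral>\<^sup>+t\<in>{0<..}. ennreal (V t powr (1 - 1 / ?n)) \<partial>lborel) \<le>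
          ennreal (2 * \<mu> * l powr (?n - 1)) + ennreal (2 * C1 * \<gamma>)"
        if lam: "\<mu> > 0" "2 * C0 * l * \<gamma> \<le> \<mu> * l ^ DIM('a)" for \<mu>
      proof -
        have "(\<integral>\<^sup>+t\<in>{0<..}. ennreal (V t powr (1 - 1 / ?n)) \<partial>lborel) \<le>
          ennreal (2 * \<mu> * (l ^ DIM('a)) powr (1 - 1 / ?n)) + (\<Sum>i. ennreal (2 * \<mu> * 2 ^ i * V (2 * \<mu> * 2 ^ i) powr (1 - 1 / ?n)))"
          using lam n Vem by (intro nn_integral_powr_le_dyadic_sum Vmono Vpos) auto
        also have "(l ^ DIM('a)) powr (1 - 1 / ?n) = l powr (?n - 1)"
          using \<open>l > 0\<close> n by (simp add: powr_powr right_diff_distrib flip: powr_realpow)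
        also have "(\<Sum>i. ennreal (2 * \<mu> * 2 ^ i * V (2 * \<mu> * 2 ^ i) powr (1 - 1 / ?n))) \<le>
          (\<Sum>i. ennreal (2 * C1) * (\<integral>\<^sup>+y\<in>?Q. G y * indicator {\<mu> * 2 ^ i<..\<mu> * 2 ^ Suc i} (u y) \<partial>lborel))"
        proof (intro suminf_le allI)
          fix i :: nat
          let ?a = "\<mu> * 2 ^ i"
          have "?a \<ge> \<mu> * 1" using lam by (intro mult_left_mono) auto
          then have "V ?a \<le> l ^ DIM('a) / 2" using Vmono[of \<mu> ?a] cheb[OF lam] by simp
          then have "ennreal ((2 * ?a - ?a) * V (2 * ?a) powr (1 - 1 / ?n)) \<le> ennreal C1 * (\<integral>\<^sup>+y\<in>?Q. G y * indicator {?a<..2 * ?a} (u y) \<partial>lborel)"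
            unfolding V_def using lam by (intro C1 u uc \<open>l > 0\<close>) auto
          then have "ennreal 2 * ennreal (?a * V (2 * ?a) powr (1 - 1 / ?n)) \<le> ennreal 2 * (ennreal C1 * (\<integral>\<^sup>+y\<in>?Q. G y * indicator {?a<..2 * ?a} (u y) \<partial>lborel))"
            by (intro mult_left_mono) auto
          then show "ennreal (2 * \<mu> * 2 ^ i * V (2 * \<mu> * 2 ^ i) powr (1 - 1 / ?n)) \<le> ennreal (2 * C1) * (\<integral>\<^sup>+y\<in>?Q. G y * indicator {\<mu> * 2 ^ i<..\<mu> * 2 ^ Suc i} (u y) \<partial>lborel)"
            using lam \<open>C1 > 0\<close> by (simp add: ennreal_mult mult_ac)
        qed auto
        also have "\<dots> = (\<integral>\<^sup>+y. (\<Sum>i. ennreal (2 * C1) * (G y * indicator ?Q y * indicator {y. u y \<in> {\<mu> * 2 ^ i<..\<mu> * 2 ^ Suc i}} y)) \<partial>lborel)"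
        proof -
          have "ennreal (2 * C1) * (\<integral>\<^sup>+y\<in>?Q. G y * indicator {\<mu> * 2 ^ i<..\<mu> * 2 ^ Suc i} (u y) \<partial>lborel) =
            (\<integral>\<^sup>+y. ennreal (2 * C1) * (G y * indicator ?Q y * indicator {y. u y \<in> {\<mu> * 2 ^ i<..\<mu> * 2 ^ Suc i}} y) \<partial>lborel)" for i
            by (subst nn_integral_cmult[symmetric]) (auto simp: indicator_def intro!: nn_integral_cong)
          then show ?thesis by (simp only:) (rule nn_integral_suminf[symmetric], measurable)
        qed
        also have "\<dots> \<le> (\<integral>\<^sup>+y. ennreal (2 * C1) * (G y * indicator ?Q y) \<partial>lborel)"
        proof (rule nn_integral_mono)
          fix y :: 'a
          have "disjoint_family (\<lambda>i. {y. u y \<in> {\<mu> * 2 ^ i<..\<mu> * 2 ^ Suc i}})"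
            using disjoint_dyadic_intervals[OF lam(1)] by (fastforce simp: disjoint_family_on_def)
          from suminf_indicator[OF this, of y]
          have "(\<Sum>i. indicator {y. u y \<in> {\<mu> * 2 ^ i<..\<mu> * 2 ^ Suc i}} y :: ennreal) \<le> 1"
            by (simp add: indicator_def)
          then have "ennreal (2 * C1) * (G y * indicator ?Q y) * (\<Sum>i. indicator {y. u y \<in> {\<mu> * 2 ^ i<..\<mu> * 2 ^ Suc i}} y :: ennreal) \<le> ennreal (2 * C1) * (G y * indicator ?Q y) * 1"
            by (intro mult_left_mono) auto
          then show "(\<Sum>i. ennreal (2 * C1) * (G y * indicator ?Q y * indicator {y. u y \<in> {\<mu> * 2 ^ i<..\<mu> * 2 ^ Suc i}} y)) \<le> ennreal (2 * C1) * (G y * indicator ?Q y)"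
            by (simp add: mult.assoc[symmetric])
        qed
        also have "\<dots> = ennreal (2 * C1 * \<gamma>)"
          using \<gamma> \<open>C1 > 0\<close> by (simp add: nn_integral_cmult \<Gamma>_def ennreal_mult)
        finally show ?thesis by (simp add: add_left_mono)
      qed
      have "(\<integral>\<^sup>+t\<in>{0<..}. ennreal (V t powr (1 - 1 / ?n)) \<partial>lborel) \<le> ennreal (C * \<gamma>)"
      proof (rule ennreal_le_epsilon)
        fix e :: real assume "e > 0"
        \<comment> \<open>The first summand is the least admissible height; it may be zero, whence the second.\<close>
        define \<mu> where "\<mu> = 2 * C0 * l * \<gamma> / l ^ DIM('a) + e / (2 * l powr (?n - 1))"
        have "\<mu> > 0" unfolding \<mu>_def using \<open>e > 0\<close> \<open>l > 0\<close> \<open>C0 > 0\<close> \<gamma> by (intro add_nonneg_pos) auto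
        have "2 * C0 * l * \<gamma> = (2 * C0 * l * \<gamma> / l ^ DIM('a)) * l ^ DIM('a)" using \<open>l > 0\<close> by simp
        also have "\<dots> \<le> \<mu> * l ^ DIM('a)" unfolding \<mu>_def using \<open>e > 0\<close> \<open>l > 0\<close> by (intro mult_right_mono) auto
        finally have "2 * C0 * l * \<gamma> \<le> \<mu> * l ^ DIM('a)" .
        from bound[OF \<open>\<mu> > 0\<close> this]
        have "(\<integral>\<^sup>+t\<in>{0<..}. ennreal (V t powr (1 - 1 / ?n)) \<partial>lborel) \<le> ennreal (2 * \<mu> * l powr (?n - 1) + 2 * C1 * \<gamma>)"
          using \<open>\<mu> > 0\<close> \<open>C1 > 0\<close> \<gamma> by (simp flip: ennreal_plus)
        also have "2 * \<mu> * l powr (?n - 1) + 2 * C1 * \<gamma> = C * \<gamma> + e"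
        proof -
          have "l powr (?n - 1) * l = l ^ DIM('a)" using \<open>l > 0\<close> n by (simp add: powr_diff powr_realpow)
          then have "l * (l powr (?n - 1) / l ^ DIM('a)) = 1" using \<open>l > 0\<close> by (simp add: mult.commute)
          moreover have "2 * (2 * C0 * l * \<gamma> / l ^ DIM('a)) * l powr (?n - 1) = 4 * C0 * \<gamma> * (l * (l powr (?n - 1) / l ^ DIM('a)))"
            by (simp add: algebra_simps)
          ultimately have "2 * (2 * C0 * l * \<gamma> / l ^ DIM('a)) * l powr (?n - 1) = 4 * C0 * \<gamma>" by simp
          moreover have "2 * (e / (2 * l powr (?n - 1))) * l powr (?n - 1) = e" using \<open>l > 0\<close> by simp
          ultimately show ?thesis unfolding \<mu>_def C_def by (simp only: distrib_left distrib_right)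
        qed
        also have "ennreal (C * \<gamma> + e) = ennreal (C * \<gamma>) + ennreal e"
          using \<open>C > 0\<close> \<gamma> \<open>e > 0\<close> by (simp add: ennreal_plus)
        finally show "(\<integral>\<^sup>+t\<in>{0<..}. ennreal (V t powr (1 - 1 / ?n)) \<partial>lborel) \<le> ennreal (C * \<gamma>) + ennreal e" .
      qed
      moreover have "(\<integral>\<^sup>+x\<in>?Q. ennreal (u x) \<partial>lborel) \<le> ennreal (C * l * \<gamma>)"
      proof -
        have "C0 * l * \<gamma> \<le> C * l * \<gamma>" using \<open>C0 > 0\<close> \<open>C1 > 0\<close> \<open>l > 0\<close> \<gamma> by (intro mult_right_mono) (auto simp: C_def)
        then show ?thesis using int_u by (meson ennreal_leI order_trans)
      qed
      ultimately show ?thesis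
        unfolding \<Gamma>_def[symmetric] \<gamma> using \<open>C > 0\<close> \<open>l > 0\<close> \<gamma>
        by (intro exI[of _ c]) (simp add: V_def u_def flip: ennreal_mult)
    qed
  qed
qed

section \<open>Smooth functions and Riesz potentials\<close>

lemma gradient_norm_continuous:
  fixes f :: "'a::euclidean_space \<Rightarrow> 'b::real_normed_vector"
  assumes "smooth_compactly_supported f"
  shows "continuous_on UNIV (gradient_norm f)"
proof -
  have "C_k (Suc 0) f" using assms unfolding smooth_compactly_supported_def by blast
  then have "continuous_on UNIV (\<lambda>x. frechet_derivative f (at x) i)" if "i \<in> Basis" for i
    using that by simp
  then show ?thesis unfolding gradient_norm_def[abs_def] by (intro continuous_intros) auto
qed

lemma smooth_continuous:
  assumes "smooth_compactly_supported f"
  shows "continuous_on UNIV f"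
  using assms unfolding smooth_compactly_supported_def by (metis C_k.simps(1))

lemma smooth_bounded_support:
  assumes "smooth_compactly_supported f"
  shows "bounded {x. f x \<noteq> 0}"
  using assms unfolding smooth_compactly_supported_def
  by (meson bounded_subset closure_subset compact_imp_bounded)

lemma norm_linear_le_L2:
  fixes L :: "'a::euclidean_space \<Rightarrow> 'b::real_normed_vector"
  assumes "linear L"
  shows "norm (L v) \<le> sqrt (\<Sum>i\<in>Basis. (norm (L i))\<^sup>2) * norm v"
proof -
  have "L v = L (\<Sum>i\<in>Basis. (v \<bullet> i) *\<^sub>R i)" by (simp add: euclidean_representation)
  also have "\<dots> = (\<Sum>i\<in>Basis. (v \<bullet> i) *\<^sub>R L i)"
    by (simp add: linear_sum[OF assms] linear_scale[OF assms])
  finally have "norm (L v) \<le> (\<Sum>i\<in>Basis. \<bar>norm (L i)\<bar> * \<bar>v \<bullet> i\<bar>)"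
    using norm_sum[of "\<lambda>i. (v \<bullet> i) *\<^sub>R L i" Basis] by (simp add: mult.commute)
  also have "\<dots> \<le> L2_set (\<lambda>i. norm (L i)) Basis * L2_set (\<lambda>i. v \<bullet> i) Basis"
    by (rule L2_set_mult_ineq)
  also have "L2_set (\<lambda>i. v \<bullet> i) Basis = norm v"
    by (simp add: norm_eq_sqrt_inner[of v] L2_set_def euclidean_inner[of v v] power2_eq_square)
  finally show ?thesis by (simp add: L2_set_def)
qed

lemma upper_gradient_gradient_norm:
  fixes f :: "'a::euclidean_space \<Rightarrow> 'b::euclidean_space"
  assumes f: "smooth_compactly_supported f"
  shows "upper_gradient f (\<lambda>x. ennreal (gradient_norm f x))"
  unfolding upper_gradient_def
proof (intro allI impI)
  fix x v :: 'a and a b :: real assume "a \<le> b"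
  let ?D = "\<lambda>x. frechet_derivative f (at x)"
  have C: "C_k (Suc 0) f" using f unfolding smooth_compactly_supported_def by blast
  then have der: "(f has_derivative ?D y) (at y)" for y
    by (simp add: differentiable_on_def frechet_derivative_works)
  have lin: "linear (?D y)" for y using der[of y] by (rule has_derivative_linear)
  have contD: "continuous_on UNIV (\<lambda>y. ?D y i)" if "i \<in> Basis" for i
    using that C by simp
  have contv: "continuous_on UNIV (\<lambda>y. ?D y v)"
  proof -
    have "?D y v = (\<Sum>i\<in>Basis. (v \<bullet> i) *\<^sub>R ?D y i)" for y
      using linear_sum[OF lin, of y "\<lambda>i. (v \<bullet> i) *\<^sub>R i" Basis]
      by (simp add: euclidean_representation linear_scale[OF lin])
    then show ?thesis by (simp only:) (intro continuous_intros contD)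
  qed
  define c' where "c' = (\<lambda>s. ?D (x + s *\<^sub>R v) v)"
  have vd: "((\<lambda>s. f (x + s *\<^sub>R v)) has_vector_derivative c' s) (at s within {a..b})" for s
  proof -
    have "((\<lambda>s. x + s *\<^sub>R v) has_derivative (\<lambda>t. t *\<^sub>R v)) (at s within {a..b})"
      by (auto intro!: derivative_eq_intros)
    from has_derivative_compose[OF this der]
    have "((\<lambda>s. f (x + s *\<^sub>R v)) has_derivative (\<lambda>t. ?D (x + s *\<^sub>R v) (t *\<^sub>R v))) (at s within {a..b})" .
    then show ?thesis unfolding has_vector_derivative_def c'_def by (simp add: linear_scale[OF lin])
  qed
  have cc: "continuous_on {a..b} c'"
    unfolding c'_def by (rule continuous_on_compose2[OF contv]) (auto intro!: continuous_intros)
  have bi: "has_bochner_integral lborel (\<lambda>s. indicator {a..b} s *\<^sub>R c' s) (f (x + b *\<^sub>R v) - f (x + a *\<^sub>R v))"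
    by (rule has_bochner_integral_FTC_Icc[OF \<open>a \<le> b\<close> vd cc])
  have "ennreal (norm (f (x + b *\<^sub>R v) - f (x + a *\<^sub>R v))) \<le> (\<integral>\<^sup>+s. ennreal (norm (indicator {a..b} s *\<^sub>R c' s)) \<partial>lborel)"
    using integral_norm_bound_ennreal[of lborel "\<lambda>s. indicator {a..b} s *\<^sub>R c' s"] bi
    by (simp add: has_bochner_integral_iff)
  also have "\<dots> \<le> (\<integral>\<^sup>+s\<in>{a<..<b}. ennreal (gradient_norm f (x + s *\<^sub>R v)) * ennreal (norm v) \<partial>lborel)"
  proof (rule nn_integral_mono_AE)
    have "AE s in lborel. s \<noteq> a" "AE s in lborel. s \<noteq> b" by (auto simp: AE_lborel_singleton)
    then show "AE s in lborel. ennreal (norm (indicator {a..b} s *\<^sub>R c' s)) \<le>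
      ennreal (gradient_norm f (x + s *\<^sub>R v)) * ennreal (norm v) * indicator {a<..<b} s"
    proof eventually_elim
      case (elim s)
      have "norm (c' s) \<le> gradient_norm f (x + s *\<^sub>R v) * norm v"
        unfolding c'_def gradient_norm_def by (rule norm_linear_le_L2[OF lin])
      then have "ennreal (norm (c' s)) \<le> ennreal (gradient_norm f (x + s *\<^sub>R v)) * ennreal (norm v)"
        by (simp add: ennreal_leI flip: ennreal_mult'')
      then show ?case using elim by (auto simp: indicator_def)
    qed
  qed
  finally show "ennreal (norm (f (x + b *\<^sub>R v) - f (x + a *\<^sub>R v))) \<le>
    (\<integral>\<^sup>+s\<in>{a<..<b}. ennreal (gradient_norm f (x + s *\<^sub>R v)) * ennreal (norm v) \<partial>lborel)" .
qed

definition riesz_potential :: "('a::euclidean_space \<Rightarrow> ennreal) \<Rightarrow> 'a \<Rightarrow> ennreal" where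
  "riesz_potential G x = (\<integral>\<^sup>+y. G y * riesz_kernel (x - y) \<partial>lborel)"

lemma riesz_potential_measurable [measurable]:
  assumes [measurable]: "G \<in> borel_measurable borel"
  shows "riesz_potential G \<in> borel_measurable borel"
  unfolding riesz_potential_def[abs_def] by measurable

lemma average_cube:
  "l > 0 \<Longrightarrow> average (cube (a::'a::euclidean_space) l) g = (\<integral>\<^sup>+y\<in>cube a l. g y \<partial>lborel) / ennreal (l ^ DIM('a))"
  by (simp add: average_def nn_integral_completion emeasure_cube)

lemma riesz_kernel_ge:
  assumes "norm (z :: 'a::euclidean_space) \<le> R" "z \<noteq> 0"
  shows "ennreal (R powr (1 - real DIM('a))) \<le> riesz_kernel z"
proof -
  have "real DIM('a) \<ge> 1" using DIM_positive[where 'a='a] by linarith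
  then show ?thesis unfolding riesz_kernel_def using assms by (intro ennreal_leI powr_mono2') auto
qed

lemma riesz_kernel_le:
  assumes "R \<le> norm (z :: 'a::euclidean_space)" "R > 0"
  shows "riesz_kernel z \<le> ennreal (R powr (1 - real DIM('a)))"
proof -
  have "real DIM('a) \<ge> 1" using DIM_positive[where 'a='a] by linarith
  then show ?thesis unfolding riesz_kernel_def using assms by (intro ennreal_leI powr_mono2') auto
qed

text \<open>This bounds the fractional maximal function by the potential; it is used for the gradient terms that
  the Poincare inequality leaves on a cube.\<close>

lemma integral_cube_le_riesz_potential:
  fixes x :: "'a::euclidean_space" and l :: real
  assumes [measurable]: "G \<in> borel_measurable borel" and "l > 0" "x \<in> cube a l"
  shows "(\<integral>\<^sup>+y\<in>cube a l. G y \<partial>lborel) \<le> ennreal ((DIM('a) * l) powr (real DIM('a) - 1)) * riesz_potential G x"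
proof -
  let ?n = "real DIM('a)" and ?r = "(DIM('a) * l) powr (real DIM('a) - 1)"
  have "(\<integral>\<^sup>+y\<in>cube a l. G y \<partial>lborel) \<le> (\<integral>\<^sup>+y. ennreal ?r * (G y * riesz_kernel (x - y)) \<partial>lborel)"
  proof (rule nn_integral_mono_AE)
    show "AE y in lborel. G y * indicator (cube a l) y \<le> ennreal ?r * (G y * riesz_kernel (x - y))"
      using AE_lborel_singleton[of x]
    proof eventually_elim
      case (elim y)
      show ?case
      proof (cases "y \<in> cube a l")
        case True
        have "ennreal ((DIM('a) * l) powr (1 - ?n)) \<le> riesz_kernel (x - y)"
          using norm_diff_cube_le[OF True assms(3)] elim by (intro riesz_kernel_ge) auto
        then have "ennreal ?r * ennreal ((DIM('a) * l) powr (1 - ?n)) \<le> ennreal ?r * riesz_kernel (x - y)"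
          by (rule mult_left_mono) simp
        also have "ennreal ?r * ennreal ((DIM('a) * l) powr (1 - ?n)) = 1"
          using \<open>l > 0\<close> by (simp flip: ennreal_mult powr_add)
        finally have "G y * 1 \<le> G y * (ennreal ?r * riesz_kernel (x - y))" by (rule mult_left_mono) simp
        then show ?thesis using True by (simp add: mult_ac)
      qed simp
    qed
  qed
  also have "\<dots> = ennreal ?r * riesz_potential G x"
    unfolding riesz_potential_def by (rule nn_integral_cmult) measurable
  finally show ?thesis .
qed

text \<open>On a cube so large that \<open>f\<close> vanishes on half of it, the mean oscillation about \<open>f x\<close> is at least half of
  \<open>norm (f x)\<close>.\<close>

lemma norm_le_riesz_potential:
  obtains C :: real where "C > 0" and
    "\<And>(f :: 'a::euclidean_space \<Rightarrow> 'b::real_normed_vector) G x. upper_gradient f G \<Longrightarrow> continuous_on UNIV f \<Longrightarrow>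
      bounded {x. f x \<noteq> 0} \<Longrightarrow> G \<in> borel_measurable borel \<Longrightarrow> ennreal (norm (f x)) \<le> ennreal C * riesz_potential G x"
proof (rule that)
  let ?n = "real DIM('a)"
  define c where "c = ?n ^ DIM('a) / ?n"
  have "c > 0" by (simp add: c_def)
  show "2 * c > 0" using \<open>c > 0\<close> by simp
  fix f :: "'a \<Rightarrow> 'b" and G and x :: 'a
  assume f: "upper_gradient f G" and cont: "continuous_on UNIV f" and bd: "bounded {x. f x \<noteq> 0}"
    and [measurable]: "G \<in> borel_measurable borel"
  obtain a0 b0 where supp: "{x. f x \<noteq> 0} \<subseteq> cbox a0 (b0::'a)" using bounded_subset_cbox_symmetric[OF bd] by blast
  define m where "m = measure lborel (cbox a0 b0)"
  \<comment> \<open>As \<open>l \<ge> 1\<close>, the volume of the cube is at least \<open>l\<close> and hence at least twice that of the support.\<close>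
  define l where "l = max 1 (2 * m)"
  have l: "l \<ge> 1" "2 * m \<le> l ^ DIM('a)"
  proof -
    show "l \<ge> 1" by (simp add: l_def)
    then have "l ^ 1 \<le> l ^ DIM('a)" by (intro power_increasing) (auto simp: Suc_le_eq)
    then show "2 * m \<le> l ^ DIM('a)" by (simp add: l_def)
  qed
  have "l > 0" using l by simp
  let ?Q = "cube x l :: 'a set"
  have x: "x \<in> ?Q" using \<open>l > 0\<close> by (simp add: mem_cube)
  define K where "K = ?Q - cbox a0 b0"
  have [measurable]: "K \<in> sets borel" by (simp add: K_def)
  have "ennreal (l ^ DIM('a)) \<le> emeasure lborel K + emeasure lborel (cbox a0 b0)"
  proof -
    have "emeasure lborel ?Q \<le> emeasure lborel (K \<union> cbox a0 b0)" by (rule emeasure_mono) (auto simp: K_def)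
    also have "\<dots> \<le> emeasure lborel K + emeasure lborel (cbox a0 b0)" by (rule emeasure_subadditive) auto
    finally show ?thesis using \<open>l > 0\<close> by (simp add: emeasure_cube)
  qed
  also have "emeasure lborel (cbox a0 b0) = ennreal m"
    unfolding m_def using emeasure_lborel_cbox_finite[of a0 b0]
    by (intro emeasure_eq_ennreal_measure) simp
  finally have K: "ennreal (l ^ DIM('a) / 2) \<le> emeasure lborel K"
  proof -
    assume a: "ennreal (l ^ DIM('a)) \<le> emeasure lborel K + ennreal m"
    have "m \<ge> 0" by (simp add: m_def)
    moreover have "ennreal (l ^ DIM('a) / 2 + m) \<le> ennreal (l ^ DIM('a))"
      using l by (intro ennreal_leI) linarith
    ultimately have "ennreal (l ^ DIM('a) / 2) + ennreal m \<le> ennreal (l ^ DIM('a))"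
      using l by simp
    with a have "ennreal (l ^ DIM('a) / 2) + ennreal m \<le> emeasure lborel K + ennreal m" by (rule order_trans[rotated])
    then show ?thesis by (simp add: add.commute[of _ "ennreal m"])
  qed
  have "ennreal (norm (f x)) * ennreal (l ^ DIM('a) / 2) \<le> ennreal (norm (f x)) * emeasure lborel K"
    by (intro mult_left_mono K) simp
  also have "\<dots> = (\<integral>\<^sup>+z. ennreal (norm (f x)) * indicator K z \<partial>lborel)" by (simp add: nn_integral_cmult)
  also have "\<dots> \<le> (\<integral>\<^sup>+z\<in>?Q. ennreal (norm (f z - f x)) \<partial>lborel)"
  proof (rule nn_integral_mono)
    fix z
    have "f z = 0" if "z \<in> K" using that supp by (auto simp: K_def)
    then show "ennreal (norm (f x)) * indicator K z \<le> ennreal (norm (f z - f x)) * indicator ?Q z"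
      by (auto simp: indicator_def K_def)
  qed
  also have "\<dots> \<le> ennreal (c * l ^ DIM('a)) * (\<integral>\<^sup>+y\<in>?Q. G y * riesz_kernel (y - x) \<partial>lborel)"
    unfolding c_def by (rule oscillation_on_cube_le_potential[OF f _ \<open>l > 0\<close> x]) measurable
  also have "\<dots> \<le> ennreal (c * l ^ DIM('a)) * riesz_potential G x"
    unfolding riesz_potential_def by (intro mult_left_mono nn_integral_mono) (auto simp: indicator_def riesz_kernel_minus)
  finally have "ennreal (2 / l ^ DIM('a)) * (ennreal (norm (f x)) * ennreal (l ^ DIM('a) / 2)) \<le>
    ennreal (2 / l ^ DIM('a)) * (ennreal (c * l ^ DIM('a)) * riesz_potential G x)"
    by (rule mult_left_mono) simp
  moreover have "ennreal (2 / l ^ DIM('a)) * (ennreal (norm (f x)) * ennreal (l ^ DIM('a) / 2)) = ennreal (norm (f x))"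
    using \<open>l > 0\<close> by (simp flip: ennreal_mult)
  moreover have "ennreal (2 / l ^ DIM('a)) * (ennreal (c * l ^ DIM('a)) * riesz_potential G x) = ennreal (2 * c) * riesz_potential G x"
    using \<open>l > 0\<close> \<open>c > 0\<close> by (simp flip: ennreal_mult mult.assoc)
  ultimately show "ennreal (norm (f x)) \<le> ennreal (2 * c) * riesz_potential G x" by simp
qed

text \<open>The kernel is an \<open>A\<^sub>1\<close> weight: if \<open>z\<close> is far from the cube, \<open>riesz_kernel (y - z)\<close> is nearly constant in
  \<open>y\<close> on the cube; otherwise its integral over the cube is at most of the order \<open>l\<close>, while
  \<open>riesz_kernel (x - z)\<close> is at least of the order \<open>l\<^bsup>1-n\<^esup>\<close>.\<close>

lemma integral_cube_riesz_potential_le: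
  obtains C :: real where "C > 0" and
    "\<And>(G :: 'a::euclidean_space \<Rightarrow> ennreal) a l x. G \<in> borel_measurable borel \<Longrightarrow> l > 0 \<Longrightarrow> x \<in> cube a l \<Longrightarrow>
      (\<integral>\<^sup>+y\<in>cube a l. riesz_potential G y \<partial>lborel) \<le> ennreal (C * l ^ DIM('a)) * riesz_potential G x"
proof -
  let ?n = "real DIM('a)"
  have n: "?n \<ge> 1" using DIM_positive[where 'a='a] by linarith
  obtain C1 where C1: "C1 > 0"
    "\<And>(E :: 'a set) x. E \<in> sets borel \<Longrightarrow> emeasure lborel E < \<infinity> \<Longrightarrow>
      (\<integral>\<^sup>+y\<in>E. riesz_kernel (y - x) \<partial>lborel) \<le> ennreal (C1 * measure lborel E powr (1 / DIM('a)))"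
    using nn_integral_riesz_kernel_set by blast
  define C where "C = C1 * (2 * ?n) powr (?n - 1) + 2 powr (?n - 1)"
  show thesis
  proof (rule that[of C])
    show "C > 0" using C1 by (simp add: C_def add_pos_pos)
    fix G :: "'a \<Rightarrow> ennreal" and a l and x :: 'a
    assume [measurable]: "G \<in> borel_measurable borel" and "l > 0" and x: "x \<in> cube a l"
    let ?Q = "cube a l :: 'a set"
    have ker: "(\<integral>\<^sup>+y. riesz_kernel (y - z) * indicator ?Q y \<partial>lborel) \<le> ennreal (C * l ^ DIM('a)) * riesz_kernel (x - z)" if "z \<noteq> x" for z
    proof (cases "norm (x - z) \<le> 2 * ?n * l")
      case True
      have "(\<integral>\<^sup>+y\<in>?Q. riesz_kernel (y - z) \<partial>lborel) \<le> ennreal (C1 * measure lborel ?Q powr (1 / DIM('a)))"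
        using \<open>l > 0\<close> by (intro C1) (auto simp: emeasure_cube)
      also have "measure lborel ?Q powr (1 / DIM('a)) = l"
        using \<open>l > 0\<close> n by (simp add: measure_cube powr_powr flip: powr_realpow)
      also have "C1 * l = C1 * (2 * ?n) powr (?n - 1) * l ^ DIM('a) * (2 * ?n * l) powr (1 - ?n)"
      proof -
        have "(2 * ?n) powr (?n - 1) * (2 * ?n * l) powr (1 - ?n) * l ^ DIM('a) = l"
          using \<open>l > 0\<close> n by (simp add: powr_mult powr_diff powr_realpow field_simps)
        then show ?thesis by (simp add: mult_ac)
      qed
      also have "\<dots> \<le> C * l ^ DIM('a) * (2 * ?n * l) powr (1 - ?n)"
        using \<open>l > 0\<close> by (intro mult_right_mono) (auto simp: C_def)
      also have "ennreal (C * l ^ DIM('a) * (2 * ?n * l) powr (1 - ?n)) = ennreal (C * l ^ DIM('a)) * ennreal ((2 * ?n * l) powr (1 - ?n))"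
        using \<open>l > 0\<close> \<open>C > 0\<close> by (subst ennreal_mult) auto
      also have "\<dots> \<le> ennreal (C * l ^ DIM('a)) * riesz_kernel (x - z)"
        using True that by (intro mult_left_mono riesz_kernel_ge) auto
      finally show ?thesis by (simp add: ennreal_leI)
    next
      case False
      have "(\<integral>\<^sup>+y. riesz_kernel (y - z) * indicator ?Q y \<partial>lborel) \<le> (\<integral>\<^sup>+y. ennreal (2 powr (?n - 1)) * riesz_kernel (x - z) * indicator ?Q y \<partial>lborel)"
      proof (intro nn_integral_mono)
        fix y
        have "riesz_kernel (y - z) \<le> ennreal (2 powr (?n - 1)) * riesz_kernel (x - z)" if "y \<in> ?Q"
        proof -
          have "norm (y - x) \<le> ?n * l" by (rule norm_diff_cube_le[OF x that])
          moreover have "norm (x - z) \<le> norm (y - x) + norm (y - z)"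
            using norm_triangle_ineq4[of "y - z" "y - x"] by (simp add: add.commute)
          ultimately have "norm (x - z) / 2 \<le> norm (y - z)" using False by linarith
          then have "riesz_kernel (y - z) \<le> ennreal ((norm (x - z) / 2) powr (1 - ?n))"
            using \<open>z \<noteq> x\<close> by (intro riesz_kernel_le) auto
          also have "(norm (x - z) / 2) powr (1 - ?n) = 2 powr (?n - 1) * norm (x - z) powr (1 - ?n)"
            by (simp add: powr_divide powr_diff field_simps)
          finally show ?thesis by (simp add: riesz_kernel_def ennreal_mult)
        qed
        then show "riesz_kernel (y - z) * indicator ?Q y \<le> ennreal (2 powr (?n - 1)) * riesz_kernel (x - z) * indicator ?Q y"
          by (auto simp: indicator_def)
      qed
      also have "\<dots> = ennreal (2 powr (?n - 1) * l ^ DIM('a)) * riesz_kernel (x - z)"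
      proof -
        have "(\<integral>\<^sup>+y. ennreal (2 powr (?n - 1)) * riesz_kernel (x - z) * indicator ?Q y \<partial>lborel) = ennreal (2 powr (?n - 1)) * riesz_kernel (x - z) * emeasure lborel ?Q"
          by (rule nn_integral_cmult_indicator) simp
        then show ?thesis
          using \<open>l > 0\<close> by (simp add: emeasure_cube ennreal_mult mult_ac)
      qed
      also have "\<dots> \<le> ennreal (C * l ^ DIM('a)) * riesz_kernel (x - z)"
        using \<open>l > 0\<close> C1 by (intro mult_right_mono ennreal_leI) (auto simp: C_def)
      finally show ?thesis .
    qed
    have "(\<integral>\<^sup>+y\<in>?Q. riesz_potential G y \<partial>lborel) = (\<integral>\<^sup>+y. (\<integral>\<^sup>+z. G z * riesz_kernel (y - z) * indicator ?Q y \<partial>lborel) \<partial>lborel)"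
      unfolding riesz_potential_def by (intro nn_integral_cong nn_integral_multc[symmetric]) measurable
    also have "\<dots> = (\<integral>\<^sup>+z. (\<integral>\<^sup>+y. G z * riesz_kernel (y - z) * indicator ?Q y \<partial>lborel) \<partial>lborel)"
    proof -
      have "(\<lambda>(y, z). G z * riesz_kernel (y - z) * indicator ?Q y) \<in> borel_measurable (lborel \<Otimes>\<^sub>M lborel)" by measurable
      from lborel_pair.Fubini'[OF this] show ?thesis by simp
    qed
    also have "\<dots> = (\<integral>\<^sup>+z. G z * (\<integral>\<^sup>+y. riesz_kernel (y - z) * indicator ?Q y \<partial>lborel) \<partial>lborel)"
      by (intro nn_integral_cong) (simp add: nn_integral_cmult[symmetric] mult.assoc)
    also have "\<dots> \<le> (\<integral>\<^sup>+z. ennreal (C * l ^ DIM('a)) * (G z * riesz_kernel (x - z)) \<partial>lborel)"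
    proof (rule nn_integral_mono_AE)
      show "AE z in lborel. G z * (\<integral>\<^sup>+y. riesz_kernel (y - z) * indicator ?Q y \<partial>lborel) \<le> ennreal (C * l ^ DIM('a)) * (G z * riesz_kernel (x - z))"
        using AE_lborel_singleton[of x]
      proof eventually_elim
        case (elim z)
        have "G z * (\<integral>\<^sup>+y. riesz_kernel (y - z) * indicator ?Q y \<partial>lborel) \<le> G z * (ennreal (C * l ^ DIM('a)) * riesz_kernel (x - z))"
          by (intro mult_left_mono ker elim) simp
        then show ?case by (simp add: mult_ac)
      qed
    qed
    also have "\<dots> = ennreal (C * l ^ DIM('a)) * riesz_potential G x"
      unfolding riesz_potential_def by (rule nn_integral_cmult) measurable
    finally show "(\<integral>\<^sup>+y\<in>?Q. riesz_potential G y \<partial>lborel) \<le> ennreal (C * l ^ DIM('a)) * riesz_potential G x" .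
  qed
qed

section \<open>The Lorentz maximal function\<close>

lemma ennreal_mult_mult:
  "0 \<le> a \<Longrightarrow> 0 \<le> b \<Longrightarrow> ennreal a * (ennreal b * R) = ennreal (a * b) * R"
  by (simp add: ennreal_mult mult.assoc)

lemma powr_add_le_add_powr:
  fixes a b q :: real
  assumes "0 \<le> a" "0 \<le> b" "0 < q" "q \<le> 1"
  shows "(a + b) powr q \<le> a powr q + b powr q"
proof (cases "a + b = 0")
  case False
  then have s: "a + b > 0" using assms by simp
  have le: "t / (a + b) \<le> (t / (a + b)) powr q" if "0 \<le> t" "t \<le> a + b" for t
    using powr_mono'[of q 1 "t / (a + b)"] that s assms by simp
  have "1 = a / (a + b) + b / (a + b)" using s by (simp flip: add_divide_distrib)
  also have "\<dots> \<le> (a / (a + b)) powr q + (b / (a + b)) powr q"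
    using assms by (intro add_mono le) auto
  also have "\<dots> = (a powr q + b powr q) / (a + b) powr q"
    using assms s by (simp add: powr_divide add_divide_distrib)
  finally show ?thesis using s by (simp add: pos_le_divide_eq)
qed (use assms in \<open>simp add: add_nonneg_eq_0_iff\<close>)

text \<open>Up to the factor \<open>n' |Q|\<^bsup>-1/n'\<^esup>\<close> this is the normalised norm of \<open>f\<close> in \<open>L\<^bsup>n',1\<^esup>(Q)\<close>.\<close>

definition lorentz_integral :: "('a::euclidean_space \<Rightarrow> 'b::real_normed_vector) \<Rightarrow> 'a set \<Rightarrow> ennreal" where
  "lorentz_integral f Q =
    (\<integral>\<^sup>+t\<in>{0<..}. ennreal (measure lborel {y\<in>Q. t < norm (f y)} powr (1 - 1 / DIM('a))) \<partial>lborel)"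

lemma measurable_measure_level_set_cube:
  fixes u :: "'a::euclidean_space \<Rightarrow> real"
  assumes [measurable]: "u \<in> borel_measurable borel" and "l \<ge> 0"
  shows "(\<lambda>t. measure lborel {y\<in>cube a l. t < u y}) \<in> borel_measurable borel"
proof -
  have "mono (\<lambda>t. - measure lborel {y\<in>cube a l. t < u y})"
  proof (rule monoI)
    fix s t :: real assume "s \<le> t"
    have "ennreal (measure lborel {y\<in>cube a l. t < u y}) \<le> ennreal (measure lborel {y\<in>cube a l. s < u y})"
      unfolding measure_level_set_cube(1)[OF assms, symmetric] using \<open>s \<le> t\<close>
      by (intro emeasure_mono) auto
    then show "- measure lborel {y\<in>cube a l. s < u y} \<le> - measure lborel {y\<in>cube a l. t < u y}" by simp
  qed
  from borel_measurable_uminus[OF borel_measurable_mono[OF this]] show ?thesis by simp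
qed

text \<open>The constant \<open>c\<close> of the Poincare inequality is controlled by the mean of \<open>f\<close>, hence by the
  mean of the Riesz potential.\<close>

lemma lorentz_integral_cube_le_riesz_potential:
  assumes dim: "DIM('a::euclidean_space) \<ge> 2"
  obtains C :: real where "C > 0" and
    "\<And>(f :: 'a \<Rightarrow> 'b::real_normed_vector) G a l x. upper_gradient f G \<Longrightarrow> continuous_on UNIV f \<Longrightarrow>
      bounded {x. f x \<noteq> 0} \<Longrightarrow> G \<in> borel_measurable borel \<Longrightarrow> l > 0 \<Longrightarrow> x \<in> cube a l \<Longrightarrow>
      lorentz_integral f (cube a l) \<le> ennreal (C * l powr (real DIM('a) - 1)) * riesz_potential G x"
proof -
  let ?n = "real DIM('a)" and ?q = "1 - 1 / real DIM('a)"
  have q: "0 < ?q" "?q \<le> 1" using dim by (auto simp: field_simps)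
  obtain C1 :: real where "C1 > 0" and C1:
    "\<And>(f :: 'a \<Rightarrow> 'b) G a l. upper_gradient f G \<Longrightarrow> continuous_on UNIV f \<Longrightarrow> G \<in> borel_measurable borel \<Longrightarrow> l > 0 \<Longrightarrow>
      \<exists>c. (\<integral>\<^sup>+x\<in>cube a l. ennreal (norm (f x - c)) \<partial>lborel) \<le> ennreal (C1 * l) * (\<integral>\<^sup>+y\<in>cube a l. G y \<partial>lborel) \<and>
        (\<integral>\<^sup>+t\<in>{0<..}. ennreal (measure lborel {x\<in>cube a l. t < norm (f x - c)} powr (1 - 1 / DIM('a))) \<partial>lborel)
          \<le> ennreal C1 * (\<integral>\<^sup>+y\<in>cube a l. G y \<partial>lborel)"
    using lorentz_poincare by blast
  obtain C2 :: real where "C2 > 0" and C2: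
    "\<And>(f :: 'a \<Rightarrow> 'b) G x. upper_gradient f G \<Longrightarrow> continuous_on UNIV f \<Longrightarrow>
      bounded {x. f x \<noteq> 0} \<Longrightarrow> G \<in> borel_measurable borel \<Longrightarrow> ennreal (norm (f x)) \<le> ennreal C2 * riesz_potential G x"
    using norm_le_riesz_potential by blast
  obtain C3 :: real where "C3 > 0" and C3:
    "\<And>(G :: 'a \<Rightarrow> ennreal) a l x. G \<in> borel_measurable borel \<Longrightarrow> l > 0 \<Longrightarrow> x \<in> cube a l \<Longrightarrow>
      (\<integral>\<^sup>+y\<in>cube a l. riesz_potential G y \<partial>lborel) \<le> ennreal (C3 * l ^ DIM('a)) * riesz_potential G x"
    using integral_cube_riesz_potential_le by blast
  define N where "N = ?n powr (?n - 1)"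
  have "N > 0" using dim by (simp add: N_def)
  define K where "K = C1 * N + C2 * C3"
  have "K > 0" using \<open>N > 0\<close> \<open>C1 > 0\<close> \<open>C2 > 0\<close> \<open>C3 > 0\<close> by (simp add: K_def add_pos_pos)
  show thesis
  proof (rule that[of "2 * C1 * N + 2 * K"])
    show "2 * C1 * N + 2 * K > 0" using \<open>C1 > 0\<close> \<open>N > 0\<close> \<open>K > 0\<close> by (simp add: add_pos_pos)
    fix f :: "'a \<Rightarrow> 'b" and G a l and x :: 'a
    assume f: "upper_gradient f G" and cont: "continuous_on UNIV f" and bd: "bounded {x. f x \<noteq> 0}"
      and [measurable]: "G \<in> borel_measurable borel" and "l > 0" and x: "x \<in> cube a l"
    let ?Q = "cube a l :: 'a set"
    define R where "R = riesz_potential G x"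
    define L where "L = l powr (?n - 1)"
    have "L > 0" using \<open>l > 0\<close> by (simp add: L_def)
    have Ll: "L * l = l ^ DIM('a)" using \<open>l > 0\<close> dim by (simp add: L_def powr_diff powr_realpow)
    obtain c where c1: "(\<integral>\<^sup>+x\<in>?Q. ennreal (norm (f x - c)) \<partial>lborel) \<le> ennreal (C1 * l) * (\<integral>\<^sup>+y\<in>?Q. G y \<partial>lborel)"
      and c2: "(\<integral>\<^sup>+t\<in>{0<..}. ennreal (measure lborel {x\<in>?Q. t < norm (f x - c)} powr ?q) \<partial>lborel)
          \<le> ennreal C1 * (\<integral>\<^sup>+y\<in>?Q. G y \<partial>lborel)"
      using C1[OF f cont _ \<open>l > 0\<close>] by force
    have mu [measurable]: "(\<lambda>y. norm (f y)) \<in> borel_measurable borel" "(\<lambda>y. norm (f y - c)) \<in> borel_measurable borel"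
      by (intro borel_measurable_continuous_onI continuous_intros cont)+
    have \<Gamma>: "(\<integral>\<^sup>+y\<in>?Q. G y \<partial>lborel) \<le> ennreal (N * L) * R"
      using integral_cube_le_riesz_potential[OF _ \<open>l > 0\<close> x, of G] \<open>l > 0\<close> by (simp add: N_def L_def R_def powr_mult)
    have "ennreal (norm c * l ^ DIM('a)) = (\<integral>\<^sup>+y. ennreal (norm c) * indicator ?Q y \<partial>lborel)"
      using \<open>l > 0\<close> by (simp add: nn_integral_cmult emeasure_cube ennreal_mult)
    also have "\<dots> \<le> (\<integral>\<^sup>+y. ennreal (norm (f y - c)) * indicator ?Q y + ennreal (norm (f y)) * indicator ?Q y \<partial>lborel)"
    proof (rule nn_integral_mono)
      fix y
      have "norm c \<le> norm (f y - c) + norm (f y)" using norm_triangle_ineq4[of "f y" "f y - c"] by simp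
      then show "ennreal (norm c) * indicator ?Q y \<le> ennreal (norm (f y - c)) * indicator ?Q y + ennreal (norm (f y)) * indicator ?Q y"
        by (auto simp: indicator_def ennreal_leI simp flip: ennreal_plus)
    qed
    also have "\<dots> = (\<integral>\<^sup>+y\<in>?Q. ennreal (norm (f y - c)) \<partial>lborel) + (\<integral>\<^sup>+y\<in>?Q. ennreal (norm (f y)) \<partial>lborel)"
      by (rule nn_integral_add) measurable
    also have "\<dots> \<le> ennreal (C1 * l) * (ennreal (N * L) * R) + ennreal C2 * (ennreal (C3 * l ^ DIM('a)) * R)"
    proof (rule add_mono)
      show "(\<integral>\<^sup>+y\<in>?Q. ennreal (norm (f y - c)) \<partial>lborel) \<le> ennreal (C1 * l) * (ennreal (N * L) * R)"
        by (rule order_trans[OF c1 mult_left_mono[OF \<Gamma> zero_le]])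
      have "(\<integral>\<^sup>+y\<in>?Q. ennreal (norm (f y)) \<partial>lborel) \<le> (\<integral>\<^sup>+y. ennreal C2 * (riesz_potential G y * indicator ?Q y) \<partial>lborel)"
      proof (rule nn_integral_mono)
        fix y
        show "ennreal (norm (f y)) * indicator ?Q y \<le> ennreal C2 * (riesz_potential G y * indicator ?Q y)"
          using C2[OF f cont bd, of y] by (simp add: indicator_def)
      qed
      also have "\<dots> = ennreal C2 * (\<integral>\<^sup>+y\<in>?Q. riesz_potential G y \<partial>lborel)"
        by (rule nn_integral_cmult) measurable
      also have "\<dots> \<le> ennreal C2 * (ennreal (C3 * l ^ DIM('a)) * R)"
        unfolding R_def by (intro mult_left_mono C3 \<open>l > 0\<close> x) auto
      finally show "(\<integral>\<^sup>+y\<in>?Q. ennreal (norm (f y)) \<partial>lborel) \<le> ennreal C2 * (ennreal (C3 * l ^ DIM('a)) * R)" .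
    qed
    also have "\<dots> = ennreal (K * l ^ DIM('a)) * R"
    proof -
      have "ennreal (C1 * l) * (ennreal (N * L) * R) = ennreal (C1 * N * l ^ DIM('a)) * R"
      proof -
        have e: "C1 * N * l ^ DIM('a) = C1 * l * (N * L)" unfolding Ll[symmetric] by (simp only: mult_ac)
        show ?thesis
          unfolding e by (rule ennreal_mult_mult) (use \<open>C1 > 0\<close> \<open>N > 0\<close> \<open>L > 0\<close> \<open>l > 0\<close> in auto)
      qed
      moreover have "ennreal C2 * (ennreal (C3 * l ^ DIM('a)) * R) = ennreal (C2 * C3 * l ^ DIM('a)) * R"
        using \<open>C2 > 0\<close> \<open>C3 > 0\<close> \<open>l > 0\<close> by (subst ennreal_mult_mult) (auto simp: mult.assoc)
      moreover have "ennreal (C1 * N * l ^ DIM('a)) + ennreal (C2 * C3 * l ^ DIM('a)) = ennreal (K * l ^ DIM('a))"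
        using \<open>C1 > 0\<close> \<open>N > 0\<close> \<open>C2 > 0\<close> \<open>C3 > 0\<close> \<open>l > 0\<close> by (simp add: K_def distrib_right)
      ultimately show ?thesis by (simp only: distrib_right[symmetric])
    qed
    finally have "ennreal (1 / l ^ DIM('a)) * ennreal (norm c * l ^ DIM('a)) \<le> ennreal (1 / l ^ DIM('a)) * (ennreal (K * l ^ DIM('a)) * R)"
      by (rule mult_left_mono) simp
    moreover have "ennreal (1 / l ^ DIM('a)) * ennreal (norm c * l ^ DIM('a)) = ennreal (norm c)"
      using \<open>l > 0\<close> by (simp flip: ennreal_mult)
    moreover have "ennreal (1 / l ^ DIM('a)) * (ennreal (K * l ^ DIM('a)) * R) = ennreal K * R"
      using \<open>l > 0\<close> \<open>K > 0\<close> by (subst ennreal_mult_mult) auto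
    ultimately have cR: "ennreal (norm c) \<le> ennreal K * R" by simp
    define V where "V = (\<lambda>t. measure lborel {y\<in>?Q. t < norm (f y - c)})"
    have [measurable]: "V \<in> borel_measurable borel"
      unfolding V_def using \<open>l > 0\<close> by (intro measurable_measure_level_set_cube) auto
    have Vn: "V t \<ge> 0" for t by (simp add: V_def)
    have "lorentz_integral f ?Q \<le> (\<integral>\<^sup>+t. ennreal (V (0 + 1/2 * t) powr ?q) * indicator {0<..} (0 + 1/2 * t) + ennreal L * indicator {0<..2 * norm c} t \<partial>lborel)"
      unfolding lorentz_integral_def
    proof (rule nn_integral_mono)
      fix t :: real
      show "ennreal (measure lborel {y\<in>?Q. t < norm (f y)} powr ?q) * indicator {0<..} t \<le>
        ennreal (V (0 + 1/2 * t) powr ?q) * indicator {0<..} (0 + 1/2 * t) + ennreal L * indicator {0<..2 * norm c} t"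
      proof (cases "t > 0")
        case t: True
        show ?thesis
        proof (cases "t \<le> 2 * norm c")
          case True
          have "measure lborel {y\<in>?Q. t < norm (f y)} powr ?q \<le> (l ^ DIM('a)) powr ?q"
            using q \<open>l > 0\<close> by (intro powr_mono2 measure_level_set_cube(2)) auto
          also have "\<dots> = L"
            using \<open>l > 0\<close> dim by (simp add: L_def powr_powr right_diff_distrib flip: powr_realpow)
          finally show ?thesis using t True by (simp add: ennreal_leI add_increasing)
        next
          case False
          have "ennreal (measure lborel {y\<in>?Q. t < norm (f y)}) \<le> ennreal (V (t / 2))"
          proof -
            have "{y\<in>?Q. t < norm (f y)} \<subseteq> {y\<in>?Q. t / 2 < norm (f y - c)}"
            proof safe
              fix y assume "t < norm (f y)"
              moreover have "norm (f y) \<le> norm (f y - c) + norm c" using norm_triangle_sub[of "f y" c] by linarith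
              ultimately show "t / 2 < norm (f y - c)" using False by linarith
            qed
            then show ?thesis
              unfolding V_def using \<open>l > 0\<close>
              by (subst (1 2) measure_level_set_cube(1)[symmetric]) (auto intro!: emeasure_mono)
          qed
          then have "measure lborel {y\<in>?Q. t < norm (f y)} powr ?q \<le> V (t / 2) powr ?q"
            using q Vn by (intro powr_mono2) auto
          then show ?thesis using t by (simp add: ennreal_leI add_increasing2)
        qed
      qed simp
    qed
    also have "\<dots> = (\<integral>\<^sup>+t. ennreal (V (0 + 1/2 * t) powr ?q) * indicator {0<..} (0 + 1/2 * t) \<partial>lborel) + ennreal L * ennreal (2 * norm c)"
      by (subst nn_integral_add) (auto simp: nn_integral_cmult)
    also have "(\<integral>\<^sup>+t. ennreal (V (0 + 1/2 * t) powr ?q) * indicator {0<..} (0 + 1/2 * t) \<partial>lborel) = ennreal 2 * (\<integral>\<^sup>+t\<in>{0<..}. ennreal (V t powr ?q) \<partial>lborel)"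
    proof -
      have "(\<integral>\<^sup>+t\<in>{0<..}. ennreal (V t powr ?q) \<partial>lborel) =
        ennreal \<bar>1/2\<bar> * (\<integral>\<^sup>+t. ennreal (V (0 + 1/2 * t) powr ?q) * indicator {0<..} (0 + 1/2 * t) \<partial>lborel)"
        by (rule nn_integral_real_affine) auto
      then have "ennreal 2 * (\<integral>\<^sup>+t\<in>{0<..}. ennreal (V t powr ?q) \<partial>lborel) =
        ennreal 2 * (ennreal (1/2) * (\<integral>\<^sup>+t. ennreal (V (0 + 1/2 * t) powr ?q) * indicator {0<..} (0 + 1/2 * t) \<partial>lborel))"
        by simp
      then show ?thesis by (subst (asm) ennreal_mult_mult) auto
    qed
    also have "\<dots> + ennreal L * ennreal (2 * norm c) \<le> ennreal 2 * (ennreal C1 * (ennreal (N * L) * R)) + ennreal L * (ennreal 2 * (ennreal K * R))"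
    proof (intro add_mono mult_left_mono)
      show "(\<integral>\<^sup>+t\<in>{0<..}. ennreal (V t powr ?q) \<partial>lborel) \<le> ennreal C1 * (ennreal (N * L) * R)"
        unfolding V_def by (rule order_trans[OF c2 mult_left_mono[OF \<Gamma> zero_le]])
      show "ennreal (2 * norm c) \<le> ennreal 2 * (ennreal K * R)"
        using mult_left_mono[OF cR, of "ennreal 2"] by (simp add: ennreal_mult)
    qed auto
    also have "\<dots> = ennreal ((2 * C1 * N + 2 * K) * L) * R"
    proof -
      have "ennreal 2 * (ennreal C1 * (ennreal (N * L) * R)) = ennreal (2 * C1 * N * L) * R"
        using \<open>C1 > 0\<close> \<open>N > 0\<close> \<open>L > 0\<close> by (simp only: ennreal_mult_mult mult_nonneg_nonneg less_imp_le zero_le_numeral mult.assoc)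
      moreover have "ennreal L * (ennreal 2 * (ennreal K * R)) = ennreal (2 * K * L) * R"
      proof -
        have e: "2 * K * L = L * 2 * K" by simp
        show ?thesis
          unfolding e using \<open>K > 0\<close> \<open>L > 0\<close>
          by (simp only: ennreal_mult_mult mult_nonneg_nonneg less_imp_le zero_le_numeral mult.assoc)
      qed
      moreover have "ennreal (2 * C1 * N * L) + ennreal (2 * K * L) = ennreal ((2 * C1 * N + 2 * K) * L)"
        using \<open>C1 > 0\<close> \<open>N > 0\<close> \<open>L > 0\<close> \<open>K > 0\<close> by (simp add: distrib_right)
      ultimately show ?thesis by (simp only: distrib_right[symmetric])
    qed
    finally show "lorentz_integral f ?Q \<le> ennreal ((2 * C1 * N + 2 * K) * l powr (?n - 1)) * riesz_potential G x"
      by (simp add: L_def R_def)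
  qed
qed

lemma epowr_ennreal: "0 \<le> m \<Longrightarrow> 0 < a \<Longrightarrow> epowr (ennreal m) a = ennreal (m powr a)"
  by (auto simp: epowr_def ennreal_eq_0_iff)

lemma lorentz_norm_cube:
  fixes f :: "'a::euclidean_space \<Rightarrow> 'b::real_normed_vector"
  assumes dim: "DIM('a) \<ge> 2" and cont: "continuous_on UNIV f" and "l > 0"
  shows "lorentz_norm (conj_exponent (real DIM('a))) (cube a l) (\<lambda>x. ennreal (norm (f x))) =
    ennreal (l powr (1 - real DIM('a)) * conj_exponent (real DIM('a))) * lorentz_integral f (cube a l)"
proof -
  let ?n = "real DIM('a)" and ?Q = "cube a l"
  have q: "1 / conj_exponent ?n = 1 - 1 / ?n" "conj_exponent ?n > 0"
    using dim by (auto simp: conj_exponent_def field_simps)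
  have mu [measurable]: "(\<lambda>y. norm (f y)) \<in> borel_measurable borel"
    by (intro borel_measurable_continuous_onI continuous_intros cont)
  have 1: "epowr (emeasure lebesgue ?Q) (- 1 / conj_exponent ?n) = ennreal (l powr (1 - ?n))"
  proof -
    have "epowr (emeasure lebesgue ?Q) (- 1 / conj_exponent ?n) = ennreal ((l ^ DIM('a)) powr (- (1 - 1 / ?n)))"
      using \<open>l > 0\<close> q dim by (simp add: emeasure_cube epowr_def ennreal_eq_0_iff not_le flip: q(1))
    also have "(l ^ DIM('a)) powr (- (1 - 1 / ?n)) = l powr (1 - ?n)"
      using \<open>l > 0\<close> dim by (simp add: powr_powr right_diff_distrib flip: powr_realpow)
    finally show ?thesis .
  qed
  have 2: "epowr (emeasure lebesgue {y \<in> ?Q. ennreal (norm (f y)) > ennreal t}) (1 / conj_exponent ?n) * indicator {0<..} t =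
    ennreal (measure lborel {y\<in>?Q. t < norm (f y)} powr (1 - 1 / ?n)) * indicator {0<..} t" for t
  proof (cases "t > 0")
    case True
    then have "{y \<in> ?Q. ennreal (norm (f y)) > ennreal t} = {y\<in>?Q. t < norm (f y)}"
      by (auto simp: ennreal_less_iff)
    moreover have "emeasure lebesgue {y\<in>?Q. t < norm (f y)} = ennreal (measure lborel {y\<in>?Q. t < norm (f y)})"
      using measure_level_set_cube(1)[OF mu] \<open>l > 0\<close> by simp
    moreover have "1 - 1 / ?n > 0" using dim by (simp add: field_simps)
    ultimately show ?thesis using q by (simp add: epowr_ennreal)
  qed simp
  show ?thesis
    unfolding lorentz_norm_def lorentz_integral_def 1 2 using q(2) \<open>l > 0\<close> by (simp add: ennreal_mult)
qed

section \<open>Kernels in the weak Lebesgue space on the sphere\<close>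

lemma nn_integral_polar_product:
  fixes h :: "'a::euclidean_space \<Rightarrow> ennreal" and k :: "real \<Rightarrow> ennreal"
  assumes [measurable]: "h \<in> borel_measurable borel" "k \<in> borel_measurable borel"
  shows "(\<integral>\<^sup>+z. h (sgn z) * k (norm z) * riesz_kernel z \<partial>lborel) =
    (\<integral>\<^sup>+y. h y \<partial>sphere_measure) * (\<integral>\<^sup>+s\<in>{0<..}. k s \<partial>lborel)"
proof -
  have m: "h \<in> borel_measurable (sphere_measure :: 'a measure)"
  proof -
    have "h \<in> borel_measurable (restrict_space borel (sphere 0 1))"
      by (intro measurable_restrict_space1) simp
    then show ?thesis unfolding sphere_measure_def by (intro measurable_completion) simp
  qed
  have "(\<integral>\<^sup>+z. h (sgn z) * k (norm z) * riesz_kernel z \<partial>lborel) =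
    (\<integral>\<^sup>+y. (\<integral>\<^sup>+s\<in>{0<..}. h (sgn (s *\<^sub>R y)) * k (norm (s *\<^sub>R y)) \<partial>lborel) \<partial>sphere_measure)"
    by (rule nn_integral_polar[symmetric]) measurable
  also have "\<dots> = (\<integral>\<^sup>+y. h y * (\<integral>\<^sup>+s\<in>{0<..}. k s \<partial>lborel) \<partial>sphere_measure)"
  proof (rule nn_integral_cong)
    fix y :: 'a assume "y \<in> space sphere_measure"
    then have y: "norm y = 1" by simp
    have "(\<integral>\<^sup>+s\<in>{0<..}. h (sgn (s *\<^sub>R y)) * k (norm (s *\<^sub>R y)) \<partial>lborel) = (\<integral>\<^sup>+s. h y * (k s * indicator {0<..} s) \<partial>lborel)"
      using y by (intro nn_integral_cong) (auto simp: indicator_def sgn_div_norm)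
    also have "\<dots> = h y * (\<integral>\<^sup>+s\<in>{0<..}. k s \<partial>lborel)" by (rule nn_integral_cmult) measurable
    finally show "(\<integral>\<^sup>+s\<in>{0<..}. h (sgn (s *\<^sub>R y)) * k (norm (s *\<^sub>R y)) \<partial>lborel) = h y * (\<integral>\<^sup>+s\<in>{0<..}. k s \<partial>lborel)" .
  qed
  also have "\<dots> = (\<integral>\<^sup>+y. h y \<partial>sphere_measure) * (\<integral>\<^sup>+s\<in>{0<..}. k s \<partial>lborel)"
    by (rule nn_integral_multc[OF m])
  finally show ?thesis .
qed

lemma borel_measurable_sphere_measure:
  fixes h :: "'a::euclidean_space \<Rightarrow> 'b::topological_space"
  assumes "h \<in> borel_measurable borel"
  shows "h \<in> borel_measurable sphere_measure"
proof -
  have "h \<in> borel_measurable (restrict_space borel (sphere 0 1))"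
    by (intro measurable_restrict_space1 assms)
  then show ?thesis unfolding sphere_measure_def by (intro measurable_completion) simp
qed

text \<open>By polar coordinates the cone over a null set of the sphere is a null set of the space.\<close>

lemma AE_sgn_of_AE_sphere_measure:
  assumes "AE y in (sphere_measure :: 'a::euclidean_space measure). P y"
  shows "AE z in lborel. P (sgn (z :: 'a))"
proof -
  let ?S = "restrict_space borel (sphere 0 (1::real)) :: 'a measure"
  define M where "M = scale_measure (of_nat DIM('a)) (distr (restrict_space lborel (cball 0 1 - {0::'a})) ?S sgn)"
  have M: "sphere_measure = completion M" "sets M = sets ?S" by (simp_all add: sphere_measure_def M_def)
  have spM: "space M = sphere 0 1" by (simp add: M_def space_scale_measure space_restrict_space)
  from assms obtain N where N: "{y\<in>space M. \<not> P y} \<subseteq> N" "emeasure M N = 0" "N \<in> sets M"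
    unfolding M(1) AE_completion_iff by (rule AE_E)
  have Nb [measurable]: "N \<in> sets borel" and Ns: "N \<subseteq> sphere 0 1"
    using N(3) unfolding M(2) by (auto simp: sets_restrict_space)
  have "(\<integral>\<^sup>+z. indicator N (sgn z) * 1 * riesz_kernel z \<partial>lborel) = (\<integral>\<^sup>+y. indicator N y \<partial>sphere_measure) * (\<integral>\<^sup>+s\<in>{0<..}. 1 \<partial>(lborel :: real measure))"
    by (rule nn_integral_polar_product[where k = "\<lambda>_. 1"]) auto
  also have "(\<integral>\<^sup>+y. indicator N y \<partial>sphere_measure) = emeasure M N"
    unfolding M(1) nn_integral_completion using N(3) by simp
  finally have "(\<integral>\<^sup>+z. indicator N (sgn z) * riesz_kernel z \<partial>lborel) = 0" using N(2) by simp
  then have "AE z in lborel. indicator N (sgn z) * riesz_kernel (z::'a) = 0"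
    by (subst (asm) nn_integral_0_iff_AE) auto
  with AE_lborel_singleton[of 0] show ?thesis
  proof eventually_elim
    case (elim z)
    then have "riesz_kernel z > 0" "norm (sgn z) = 1" by (auto simp: riesz_kernel_def norm_sgn)
    then have "sgn z \<notin> N" "sgn z \<in> space M" using elim spM by (auto simp: indicator_def split: if_splits)
    then show ?case using N(1) by auto
  qed
qed

text \<open>\<open>\<Omega>\<close> is only measurable for completed measures, which interact badly with product measures; a Borel
  representative that is constant along rays, also at the level of single points, avoids this.\<close>

lemma weak_Lp_sphere_borel_version:
  fixes \<Omega> :: "'a::euclidean_space \<Rightarrow> complex"
  assumes "\<Omega> \<in> borel_measurable sphere_measure" and hom: "homogeneous_degree_0 \<Omega>"
  obtains \<Theta> where "\<Theta> \<in> borel_measurable borel" "\<And>y. \<Theta> (sgn y) = \<Theta> y"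
    "AE y in sphere_measure. \<Omega> y = \<Theta> y" "AE y in lborel. \<Omega> y = \<Theta> y"
proof -
  let ?S = "restrict_space borel (sphere 0 (1::real)) :: 'a measure"
  define M where "M = scale_measure (of_nat DIM('a)) (distr (restrict_space lborel (cball 0 1 - {0::'a})) ?S sgn)"
  have M: "sphere_measure = completion M" "sets M = sets ?S" by (simp_all add: sphere_measure_def M_def)
  have "(\<lambda>y. Re (\<Omega> y)) \<in> borel_measurable (completion M)" "(\<lambda>y. Im (\<Omega> y)) \<in> borel_measurable (completion M)"
    using assms(1) unfolding M(1) by measurable
  from this[THEN completion_ex_borel_measurable_real]
  obtain g1 g2 where g: "g1 \<in> borel_measurable M" "g2 \<in> borel_measurable M"
    and AEg: "AE y in M. Re (\<Omega> y) = g1 y" "AE y in M. Im (\<Omega> y) = g2 y"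
    by blast
  define \<Theta>0 where "\<Theta>0 = (\<lambda>y. indicator (sphere 0 1) y *\<^sub>R Complex (g1 y) (g2 y))"
  have "(\<lambda>y. Complex (g1 y) (g2 y)) \<in> borel_measurable ?S"
    using g unfolding measurable_cong_sets[OF M(2) refl] by (simp add: borel_measurable_complex_iff)
  then have [measurable]: "\<Theta>0 \<in> borel_measurable borel"
    unfolding \<Theta>0_def by (subst (asm) borel_measurable_restrict_space_iff) auto
  define \<Theta> where "\<Theta> = (\<lambda>y. \<Theta>0 (sgn y))"
  have 1: "\<Theta> \<in> borel_measurable borel" unfolding \<Theta>_def by measurable
  have 2: "\<Theta> (sgn y) = \<Theta> y" for y by (cases "y = 0") (simp_all add: \<Theta>_def sgn_div_norm)
  have spM: "space M = sphere 0 1" by (simp add: M_def space_scale_measure space_restrict_space)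
  have "AE y in M. \<Omega> y = \<Theta> y"
    using AEg AE_space
  proof eventually_elim
    case (elim y)
    then have "norm y = 1" using spM by simp
    then have "\<Theta> y = Complex (g1 y) (g2 y)" by (simp add: \<Theta>_def \<Theta>0_def sgn_div_norm)
    then show ?case using elim by (simp add: complex_eq_iff)
  qed
  then have 3: "AE y in sphere_measure. \<Omega> y = \<Theta> y" unfolding M(1) by (rule AE_completion)
  have 4: "AE z in lborel. \<Omega> z = \<Theta> z"
    using AE_sgn_of_AE_sphere_measure[OF 3] AE_lborel_singleton[of 0]
  proof eventually_elim
    case (elim z)
    have "\<Omega> (inverse (norm z) *\<^sub>R z) = \<Omega> z" using hom elim(2) unfolding homogeneous_degree_0_def by simp
    then show ?case using elim 2[of z] by (simp add: sgn_div_norm)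
  qed
  from that[OF 1 2 3 4] show thesis .
qed

text \<open>The set where \<open>norm (\<Theta> y) > t\<close> is a cone, whose volume in the ball of radius \<open>R\<close> is \<open>R\<^sup>n / n\<close> times the
  surface measure of its base.\<close>

lemma distribution_of_weak_Lp_sphere:
  fixes \<Omega> \<Theta> :: "'a::euclidean_space \<Rightarrow> complex"
  assumes weak: "\<Omega> \<in> weak_Lp_sphere (real DIM('a))"
    and [measurable]: "\<Theta> \<in> borel_measurable borel" and hom: "\<And>y. \<Theta> (sgn y) = \<Theta> y"
    and AE: "AE y in sphere_measure. \<Omega> y = \<Theta> y"
  obtains A :: real where "A > 0" "\<And>R t. R > 0 \<Longrightarrow> t > 0 \<Longrightarrow>
    emeasure lborel {y\<in>cball 0 R. t < norm (\<Theta> y)} \<le> ennreal (A * R ^ DIM('a) * t powr - real DIM('a))"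
proof -
  let ?n = "real DIM('a)"
  have n: "?n \<ge> 1" using DIM_positive[where 'a='a] by linarith
  define W where "W = (SUP t\<in>{0<..}. ennreal t * epowr (emeasure sphere_measure {y \<in> sphere 0 1. norm (\<Omega> y) > t}) (1 / ?n))"
  have "W < \<infinity>" using weak by (simp add: weak_Lp_sphere_def W_def)
  then obtain w where w: "W = ennreal w" "w \<ge> 0" by (cases W) auto
  have Om: "\<Omega> \<in> borel_measurable sphere_measure" using weak by (simp add: weak_Lp_sphere_def)
  show thesis
  proof (rule that[of "w powr ?n / ?n + 1"])
    show "w powr ?n / ?n + 1 > 0" using n by (intro add_nonneg_pos) auto
    fix R t :: real assume "R > 0" "t > 0"
    let ?E = "{y \<in> sphere 0 1. norm (\<Omega> y) > t}"
    have Efin: "emeasure sphere_measure ?E < \<infinity>"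
      using emeasure_mono[of ?E "sphere 0 1" sphere_measure] emeasure_sphere_measure_finite[where 'a='a]
      by (metis (no_types, lifting) emeasure_space le_less_trans mem_Collect_eq sets.top space_sphere_measure subsetI)
    define e where "e = measure sphere_measure ?E"
    have e: "emeasure sphere_measure ?E = ennreal e" "e \<ge> 0"
      using Efin by (auto simp: e_def intro!: emeasure_eq_ennreal_measure)
    have "ennreal t * epowr (emeasure sphere_measure ?E) (1 / ?n) \<le> W"
      unfolding W_def using \<open>t > 0\<close> by (intro SUP_upper) auto
    then have "t * e powr (1 / ?n) \<le> w" using \<open>t > 0\<close> e n w by (simp add: epowr_ennreal flip: ennreal_mult)
    then have "e powr (1 / ?n) \<le> w / t" using \<open>t > 0\<close> by (simp add: field_simps)
    then have "(e powr (1 / ?n)) powr ?n \<le> (w / t) powr ?n" using n by (intro powr_mono2) auto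
    then have e_le: "e \<le> w powr ?n * t powr - ?n"
      using e n w \<open>t > 0\<close> by (cases "e = 0") (auto simp: powr_powr powr_divide powr_minus field_simps)
    have "of_nat DIM('a) * emeasure lborel {y\<in>cball 0 1 - {0}. t < norm (\<Theta> y)} =
      of_nat DIM('a) * (\<integral>\<^sup>+z\<in>cball 0 1 - {0}. indicator {y. t < norm (\<Theta> y)} (sgn z) \<partial>lborel)"
    proof -
      have "(\<integral>\<^sup>+z\<in>cball 0 1 - {0}. indicator {y. t < norm (\<Theta> y)} (sgn z) \<partial>lborel) = (\<integral>\<^sup>+z. indicator {y\<in>cball 0 1 - {0}. t < norm (\<Theta> y)} z \<partial>lborel)"
        by (intro nn_integral_cong) (auto simp: indicator_def hom)
      also have "\<dots> = emeasure lborel {y\<in>cball 0 1 - {0}. t < norm (\<Theta> y)}"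
        by (rule nn_integral_indicator) measurable
      finally show ?thesis by simp
    qed
    also have "\<dots> = (\<integral>\<^sup>+y. indicator {y. t < norm (\<Theta> y)} y \<partial>sphere_measure)"
      by (rule nn_integral_sphere_measure[symmetric]) measurable
    also have "\<dots> = (\<integral>\<^sup>+y. indicator ?E y \<partial>sphere_measure)"
      using AE AE_space by (intro nn_integral_cong_AE, eventually_elim) (auto simp: indicator_def)
    also have "\<dots> = ennreal e"
    proof -
      have "{y \<in> space sphere_measure. norm (\<Omega> y) > t} \<in> sets sphere_measure" using Om by measurable
      then have "?E \<in> sets sphere_measure" by (simp only: space_sphere_measure)
      then show ?thesis using e by simp
    qed
    finally have "ennreal ?n * emeasure lborel {y\<in>cball 0 1 - {0}. t < norm (\<Theta> y)} = ennreal e"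
      by (simp add: ennreal_of_nat_eq_real_of_nat)
    then have "ennreal (1 / ?n) * (ennreal ?n * emeasure lborel {y\<in>cball 0 1 - {0}. t < norm (\<Theta> y)}) = ennreal (1 / ?n) * ennreal e"
      by simp
    then have ball1: "emeasure lborel {y\<in>cball 0 1 - {0}. t < norm (\<Theta> y)} = ennreal (e / ?n)"
      using e n by (subst (asm) ennreal_mult_mult) (auto simp flip: ennreal_mult)
    have "emeasure lborel {y\<in>cball 0 R. t < norm (\<Theta> y)} = (\<integral>\<^sup>+y. indicator {y\<in>cball 0 R. t < norm (\<Theta> y)} y \<partial>lborel)"
      by simp
    also have "\<dots> = ennreal (\<bar>R\<bar> ^ DIM('a)) * (\<integral>\<^sup>+y. indicator {y\<in>cball 0 R. t < norm (\<Theta> y)} (0 + R *\<^sub>R y) \<partial>lborel)"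
      by (rule nn_integral_dilation) (use \<open>R > 0\<close> in auto)
    also have "(\<integral>\<^sup>+y. indicator {y\<in>cball 0 R. t < norm (\<Theta> y)} (0 + R *\<^sub>R y) \<partial>lborel) = (\<integral>\<^sup>+y. indicator {y\<in>cball 0 1 - {0}. t < norm (\<Theta> y)} y \<partial>lborel)"
    proof (rule nn_integral_cong_AE)
      show "AE y in lborel. (indicator {y\<in>cball 0 R. t < norm (\<Theta> y)} (0 + R *\<^sub>R y) :: ennreal) = indicator {y\<in>cball 0 1 - {0}. t < norm (\<Theta> y)} y"
        using AE_lborel_singleton[of 0]
      proof eventually_elim
        case (elim y)
        have "\<Theta> (R *\<^sub>R y) = \<Theta> y"
          using hom[of "R *\<^sub>R y"] hom[of y] \<open>R > 0\<close> by (simp add: sgn_scaleR)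
        then show ?case using elim \<open>R > 0\<close> by (auto simp: indicator_def)
      qed
    qed
    also have "\<dots> = ennreal (e / ?n)" unfolding ball1[symmetric] by (rule nn_integral_indicator) measurable
    also have "ennreal (\<bar>R\<bar> ^ DIM('a)) * ennreal (e / ?n) = ennreal (R ^ DIM('a) * (e / ?n))"
      using \<open>R > 0\<close> e by (simp flip: ennreal_mult)
    also have "\<dots> \<le> ennreal ((w powr ?n / ?n + 1) * R ^ DIM('a) * t powr - ?n)"
    proof (rule ennreal_leI)
      have "R ^ DIM('a) * (e / ?n) \<le> R ^ DIM('a) * ((w powr ?n * t powr - ?n) / ?n)"
        using \<open>R > 0\<close> e_le n by (intro mult_left_mono divide_right_mono) auto
      also have "\<dots> = (w powr ?n / ?n) * R ^ DIM('a) * t powr - ?n" by simp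
      also have "\<dots> \<le> (w powr ?n / ?n + 1) * R ^ DIM('a) * t powr - ?n"
        using \<open>R > 0\<close> by (intro mult_right_mono) auto
      finally show "R ^ DIM('a) * (e / ?n) \<le> (w powr ?n / ?n + 1) * R ^ DIM('a) * t powr - ?n" .
    qed
    finally show "emeasure lborel {y\<in>cball 0 R. t < norm (\<Theta> y)} \<le> ennreal ((w powr ?n / ?n + 1) * R ^ DIM('a) * t powr - ?n)" .
  qed
qed

lemma nn_integral_layer_cake:
  fixes u :: "'a::euclidean_space \<Rightarrow> real" and g :: "'a \<Rightarrow> ennreal"
  assumes [measurable]: "u \<in> borel_measurable borel" "g \<in> borel_measurable borel" and "\<And>y. u y \<ge> 0"
  shows "(\<integral>\<^sup>+y. g y * ennreal (u y) \<partial>lborel) = (\<integral>\<^sup>+t\<in>{0<..}. (\<integral>\<^sup>+y. g y * indicator {y. t < u y} y \<partial>lborel) \<partial>lborel)"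
proof -
  have "(\<integral>\<^sup>+y. g y * ennreal (u y) \<partial>lborel) = (\<integral>\<^sup>+y. (\<integral>\<^sup>+t. g y * (indicator {0<..} t * indicator {y. t < u y} y) \<partial>lborel) \<partial>lborel)"
  proof (rule nn_integral_cong)
    fix y
    have "(\<integral>\<^sup>+t. g y * (indicator {0<..} t * indicator {y. t < u y} y) \<partial>lborel) = (\<integral>\<^sup>+t. g y * indicator {0<..<u y} t \<partial>lborel)"
      by (intro nn_integral_cong) (auto simp: indicator_def)
    also have "\<dots> = g y * ennreal (u y)" using assms(3)[of y] by (simp add: nn_integral_cmult)
    finally show "g y * ennreal (u y) = (\<integral>\<^sup>+t. g y * (indicator {0<..} t * indicator {y. t < u y} y) \<partial>lborel)" by simp
  qed
  also have "\<dots> = (\<integral>\<^sup>+t. (\<integral>\<^sup>+y. g y * (indicator {0<..} t * indicator {y. t < u y} y) \<partial>lborel) \<partial>lborel)"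
  proof -
    have "(\<lambda>(y, t). g y * (indicator {0<..} t * (if t < u y then 1 else 0))) \<in> borel_measurable (lborel \<Otimes>\<^sub>M lborel)" by measurable
    then have "(\<lambda>(y, t). g y * (indicator {0<..} t * indicator {y. t < u y} y)) \<in> borel_measurable (lborel \<Otimes>\<^sub>M lborel)"
      by (simp add: indicator_def of_bool_def)
    from lborel_pair.Fubini'[OF this] show ?thesis by simp
  qed
  also have "\<dots> = (\<integral>\<^sup>+t\<in>{0<..}. (\<integral>\<^sup>+y. g y * indicator {y. t < u y} y \<partial>lborel) \<partial>lborel)"
  proof (rule nn_integral_cong)
    fix t :: real
    show "(\<integral>\<^sup>+y. g y * (indicator {0<..} t * indicator {y. t < u y} y) \<partial>lborel) = (\<integral>\<^sup>+y. g y * indicator {y. t < u y} y \<partial>lborel) * indicator {0<..} t"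
      by (cases "t > 0") simp_all
  qed
  finally show ?thesis .
qed

text \<open>The set with the largest integral of \<open>\<Theta>\<close> is a superlevel set, so only the distribution function
  matters; the height \<open>T\<close> balances \<open>|E|\<close> against \<open>R\<^sup>n T\<^bsup>-n\<^esup>\<close>.\<close>

lemma integral_rough_kernel_set:
  fixes \<Theta> :: "'a::euclidean_space \<Rightarrow> complex"
  assumes dim: "DIM('a) \<ge> 2" and [measurable]: "\<Theta> \<in> borel_measurable borel" and "A > 0"
    and dist: "\<And>R t. R > 0 \<Longrightarrow> t > 0 \<Longrightarrow>
      emeasure lborel {y\<in>cball 0 R. t < norm (\<Theta> y)} \<le> ennreal (A * R ^ DIM('a) * t powr - real DIM('a))"
    and [measurable]: "E \<in> sets borel" and E: "E \<subseteq> cball 0 R" and "R > 0"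
  shows "(\<integral>\<^sup>+y\<in>E. ennreal (norm (\<Theta> y)) \<partial>lborel) \<le>
    ennreal ((1 + A / (DIM('a) - 1)) * R * measure lborel E powr (1 - 1 / DIM('a)))"
proof -
  let ?n = "real DIM('a)"
  have n: "?n \<ge> 2" using dim by simp
  have Efin: "emeasure lborel E < \<infinity>"
    using emeasure_mono[OF E, of lborel] emeasure_lborel_cball_finite[of 0 R] le_less_trans by fastforce
  define m where "m = measure lborel E"
  have m: "emeasure lborel E = ennreal m" "m \<ge> 0" using Efin by (auto simp: m_def intro!: emeasure_eq_ennreal_measure)
  show ?thesis
  proof (cases "m = 0")
    case True
    then have "E \<in> null_sets lborel" using m by (simp add: null_sets_def)
    then have "(\<integral>\<^sup>+y\<in>E. ennreal (norm (\<Theta> y)) \<partial>lborel) = 0" by (simp add: nn_integral_null_set)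
    then show ?thesis by simp
  next
    case False
    then have "m > 0" using m by simp
    define T where "T = R * m powr (- 1 / ?n)"
    have "T > 0" using \<open>R > 0\<close> \<open>m > 0\<close> by (simp add: T_def)
    have "(\<integral>\<^sup>+y\<in>E. ennreal (norm (\<Theta> y)) \<partial>lborel) = (\<integral>\<^sup>+y. indicator E y * ennreal (norm (\<Theta> y)) \<partial>lborel)"
      by (simp add: mult.commute)
    also have "\<dots> = (\<integral>\<^sup>+t\<in>{0<..}. (\<integral>\<^sup>+y. indicator E y * indicator {y. t < norm (\<Theta> y)} y \<partial>lborel) \<partial>lborel)"
      by (rule nn_integral_layer_cake) auto
    also have "\<dots> \<le> (\<integral>\<^sup>+t. ennreal m * indicator {0<..T} t + ennreal (A * R ^ DIM('a)) * (ennreal (t powr (- (?n - 1) - 1)) * indicator {T..} t) \<partial>lborel)"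
    proof (rule nn_integral_mono)
      fix t :: real
      have eq: "(\<integral>\<^sup>+y. indicator E y * indicator {y. t < norm (\<Theta> y)} y \<partial>lborel) = emeasure lborel {y\<in>E. t < norm (\<Theta> y)}"
      proof -
        have "(\<integral>\<^sup>+y. indicator E y * indicator {y. t < norm (\<Theta> y)} y \<partial>lborel) = (\<integral>\<^sup>+y. indicator {y\<in>E. t < norm (\<Theta> y)} y \<partial>lborel)"
          by (intro nn_integral_cong) (auto simp: indicator_def)
        then show ?thesis by simp
      qed
      consider "t \<le> 0" | "0 < t" "t \<le> T" | "T < t" "0 < t" using \<open>T > 0\<close> by linarith
      then show "(\<integral>\<^sup>+y. indicator E y * indicator {y. t < norm (\<Theta> y)} y \<partial>lborel) * indicator {0<..} t \<le>
        ennreal m * indicator {0<..T} t + ennreal (A * R ^ DIM('a)) * (ennreal (t powr (- (?n - 1) - 1)) * indicator {T..} t)"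
      proof cases
        case 2
        have "emeasure lborel {y\<in>E. t < norm (\<Theta> y)} \<le> ennreal m" unfolding m(1)[symmetric] by (intro emeasure_mono) auto
        then show ?thesis using 2 by (simp add: eq add_increasing2)
      next
        case 3
        have "emeasure lborel {y\<in>E. t < norm (\<Theta> y)} \<le> emeasure lborel {y\<in>cball 0 R. t < norm (\<Theta> y)}"
          using E by (intro emeasure_mono) auto
        also have "\<dots> \<le> ennreal (A * R ^ DIM('a) * t powr - ?n)" using dist[OF \<open>R > 0\<close> 3(2)] .
        finally show ?thesis using 3 \<open>A > 0\<close> \<open>R > 0\<close> by (simp add: eq ennreal_mult)
      qed simp
    qed
    also have "\<dots> = ennreal m * ennreal T + ennreal (A * R ^ DIM('a)) * ennreal (T powr - (?n - 1) / (?n - 1))"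
    proof -
      have tail: "(\<integral>\<^sup>+t. ennreal (t powr (- (?n - 1) - 1)) * indicator {T..} t \<partial>lborel) = ennreal (T powr - (?n - 1) / (?n - 1))"
        using \<open>T > 0\<close> n by (intro nn_integral_powr_tail) auto
      show ?thesis
        unfolding tail[symmetric] using \<open>T > 0\<close> by (subst nn_integral_add) (simp_all add: nn_integral_cmult)
    qed
    also have "\<dots> = ennreal (m * T + A * R ^ DIM('a) * (T powr - (?n - 1) / (?n - 1)))"
      using \<open>T > 0\<close> \<open>m > 0\<close> \<open>A > 0\<close> \<open>R > 0\<close> n by (simp flip: ennreal_mult ennreal_plus)
    also have "m * T + A * R ^ DIM('a) * (T powr - (?n - 1) / (?n - 1)) = (1 + A / (DIM('a) - 1)) * R * m powr (1 - 1 / DIM('a))"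
    proof -
      have 1: "m * T = R * m powr (1 - 1 / ?n)"
        using \<open>m > 0\<close> powr_add[of m 1 "- 1 / ?n"] by (simp add: T_def)
      have "T powr - (?n - 1) = R powr (1 - ?n) * m powr ((- 1 / ?n) * (1 - ?n))"
        using \<open>R > 0\<close> \<open>m > 0\<close> by (simp add: T_def powr_mult powr_powr)
      moreover have "(- 1 / ?n) * (1 - ?n) = 1 - 1 / ?n" using n by (simp add: field_simps)
      moreover have "R ^ DIM('a) * R powr (1 - ?n) = R"
        using \<open>R > 0\<close> by (simp add: powr_diff powr_realpow)
      ultimately have 2: "R ^ DIM('a) * T powr - (?n - 1) = R * m powr (1 - 1 / ?n)"
        by (simp add: mult.assoc[symmetric])
      have "A * R ^ DIM('a) * (T powr - (?n - 1) / (?n - 1)) = A / (?n - 1) * (R ^ DIM('a) * T powr - (?n - 1))" by simp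
      then show ?thesis unfolding 1 2 using dim by (simp add: algebra_simps of_nat_diff)
    qed
    finally show ?thesis by (simp add: m_def)
  qed
qed

text \<open>Slicing \<open>f\<close> into its superlevel sets reduces the pairing with the kernel to integrals of the kernel
  over sets; this is the duality of \<open>L\<^bsup>n,\<infinity>\<^esup>\<close> and \<open>L\<^bsup>n',1\<^esup>\<close>.\<close>

lemma integral_rough_kernel_le_lorentz_integral:
  fixes \<Theta> :: "'a::euclidean_space \<Rightarrow> complex" and f :: "'a \<Rightarrow> 'b::real_normed_vector"
  assumes dim: "DIM('a) \<ge> 2" and [measurable]: "\<Theta> \<in> borel_measurable borel" and "K > 0"
    and ker: "\<And>E R. E \<in> sets borel \<Longrightarrow> E \<subseteq> cball 0 R \<Longrightarrow> R > 0 \<Longrightarrow>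
      (\<integral>\<^sup>+y\<in>E. ennreal (norm (\<Theta> y)) \<partial>lborel) \<le> ennreal (K * R * measure lborel E powr (1 - 1 / DIM('a)))"
    and cont: "continuous_on UNIV f" and "R > 0"
  shows "(\<integral>\<^sup>+y\<in>cball 0 R. ennreal (norm (\<Theta> y)) * ennreal (norm (f (x - y))) \<partial>lborel) \<le>
    ennreal (K * R) * lorentz_integral f (cube (x - R *\<^sub>R One) (2 * R))"
proof -
  let ?n = "real DIM('a)" and ?Q = "cube (x - R *\<^sub>R One) (2 * R)"
  have mu [measurable]: "(\<lambda>y. norm (f y)) \<in> borel_measurable borel"
    by (intro borel_measurable_continuous_onI continuous_intros cont)
  have mu' [measurable]: "(\<lambda>y. norm (f (x - y))) \<in> borel_measurable borel"
    by (intro borel_measurable_continuous_onI continuous_intros continuous_on_compose2[OF cont]) auto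
  have lev: "measure lborel {y\<in>cball 0 R. t < norm (f (x - y))} \<le> measure lborel {y\<in>?Q. t < norm (f y)}" for t
  proof -
    have "emeasure lborel {y\<in>cball 0 R. t < norm (f (x - y))} \<le> emeasure lborel {y\<in>?Q. t < norm (f y)}"
    proof -
      have "emeasure lborel {y\<in>?Q. t < norm (f y)} = (\<integral>\<^sup>+y. indicator {y\<in>?Q. t < norm (f y)} y \<partial>lborel)" by simp
      also have "\<dots> = ennreal (\<bar>-1\<bar> ^ DIM('a)) * (\<integral>\<^sup>+y. indicator {y\<in>?Q. t < norm (f y)} (x + (-1) *\<^sub>R y) \<partial>lborel)"
        by (rule nn_integral_dilation) auto
      also have "\<dots> \<ge> (\<integral>\<^sup>+y. indicator {y\<in>cball 0 R. t < norm (f (x - y))} y \<partial>lborel)"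
      proof -
        have "x - y \<in> ?Q" if "norm y \<le> R" for y
        proof -
          have "\<bar>y \<bullet> i\<bar> \<le> R" if "i \<in> Basis" for i using Basis_le_norm[OF that, of y] \<open>norm y \<le> R\<close> by linarith
          then show ?thesis by (force simp: mem_cube inner_diff_left abs_le_iff)
        qed
        moreover have one: "ennreal (\<bar>-1\<bar> ^ DIM('a)) = 1" by simp
        ultimately show ?thesis unfolding one mult_1 by (intro nn_integral_mono) (auto simp: indicator_def)
      qed
      finally show ?thesis by simp
    qed
    moreover have "emeasure lborel {y\<in>cball 0 R. t < norm (f (x - y))} < \<infinity>"
      using emeasure_mono[of "{y\<in>cball 0 R. t < norm (f (x - y))}" "cball 0 R" lborel] emeasure_lborel_cball_finite[of 0 R] le_less_trans by fastforce
    ultimately show ?thesis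
      using measure_level_set_cube(1)[OF mu, of "2 * R" "x - R *\<^sub>R One" t] \<open>R > 0\<close>
      by (simp add: emeasure_eq_ennreal_measure less_top)
  qed
  have "(\<integral>\<^sup>+y\<in>cball 0 R. ennreal (norm (\<Theta> y)) * ennreal (norm (f (x - y))) \<partial>lborel) =
    (\<integral>\<^sup>+y. (ennreal (norm (\<Theta> y)) * indicator (cball 0 R) y) * ennreal (norm (f (x - y))) \<partial>lborel)"
    by (simp add: mult_ac)
  also have "\<dots> = (\<integral>\<^sup>+t\<in>{0<..}. (\<integral>\<^sup>+y. (ennreal (norm (\<Theta> y)) * indicator (cball 0 R) y) * indicator {y. t < norm (f (x - y))} y \<partial>lborel) \<partial>lborel)"
    by (rule nn_integral_layer_cake) auto
  also have "\<dots> \<le> (\<integral>\<^sup>+t. ennreal (K * R) * (ennreal (measure lborel {y\<in>?Q. t < norm (f y)} powr (1 - 1 / ?n)) * indicator {0<..} t) \<partial>lborel)"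
  proof (rule nn_integral_mono)
    fix t :: real
    have "(\<integral>\<^sup>+y. (ennreal (norm (\<Theta> y)) * indicator (cball 0 R) y) * indicator {y. t < norm (f (x - y))} y \<partial>lborel)
      = (\<integral>\<^sup>+y\<in>{y\<in>cball 0 R. t < norm (f (x - y))}. ennreal (norm (\<Theta> y)) \<partial>lborel)"
      by (intro nn_integral_cong) (auto simp: indicator_def)
    also have "\<dots> \<le> ennreal (K * R * measure lborel {y\<in>cball 0 R. t < norm (f (x - y))} powr (1 - 1 / ?n))"
      using \<open>R > 0\<close> by (intro ker) auto
    also have "\<dots> \<le> ennreal (K * R * measure lborel {y\<in>?Q. t < norm (f y)} powr (1 - 1 / ?n))"
      using \<open>R > 0\<close> \<open>K > 0\<close> dim by (intro ennreal_leI mult_left_mono powr_mono2 lev) (auto simp: field_simps)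
    finally show "(\<integral>\<^sup>+y. (ennreal (norm (\<Theta> y)) * indicator (cball 0 R) y) * indicator {y. t < norm (f (x - y))} y \<partial>lborel) * indicator {0<..} t
      \<le> ennreal (K * R) * (ennreal (measure lborel {y\<in>?Q. t < norm (f y)} powr (1 - 1 / ?n)) * indicator {0<..} t)"
      using \<open>R > 0\<close> \<open>K > 0\<close> by (auto simp: indicator_def ennreal_mult)
  qed
  also have "\<dots> = ennreal (K * R) * lorentz_integral f ?Q"
  proof -
    have [measurable]: "(\<lambda>t. measure lborel {y\<in>?Q. t < norm (f y)}) \<in> borel_measurable borel"
      using \<open>R > 0\<close> by (intro measurable_measure_level_set_cube) auto
    show ?thesis unfolding lorentz_integral_def by (rule nn_integral_cmult) measurable
  qed
  finally show ?thesis .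
qed

section \<open>Rough maximal and spherical maximal functions\<close>

text \<open>Membership in \<open>L\<^bsup>n,\<infinity>\<^esup>\<close> enters only through the bound for integrals over sets, its dual form.\<close>

definition rough_kernel :: "('a::euclidean_space \<Rightarrow> complex) \<Rightarrow> real \<Rightarrow> bool" where
  "rough_kernel \<Theta> K \<longleftrightarrow> \<Theta> \<in> borel_measurable borel \<and> (\<forall>y. \<Theta> (sgn y) = \<Theta> y) \<and> K > 0 \<and>
    (\<forall>E R. E \<in> sets borel \<longrightarrow> E \<subseteq> cball 0 R \<longrightarrow> R > 0 \<longrightarrow>
      (\<integral>\<^sup>+y\<in>E. ennreal (norm (\<Theta> y)) \<partial>lborel) \<le> ennreal (K * R * measure lborel E powr (1 - 1 / DIM('a))))"

lemma rough_kernelD: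
  assumes "rough_kernel (\<Theta> :: 'a::euclidean_space \<Rightarrow> complex) K"
  shows "\<Theta> \<in> borel_measurable borel" "\<Theta> (sgn y) = \<Theta> y" "K > 0"
    "E \<in> sets borel \<Longrightarrow> E \<subseteq> cball 0 R \<Longrightarrow> R > 0 \<Longrightarrow>
      (\<integral>\<^sup>+y\<in>E. ennreal (norm (\<Theta> y)) \<partial>lborel) \<le> ennreal (K * R * measure lborel E powr (1 - 1 / DIM('a)))"
  using assms unfolding rough_kernel_def by blast+

lemma weak_Lp_sphere_rough_kernel:
  fixes \<Omega> :: "'a::euclidean_space \<Rightarrow> complex"
  assumes dim: "DIM('a) \<ge> 2" and hom: "homogeneous_degree_0 \<Omega>" and weak: "\<Omega> \<in> weak_Lp_sphere (real DIM('a))"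
  obtains \<Theta> K where "rough_kernel \<Theta> K" "AE y in sphere_measure. \<Omega> y = \<Theta> y" "AE y in lborel. \<Omega> y = \<Theta> y"
proof -
  have "\<Omega> \<in> borel_measurable sphere_measure" using weak by (simp add: weak_Lp_sphere_def)
  then obtain \<Theta> where T: "\<Theta> \<in> borel_measurable borel" "\<And>y. \<Theta> (sgn y) = \<Theta> y"
    "AE y in sphere_measure. \<Omega> y = \<Theta> y" "AE y in lborel. \<Omega> y = \<Theta> y"
    using weak_Lp_sphere_borel_version[OF _ hom] by blast
  obtain A :: real where "A > 0" and A: "\<And>R t. R > 0 \<Longrightarrow> t > 0 \<Longrightarrow>
    emeasure lborel {y\<in>cball 0 R. t < norm (\<Theta> y)} \<le> ennreal (A * R ^ DIM('a) * t powr - real DIM('a))"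
    using distribution_of_weak_Lp_sphere[OF weak T(1) T(2) T(3)] by blast
  have "rough_kernel \<Theta> (1 + A / (DIM('a) - 1))"
    unfolding rough_kernel_def using integral_rough_kernel_set[OF dim T(1) \<open>A > 0\<close> A] T(1,2) \<open>A > 0\<close> dim
    by (auto intro!: add_pos_nonneg)
  from that[OF this T(3,4)] show thesis .
qed

lemma rough_maximal_le_riesz_potential:
  fixes \<Omega> :: "'a::euclidean_space \<Rightarrow> complex"
  assumes dim: "DIM('a) \<ge> 2" and hom: "homogeneous_degree_0 \<Omega>" and weak: "\<Omega> \<in> weak_Lp_sphere (real DIM('a))"
  obtains C :: real where "C > 0" "\<And>f G x. upper_gradient f G \<Longrightarrow> continuous_on UNIV f \<Longrightarrow>
      bounded {x. f x \<noteq> 0} \<Longrightarrow> G \<in> borel_measurable borel \<Longrightarrow> rough_maximal \<Omega> f x \<le> ennreal C * riesz_potential G x"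
proof -
  let ?n = "real DIM('a)"
  obtain \<Theta> K where T: "rough_kernel \<Theta> K" and AE: "AE y in lborel. \<Omega> y = \<Theta> y"
    using weak_Lp_sphere_rough_kernel[OF dim hom weak] by blast
  note T = rough_kernelD[OF T]
  obtain C1 :: real where "C1 > 0" and C1:
    "\<And>(f :: 'a \<Rightarrow> complex) G a l x. upper_gradient f G \<Longrightarrow> continuous_on UNIV f \<Longrightarrow>
      bounded {x. f x \<noteq> 0} \<Longrightarrow> G \<in> borel_measurable borel \<Longrightarrow> l > 0 \<Longrightarrow> x \<in> cube a l \<Longrightarrow>
      lorentz_integral f (cube a l) \<le> ennreal (C1 * l powr (?n - 1)) * riesz_potential G x"
    using lorentz_integral_cube_le_riesz_potential[OF dim, where 'b=complex] by blast
  define C where "C = K * C1 * 2 powr (?n - 1)"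
  show thesis
  proof (rule that[of C])
    show "C > 0" using T(3) \<open>C1 > 0\<close> by (simp add: C_def)
    fix f :: "'a \<Rightarrow> complex" and G and x :: 'a
    assume f: "upper_gradient f G" "continuous_on UNIV f" "bounded {x. f x \<noteq> 0}" "G \<in> borel_measurable borel"
    show "rough_maximal \<Omega> f x \<le> ennreal C * riesz_potential G x"
      unfolding rough_maximal_def
    proof (rule SUP_least)
      fix t :: real assume "t \<in> {0<..}"
      then have "t > 0" by simp
      have "(\<integral>\<^sup>+y\<in>ball 0 t. ennreal (norm (\<Omega> y * f (x - y))) \<partial>lebesgue) = (\<integral>\<^sup>+y\<in>ball 0 t. ennreal (norm (\<Theta> y * f (x - y))) \<partial>lborel)"
        unfolding nn_integral_completion using AE by (intro nn_integral_cong_AE, eventually_elim) simp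
      also have "\<dots> \<le> (\<integral>\<^sup>+y\<in>cball 0 t. ennreal (norm (\<Theta> y)) * ennreal (norm (f (x - y))) \<partial>lborel)"
        by (intro nn_integral_mono) (auto simp: indicator_def norm_mult ennreal_mult)
      also have "\<dots> \<le> ennreal (K * t) * lorentz_integral f (cube (x - t *\<^sub>R One) (2 * t))"
        by (intro integral_rough_kernel_le_lorentz_integral dim T f \<open>t > 0\<close>)
      also have "\<dots> \<le> ennreal (K * t) * (ennreal (C1 * (2 * t) powr (?n - 1)) * riesz_potential G x)"
        using \<open>t > 0\<close> by (intro mult_left_mono C1 f) (auto simp: mem_cube inner_diff_left)
      also have "\<dots> = ennreal (t ^ DIM('a)) * (ennreal C * riesz_potential G x)"
      proof -
        have "K * t * (C1 * (2 * t) powr (?n - 1)) = t ^ DIM('a) * C"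
          using \<open>t > 0\<close> by (simp add: C_def powr_mult powr_diff powr_realpow)
        then show ?thesis
          using T(3) \<open>C1 > 0\<close> \<open>t > 0\<close> \<open>C > 0\<close> by (simp add: ennreal_mult_mult)
      qed
      finally show "(\<integral>\<^sup>+y\<in>ball 0 t. ennreal (norm (\<Omega> y * f (x - y))) \<partial>lebesgue) / ennreal (t ^ DIM('a)) \<le> ennreal C * riesz_potential G x"
        using \<open>t > 0\<close> by (intro divide_le_posI_ennreal) auto
    qed
  qed
qed

lemma nn_integral_reflect:
  fixes F :: "'a::euclidean_space \<Rightarrow> ennreal"
  assumes [measurable]: "F \<in> borel_measurable borel"
  shows "(\<integral>\<^sup>+z. F (x - z) \<partial>lborel) = (\<integral>\<^sup>+y. F y \<partial>lborel)"
proof -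
  have "(\<integral>\<^sup>+y. F y \<partial>lborel) = ennreal (\<bar>-1\<bar> ^ DIM('a)) * (\<integral>\<^sup>+z. F (x + (-1) *\<^sub>R z) \<partial>lborel)"
    by (rule nn_integral_dilation) auto
  then show ?thesis by simp
qed

lemma ennreal_norm_integral_le: "ennreal (norm (\<integral>x. f x \<partial>M)) \<le> (\<integral>\<^sup>+x. ennreal (norm (f x)) \<partial>M)"
  by (cases "integrable M f") (auto intro: integral_norm_bound_ennreal simp: not_integrable_integral_eq)

text \<open>As \<open>f\<close> vanishes far out on every ray, \<open>f (x - t y)\<close> is bounded by the integral of the gradient along
  the rest of the ray.\<close>

lemma spherical_maximal_le_riesz_potential:
  fixes f :: "'a::euclidean_space \<Rightarrow> complex"
  assumes f: "upper_gradient f G" "bounded {x. f x \<noteq> 0}" and [measurable]: "G \<in> borel_measurable borel"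
  shows "spherical_maximal f x \<le> riesz_potential G x"
  unfolding spherical_maximal_def
proof (rule SUP_least)
  fix t :: real assume "t \<in> {0<..}"
  then have "t > 0" by simp
  obtain \<rho> where \<rho>: "\<And>z. f z \<noteq> 0 \<Longrightarrow> norm z \<le> \<rho>" using f(2) by (auto simp: bounded_iff)
  have "ennreal (norm (\<integral>y. f (x - t *\<^sub>R y) \<partial>sphere_measure)) \<le> (\<integral>\<^sup>+y. ennreal (norm (f (x - t *\<^sub>R y))) \<partial>sphere_measure)"
    by (rule ennreal_norm_integral_le)
  also have "\<dots> \<le> (\<integral>\<^sup>+y. (\<integral>\<^sup>+s\<in>{0<..}. G (x - s *\<^sub>R y) \<partial>lborel) \<partial>sphere_measure)"
  proof (rule nn_integral_mono)
    fix y :: 'a assume "y \<in> space sphere_measure"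
    then have y: "norm y = 1" by simp
    define b where "b = max t (norm x + \<rho> + 1)"
    have "f (x - b *\<^sub>R y) = 0"
    proof (rule ccontr)
      assume "f (x - b *\<^sub>R y) \<noteq> 0"
      then have "norm (x - b *\<^sub>R y) \<le> \<rho>" by (rule \<rho>)
      moreover have "norm (b *\<^sub>R y) \<le> norm x + norm (x - b *\<^sub>R y)"
        using norm_triangle_ineq4[of x "x - b *\<^sub>R y"] by simp
      moreover have "norm (b *\<^sub>R y) = b" using y \<open>t > 0\<close> by (simp add: b_def)
      ultimately show False by (simp add: b_def)
    qed
    then have "ennreal (norm (f (x - t *\<^sub>R y))) \<le> (\<integral>\<^sup>+s\<in>{t<..<b}. G (x + s *\<^sub>R (-y)) * ennreal (norm (-y)) \<partial>lborel)"
      using upper_gradientD[OF f(1), of t b x "-y"] by (simp add: b_def)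
    also have "\<dots> \<le> (\<integral>\<^sup>+s\<in>{0<..}. G (x - s *\<^sub>R y) \<partial>lborel)"
      using y \<open>t > 0\<close> by (intro nn_integral_mono) (auto simp: indicator_def)
    finally show "ennreal (norm (f (x - t *\<^sub>R y))) \<le> (\<integral>\<^sup>+s\<in>{0<..}. G (x - s *\<^sub>R y) \<partial>lborel)" .
  qed
  also have "\<dots> = (\<integral>\<^sup>+z. G (x - z) * riesz_kernel z \<partial>lborel)"
    by (rule nn_integral_polar) measurable
  also have "\<dots> = riesz_potential G x"
    unfolding riesz_potential_def using nn_integral_reflect[of "\<lambda>y. G y * riesz_kernel (x - y)" x] by simp
  finally show "ennreal (norm (\<integral>y. f (x - t *\<^sub>R y) \<partial>sphere_measure)) \<le> riesz_potential G x" .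
qed

section \<open>Singular integrals with rough kernels\<close>

lemma rough_kernel_integrable_sphere:
  assumes T: "rough_kernel \<Theta> K"
  shows "(\<integral>\<^sup>+y. ennreal (norm (\<Theta> y)) \<partial>sphere_measure) < \<infinity>"
proof -
  note T = rough_kernelD[OF T]
  note [measurable] = T(1)
  have "(\<integral>\<^sup>+y. ennreal (norm (\<Theta> y)) \<partial>sphere_measure) = of_nat DIM('a) * (\<integral>\<^sup>+z\<in>cball 0 1 - {0}. ennreal (norm (\<Theta> (sgn z))) \<partial>lborel)"
    by (rule nn_integral_sphere_measure) measurable
  also have "\<dots> \<le> of_nat DIM('a) * ennreal (K * 1 * measure lborel (cball (0::'a) 1 - {0}) powr (1 - 1 / DIM('a)))"
    unfolding T(2) by (intro mult_left_mono T) auto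
  also have "\<dots> < \<infinity>" by (simp add: ennreal_mult_less_top of_nat_less_top)
  finally show ?thesis .
qed

lemma nn_integral_shell:
  fixes g :: "'a::euclidean_space \<Rightarrow> ennreal"
  assumes [measurable]: "g \<in> borel_measurable borel" and hom: "\<And>y. g (sgn y) = g y"
  shows "(\<integral>\<^sup>+y. g y * (indicator {a<..b} (norm y) * ennreal (1 / norm y ^ DIM('a))) \<partial>lborel) =
    (\<integral>\<^sup>+y. g y \<partial>sphere_measure) * (\<integral>\<^sup>+s\<in>{0<..}. indicator {a<..b} s * ennreal (1 / s) \<partial>lborel)"
proof -
  have "(\<integral>\<^sup>+z. g (sgn z) * (indicator {a<..b} (norm z) * ennreal (1 / norm z)) * riesz_kernel z \<partial>lborel) =
    (\<integral>\<^sup>+y. g y \<partial>sphere_measure) * (\<integral>\<^sup>+s\<in>{0<..}. indicator {a<..b} s * ennreal (1 / s) \<partial>lborel)"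
    by (rule nn_integral_polar_product) measurable
  moreover have "(\<integral>\<^sup>+y. g y * (indicator {a<..b} (norm y) * ennreal (1 / norm y ^ DIM('a))) \<partial>lborel) =
    (\<integral>\<^sup>+z. g (sgn z) * (indicator {a<..b} (norm z) * ennreal (1 / norm z)) * riesz_kernel z \<partial>lborel)"
  proof (rule nn_integral_cong)
    fix y :: 'a
    have "ennreal (1 / norm y) * riesz_kernel y = ennreal (1 / norm y ^ DIM('a))"
    proof (cases "y = 0")
      case False
      then have "1 / norm y * norm y powr (1 - real DIM('a)) = 1 / norm y ^ DIM('a)"
        by (simp add: powr_diff powr_realpow)
      then show ?thesis unfolding riesz_kernel_def by (simp flip: ennreal_mult)
    qed (simp add: riesz_kernel_def)
    then show "g y * (indicator {a<..b} (norm y) * ennreal (1 / norm y ^ DIM('a))) =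
      g (sgn y) * (indicator {a<..b} (norm y) * ennreal (1 / norm y)) * riesz_kernel y"
      by (simp add: hom mult.assoc)
  qed
  ultimately show ?thesis by simp
qed

lemma shell_factor_finite:
  assumes "0 < a"
  shows "(\<integral>\<^sup>+s\<in>{0<..}. indicator {a<..b} s * ennreal (1 / s) \<partial>lborel) < \<infinity>"
proof -
  have "(\<integral>\<^sup>+s\<in>{0<..}. indicator {a<..b} s * ennreal (1 / s) \<partial>lborel) \<le> (\<integral>\<^sup>+s. ennreal (1 / a) * indicator {a..b} s \<partial>lborel)"
    using assms by (intro nn_integral_mono) (auto simp: indicator_def frac_le intro!: ennreal_leI)
  also have "\<dots> < \<infinity>"
    by (subst nn_integral_cmult_indicator) (auto simp: ennreal_mult_less_top emeasure_lborel_Icc_eq)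
  finally show ?thesis .
qed

lemma integral_shell:
  fixes h :: "'a::euclidean_space \<Rightarrow> real"
  assumes [measurable]: "h \<in> borel_measurable borel" and hom: "\<And>y. h (sgn y) = h y"
    and int: "integrable sphere_measure h" and "0 < a"
  shows "integrable lborel (\<lambda>y. indicator {a<..b} (norm y) * (h y / norm y ^ DIM('a)))"
    and "(\<integral>y. indicator {a<..b} (norm y) * (h y / norm y ^ DIM('a)) \<partial>lborel) =
      (\<integral>y. h y \<partial>sphere_measure) * enn2real (\<integral>\<^sup>+s\<in>{0<..}. indicator {a<..b} s * ennreal (1 / s) \<partial>lborel)"
proof -
  let ?F = "\<lambda>h y. indicator {a<..b} (norm y) * (h y / norm y ^ DIM('a))"
  define L where "L = (\<integral>\<^sup>+s\<in>{0<..}. indicator {a<..b} s * ennreal (1 / s) \<partial>lborel)"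
  have L: "L < \<infinity>" unfolding L_def by (rule shell_factor_finite[OF \<open>0 < a\<close>])
  have eq: "(\<integral>\<^sup>+y. ennreal (?F h y) \<partial>lborel) = (\<integral>\<^sup>+y. ennreal (h y) \<partial>sphere_measure) * L"
    if [measurable]: "h \<in> borel_measurable borel" and hom: "\<And>y. h (sgn y) = h y" for h :: "'a \<Rightarrow> real"
  proof -
    have "(\<integral>\<^sup>+y. ennreal (?F h y) \<partial>lborel) = (\<integral>\<^sup>+y. ennreal (h y) * (indicator {a<..b} (norm y) * ennreal (1 / norm y ^ DIM('a))) \<partial>lborel)"
    proof (rule nn_integral_cong)
      fix y :: 'a
      have "ennreal (h y / norm y ^ DIM('a)) = ennreal (h y) * ennreal (1 / norm y ^ DIM('a))"
        by (simp flip: ennreal_mult'')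
      then show "ennreal (?F h y) = ennreal (h y) * (indicator {a<..b} (norm y) * ennreal (1 / norm y ^ DIM('a)))"
        by (simp add: indicator_def)
    qed
    also have "\<dots> = (\<integral>\<^sup>+y. ennreal (h y) \<partial>sphere_measure) * L"
      unfolding L_def by (rule nn_integral_shell) (use hom in auto)
    finally show ?thesis .
  qed
  show 1: "integrable lborel (?F h)"
  proof (rule integrableI_bounded)
    have "(\<integral>\<^sup>+y. ennreal (norm (?F h y)) \<partial>lborel) = (\<integral>\<^sup>+y. ennreal (?F (\<lambda>y. \<bar>h y\<bar>) y) \<partial>lborel)"
      by (intro nn_integral_cong) (simp add: abs_mult)
    also have "\<dots> = (\<integral>\<^sup>+y. ennreal \<bar>h y\<bar> \<partial>sphere_measure) * L" by (rule eq) (auto simp: hom)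
    also have "\<dots> < \<infinity>" using L int by (simp add: ennreal_mult_less_top integrable_iff_bounded)
    finally show "(\<integral>\<^sup>+y. ennreal (norm (?F h y)) \<partial>lborel) < \<infinity>" .
  qed measurable
  have "(\<integral>y. ?F h y \<partial>lborel) = enn2real (\<integral>\<^sup>+y. ennreal (?F h y) \<partial>lborel) - enn2real (\<integral>\<^sup>+y. ennreal (- ?F h y) \<partial>lborel)"
    by (rule real_lebesgue_integral_def[OF 1])
  also have "(\<integral>\<^sup>+y. ennreal (- ?F h y) \<partial>lborel) = (\<integral>\<^sup>+y. ennreal (?F (\<lambda>y. - h y) y) \<partial>lborel)" by simp
  also have "\<dots> = (\<integral>\<^sup>+y. ennreal (- h y) \<partial>sphere_measure) * L" by (rule eq) (auto simp: hom)
  also have "(\<integral>\<^sup>+y. ennreal (?F h y) \<partial>lborel) = (\<integral>\<^sup>+y. ennreal (h y) \<partial>sphere_measure) * L" by (rule eq) (auto simp: hom)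
  finally have "(\<integral>y. ?F h y \<partial>lborel) = (enn2real (\<integral>\<^sup>+y. ennreal (h y) \<partial>sphere_measure) - enn2real (\<integral>\<^sup>+y. ennreal (- h y) \<partial>sphere_measure)) * enn2real L"
    by (simp add: enn2real_mult left_diff_distrib)
  also have "enn2real (\<integral>\<^sup>+y. ennreal (h y) \<partial>sphere_measure) - enn2real (\<integral>\<^sup>+y. ennreal (- h y) \<partial>sphere_measure) = (\<integral>y. h y \<partial>sphere_measure)"
    by (rule real_lebesgue_integral_def[OF int, symmetric])
  finally show "(\<integral>y. ?F h y \<partial>lborel) = (\<integral>y. h y \<partial>sphere_measure) * enn2real (\<integral>\<^sup>+s\<in>{0<..}. indicator {a<..b} s * ennreal (1 / s) \<partial>lborel)"
    by (simp add: L_def)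
qed

text \<open>In polar coordinates the integral over a shell is the integral over the sphere times a finite factor
  that depends only on the radii.\<close>

lemma rough_kernel_shell:
  fixes \<Theta> :: "'a::euclidean_space \<Rightarrow> complex"
  assumes T: "rough_kernel \<Theta> K" and "0 < a"
  shows "integrable lborel (\<lambda>y. indicator {a<..b} (norm y) *\<^sub>R (\<Theta> y / of_real (norm y ^ DIM('a))))"
    and "(\<integral>y. \<Theta> y \<partial>sphere_measure) = 0 \<Longrightarrow>
      (\<integral>y. indicator {a<..b} (norm y) *\<^sub>R (\<Theta> y / of_real (norm y ^ DIM('a))) \<partial>lborel) = 0"
proof -
  note T' = rough_kernelD[OF T]
  note [measurable] = T'(1)
  let ?F = "\<lambda>y. indicator {a<..b} (norm y) *\<^sub>R (\<Theta> y / of_real (norm y ^ DIM('a)))"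
  have int: "integrable sphere_measure \<Theta>"
    using rough_kernel_integrable_sphere[OF T] borel_measurable_sphere_measure[OF T'(1)] by (simp add: integrable_iff_bounded)
  have ReF: "Re (?F y) = indicator {a<..b} (norm y) * (Re (\<Theta> y) / norm y ^ DIM('a))" for y
    by (simp del: of_real_power)
  have ImF: "Im (?F y) = indicator {a<..b} (norm y) * (Im (\<Theta> y) / norm y ^ DIM('a))" for y
    by (simp del: of_real_power)
  have intR: "integrable sphere_measure (\<lambda>y. Re (\<Theta> y))" "integrable sphere_measure (\<lambda>y. Im (\<Theta> y))"
    using int by (auto intro: integrable_bounded_linear[OF bounded_linear_Re] integrable_bounded_linear[OF bounded_linear_Im])
  have R: "integrable lborel (\<lambda>y. Re (?F y))" "(\<integral>y. Re (?F y) \<partial>lborel) = (\<integral>y. Re (\<Theta> y) \<partial>sphere_measure) * enn2real (\<integral>\<^sup>+s\<in>{0<..}. indicator {a<..b} s * ennreal (1 / s) \<partial>lborel)"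
    unfolding ReF by (rule integral_shell; use T'(2) intR \<open>0 < a\<close> in simp)+
  have I: "integrable lborel (\<lambda>y. Im (?F y))" "(\<integral>y. Im (?F y) \<partial>lborel) = (\<integral>y. Im (\<Theta> y) \<partial>sphere_measure) * enn2real (\<integral>\<^sup>+s\<in>{0<..}. indicator {a<..b} s * ennreal (1 / s) \<partial>lborel)"
    unfolding ImF by (rule integral_shell; use T'(2) intR \<open>0 < a\<close> in simp)+
  show 1: "integrable lborel ?F"
  proof -
    have "integrable lborel (\<lambda>y. of_real (Re (?F y)) + \<i> * of_real (Im (?F y)))"
      using R(1) I(1) by (intro Bochner_Integration.integrable_add integrable_mult_right integrable_of_real)
    then show ?thesis by (simp only: complex_eq[symmetric])
  qed
  assume z: "(\<integral>y. \<Theta> y \<partial>sphere_measure) = 0"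
  have "Re (\<integral>y. ?F y \<partial>lborel) = 0"
    using R(2) integral_bounded_linear[OF bounded_linear_Re 1] integral_bounded_linear[OF bounded_linear_Re int] z by simp
  moreover have "Im (\<integral>y. ?F y \<partial>lborel) = 0"
    using I(2) integral_bounded_linear[OF bounded_linear_Im 1] integral_bounded_linear[OF bounded_linear_Im int] z by simp
  ultimately show "(\<integral>y. ?F y \<partial>lborel) = 0" by (simp add: complex_eq_iff)
qed

lemma sum_geometric_powr_le:
  fixes b s :: real
  assumes "s \<ge> 1" "b > 0"
  shows "(\<Sum>i<N. (b * 2 ^ i) powr - s) \<le> 2 * b powr - s"
  using \<open>b > 0\<close>
proof (induction N arbitrary: b)
  case (Suc N)
  have "2 powr - s \<le> (1 / 2 :: real)"
    using \<open>s \<ge> 1\<close> powr_mono[of "- s" "- 1" "2::real"] by (simp add: powr_minus)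
  from mult_right_mono[OF this, of "b powr - s"]
  have half: "(2 * b) powr - s \<le> b powr - s / 2"
    using Suc.prems by (simp add: powr_mult)
  have "(\<Sum>i<Suc N. (b * 2 ^ i) powr - s) = b powr - s + (\<Sum>i<N. (2 * b * 2 ^ i) powr - s)"
    by (simp only: sum.lessThan_Suc_shift) (simp add: mult_ac)
  also have "\<dots> \<le> b powr - s + 2 * (2 * b) powr - s" using Suc.IH[of "2 * b"] Suc.prems by simp
  also have "\<dots> \<le> 2 * b powr - s" using half by simp
  finally show ?case .
qed simp

text \<open>The first summand that is not cut off has base at least \<open>r\<close>; later ones decay geometrically.\<close>

lemma sum_geometric_powr_above_le:
  fixes b r s :: real
  assumes "s \<ge> 1" "b > 0" "r > 0"
  shows "(\<Sum>i<N. if r \<le> b * 2 ^ i then (b * 2 ^ i) powr - s else 0) \<le> 2 * r powr - s"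
  using \<open>b > 0\<close>
proof (induction N arbitrary: b)
  case (Suc N)
  show ?case
  proof (cases "r \<le> b")
    case True
    have "(\<Sum>i<Suc N. if r \<le> b * 2 ^ i then (b * 2 ^ i) powr - s else 0) \<le> (\<Sum>i<Suc N. (b * 2 ^ i) powr - s)"
      by (intro sum_mono) auto
    also have "\<dots> \<le> 2 * b powr - s" by (rule sum_geometric_powr_le) (use assms Suc.prems in auto)
    also have "\<dots> \<le> 2 * r powr - s" using True assms by (simp add: powr_mono2')
    finally show ?thesis .
  next
    case False
    have shift: "b * 2 ^ Suc i = 2 * b * 2 ^ i" for i by simp
    have "(\<Sum>i<Suc N. if r \<le> b * 2 ^ i then (b * 2 ^ i) powr - s else 0) =
      (\<Sum>i<N. if r \<le> 2 * b * 2 ^ i then (2 * b * 2 ^ i) powr - s else 0)"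
      using False by (simp only: sum.lessThan_Suc_shift shift) simp
    also have "\<dots> \<le> 2 * r powr - s" using Suc.prems by (intro Suc.IH) simp
    finally show ?thesis .
  qed
qed (use assms in simp)

lemma bounded_range_of_bounded_support:
  fixes f :: "'a::euclidean_space \<Rightarrow> 'b::real_normed_vector"
  assumes "continuous_on UNIV f" "bounded {x. f x \<noteq> 0}"
  obtains B where "B \<ge> 0" "\<And>z. norm (f z) \<le> B"
proof -
  obtain \<rho> where \<rho>: "\<And>z. f z \<noteq> 0 \<Longrightarrow> norm z \<le> \<rho>" using assms(2) by (auto simp: bounded_iff)
  have "bounded (f ` cball 0 \<rho>)"
    by (intro compact_imp_bounded compact_continuous_image continuous_on_subset[OF assms(1)]) auto
  then obtain B where B: "\<And>z. z \<in> cball 0 \<rho> \<Longrightarrow> norm (f z) \<le> B" unfolding bounded_iff by blast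
  have "norm (f z) \<le> max 0 B" for z
  proof (cases "f z = 0")
    case False
    then have "z \<in> cball 0 \<rho>" using \<rho> by simp
    then show ?thesis using B[of z] by simp
  qed simp
  then show thesis by (intro that[of "max 0 B"]) auto
qed

lemma integrable_shell_mult:
  fixes \<Theta> :: "'a::euclidean_space \<Rightarrow> complex"
  assumes T: "rough_kernel \<Theta> K" and "0 < a" and g: "continuous_on UNIV g" "\<And>z. norm (g z) \<le> B"
  shows "integrable lborel (\<lambda>y. indicator {a<..b} (norm y) *\<^sub>R (\<Theta> y / of_real (norm y ^ DIM('a)) * g y))"
proof (rule Bochner_Integration.integrable_bound)
  note [measurable] = rough_kernelD(1)[OF T] borel_measurable_continuous_onI[OF g(1)]
  show "integrable lborel (\<lambda>y. norm (indicator {a<..b} (norm y) *\<^sub>R (\<Theta> y / of_real (norm y ^ DIM('a)))) * B)"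
    by (intro integrable_mult_left integrable_norm rough_kernel_shell(1)[OF T \<open>0 < a\<close>])
  show "(\<lambda>y. indicator {a<..b} (norm y) *\<^sub>R (\<Theta> y / of_real (norm y ^ DIM('a)) * g y)) \<in> borel_measurable lborel"
    by measurable
  have "B \<ge> 0" by (rule order_trans[OF norm_ge_zero g(2)])
  then show "AE y in lborel. norm (indicator {a<..b} (norm y) *\<^sub>R (\<Theta> y / of_real (norm y ^ DIM('a)) * g y)) \<le>
    norm (norm (indicator {a<..b} (norm y) *\<^sub>R (\<Theta> y / of_real (norm y ^ DIM('a)))) * B)"
    using g(2) by (auto intro!: AE_I2 divide_right_mono mult_left_mono simp: norm_mult norm_divide abs_mult mult.assoc[symmetric] simp del: of_real_power)
qed

text \<open>The truncated singular integral of a Borel kernel, with Borel measurable instead of Lebesgue measurable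
  integrand.\<close>

definition truncated_transform :: "('a::euclidean_space \<Rightarrow> complex) \<Rightarrow> real \<Rightarrow> ('a \<Rightarrow> complex) \<Rightarrow> 'a \<Rightarrow> complex" where
  "truncated_transform \<Theta> t f x = (\<integral>y. indicator {t<..} (norm y) *\<^sub>R (\<Theta> y / of_real (norm y ^ DIM('a)) * f (x - y)) \<partial>lborel)"

lemma truncated_integral_eq_truncated_transform:
  fixes \<Omega> \<Theta> :: "'a::euclidean_space \<Rightarrow> complex"
  assumes [measurable]: "\<Theta> \<in> borel_measurable borel" and AE: "AE y in lborel. \<Omega> y = \<Theta> y" and cont: "continuous_on UNIV f"
  shows "truncated_integral \<Omega> t f x = truncated_transform \<Theta> t f x"
proof -
  let ?F = "\<lambda>\<Omega> y. indicator {t<..} (norm y) *\<^sub>R (\<Omega> y / of_real (norm y ^ DIM('a)) * f (x - y))"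
  have [measurable]: "(\<lambda>y. f (x - y)) \<in> borel_measurable borel"
    by (intro borel_measurable_continuous_onI continuous_intros continuous_on_compose2[OF cont]) auto
  have mT: "?F \<Theta> \<in> borel_measurable lborel" by measurable
  have eq: "AE y in lebesgue. ?F \<Theta> y = ?F \<Omega> y"
    using AE by (intro AE_completion, eventually_elim) simp
  have mO: "?F \<Omega> \<in> borel_measurable lebesgue"
    by (rule borel_measurable_AE[OF measurable_completion[OF mT] eq])
  have "truncated_integral \<Omega> t f x = (\<integral>y. ?F \<Omega> y \<partial>lebesgue)"
    by (simp add: truncated_integral_def set_lebesgue_integral_def indicator_def)
  also have "\<dots> = (\<integral>y. ?F \<Theta> y \<partial>lebesgue)"
    using eq by (intro integral_cong_AE mO measurable_completion mT) auto
  also have "\<dots> = (\<integral>y. ?F \<Theta> y \<partial>lborel)" by (rule integral_completion[OF mT])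
  finally show ?thesis by (simp add: truncated_transform_def)
qed

lemma truncated_transform_eq_shell:
  fixes \<Theta> :: "'a::euclidean_space \<Rightarrow> complex"
  assumes "\<And>y. b < norm y \<Longrightarrow> f (x - y) = 0"
  shows "truncated_transform \<Theta> t f x = (\<integral>y. indicator {t<..b} (norm y) *\<^sub>R (\<Theta> y / of_real (norm y ^ DIM('a)) * f (x - y)) \<partial>lborel)"
  unfolding truncated_transform_def using assms
  by (intro Bochner_Integration.integral_cong) (auto simp: indicator_def not_le)

lemma shell_integral_subtract_const:
  fixes \<Theta> :: "'a::euclidean_space \<Rightarrow> complex"
  assumes T: "rough_kernel \<Theta> K" and mean: "(\<integral>y. \<Theta> y \<partial>sphere_measure) = 0" and "0 < a"
    and g: "continuous_on UNIV g" "\<And>z. norm (g z) \<le> B"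
  shows "(\<integral>y. indicator {a<..b} (norm y) *\<^sub>R (\<Theta> y / of_real (norm y ^ DIM('a)) * g y) \<partial>lborel) =
    (\<integral>y. indicator {a<..b} (norm y) *\<^sub>R (\<Theta> y / of_real (norm y ^ DIM('a)) * (g y - c)) \<partial>lborel)"
proof -
  let ?k = "\<lambda>y. indicator {a<..b} (norm y) *\<^sub>R (\<Theta> y / of_real (norm y ^ DIM('a)))"
  have "(\<integral>y. indicator {a<..b} (norm y) *\<^sub>R (\<Theta> y / of_real (norm y ^ DIM('a)) * (g y - c)) \<partial>lborel) =
    (\<integral>y. indicator {a<..b} (norm y) *\<^sub>R (\<Theta> y / of_real (norm y ^ DIM('a)) * g y) - ?k y * c \<partial>lborel)"
  proof -
    have "s *\<^sub>R (k * (z - c)) = s *\<^sub>R (k * z) - s *\<^sub>R k * c" for s :: real and k z :: complex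
      by (simp add: right_diff_distrib scaleR_diff_right)
    then show ?thesis by (simp only:)
  qed
  also have "\<dots> = (\<integral>y. indicator {a<..b} (norm y) *\<^sub>R (\<Theta> y / of_real (norm y ^ DIM('a)) * g y) \<partial>lborel) - (\<integral>y. ?k y * c \<partial>lborel)"
    by (intro Bochner_Integration.integral_diff integrable_shell_mult[OF T \<open>0 < a\<close> g] integrable_mult_left rough_kernel_shell(1)[OF T \<open>0 < a\<close>])
  also have "(\<integral>y. ?k y * c \<partial>lborel) = (\<integral>y. ?k y \<partial>lborel) * c"
    by (rule Bochner_Integration.integral_mult_left) (rule rough_kernel_shell(1)[OF T \<open>0 < a\<close>])
  also have "(\<integral>y. ?k y \<partial>lborel) = 0" by (rule rough_kernel_shell(2)[OF T \<open>0 < a\<close> mean])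
  finally show ?thesis by simp
qed

text \<open>On each dyadic shell the mean value zero of the kernel allows subtracting the constant of the
  Poincare inequality on a cube around the shell, and the contributions of the shells add up to the
  Riesz potential because the sum of \<open>R\<^bsup>1-n\<^esup>\<close> over the dyadic multiples \<open>R \<ge> |y|\<close> of \<open>t\<close>
  is at most a constant times \<open>|y|\<^bsup>1-n\<^esup>\<close>.\<close>

lemma truncated_transform_le_riesz_potential:
  fixes \<Theta> :: "'a::euclidean_space \<Rightarrow> complex"
  assumes dim: "DIM('a) \<ge> 2" and T: "rough_kernel \<Theta> K" and mean: "(\<integral>y. \<Theta> y \<partial>sphere_measure) = 0"
  obtains C :: real where "C > 0" "\<And>f G x t. upper_gradient f G \<Longrightarrow> continuous_on UNIV f \<Longrightarrow>
      bounded {x. f x \<noteq> 0} \<Longrightarrow> G \<in> borel_measurable borel \<Longrightarrow> t > 0 \<Longrightarrow>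
      ennreal (norm (truncated_transform \<Theta> t f x)) \<le> ennreal C * riesz_potential G x"
proof -
  let ?n = "real DIM('a)"
  note T' = rough_kernelD[OF T]
  note [measurable] = T'(1)
  obtain C1 :: real where "C1 > 0" and C1:
    "\<And>(f :: 'a \<Rightarrow> complex) G a l. upper_gradient f G \<Longrightarrow> continuous_on UNIV f \<Longrightarrow> G \<in> borel_measurable borel \<Longrightarrow> l > 0 \<Longrightarrow>
      \<exists>c. (\<integral>\<^sup>+x\<in>cube a l. ennreal (norm (f x - c)) \<partial>lborel) \<le> ennreal (C1 * l) * (\<integral>\<^sup>+y\<in>cube a l. G y \<partial>lborel) \<and>
        (\<integral>\<^sup>+t\<in>{0<..}. ennreal (measure lborel {x\<in>cube a l. t < norm (f x - c)} powr (1 - 1 / DIM('a))) \<partial>lborel)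
          \<le> ennreal C1 * (\<integral>\<^sup>+y\<in>cube a l. G y \<partial>lborel)"
    using lorentz_poincare[where 'b=complex] by blast
  define C2 where "C2 = K * C1 * 2 ^ DIM('a)"
  define C where "C = C2 * (2 * (2 * ?n) powr (?n - 1))"
  have "C2 > 0" using T'(3) \<open>C1 > 0\<close> by (simp add: C2_def)
  show thesis
  proof (rule that[of C])
    show "C > 0" using \<open>C2 > 0\<close> by (simp add: C_def)
    fix f :: "'a \<Rightarrow> complex" and G and x :: 'a and t :: real
    assume f: "upper_gradient f G" and cont: "continuous_on UNIV f" and bd: "bounded {x. f x \<noteq> 0}"
      and [measurable]: "G \<in> borel_measurable borel" and "t > 0"
    have cont': "continuous_on UNIV (\<lambda>y. f (x - y))"
      by (intro continuous_intros continuous_on_compose2[OF cont]) auto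
    obtain B where B: "\<And>z. norm (f z) \<le> B" using bounded_range_of_bounded_support[OF cont bd] by blast
    obtain \<rho> where \<rho>: "\<And>z. f z \<noteq> 0 \<Longrightarrow> norm z \<le> \<rho>" using bd by (auto simp: bounded_iff)
    obtain N :: nat where N: "(norm x + \<rho>) / t < 2 ^ N" using real_arch_pow[of 2] by auto
    let ?k = "\<lambda>y. \<Theta> y / of_real (norm y ^ DIM('a))"
    define r where "r = (\<lambda>i. t * 2 ^ i)"
    have r: "r i > 0" "r (Suc i) = 2 * r i" for i using \<open>t > 0\<close> by (auto simp: r_def)
    define J where "J = (\<lambda>i. \<integral>y. indicator {r i<..r (Suc i)} (norm y) *\<^sub>R (?k y * f (x - y)) \<partial>lborel)"
    have zero: "f (x - y) = 0" if "r N < norm y" for y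
    proof (rule ccontr)
      assume "f (x - y) \<noteq> 0"
      then have "norm (x - y) \<le> \<rho>" by (rule \<rho>)
      moreover have "norm y \<le> norm x + norm (x - y)" using norm_triangle_ineq4[of x "x - y"] by simp
      ultimately show False using N that \<open>t > 0\<close> by (simp add: r_def field_simps)
    qed
    have shells: "indicator {t<..r M} s = (\<Sum>i<M. indicator {r i<..r (Suc i)} s :: real)" for M s
    proof (induction M)
      case (Suc M)
      have "t * 1 \<le> t * 2 ^ M" using \<open>t > 0\<close> by (intro mult_left_mono) auto
      then have "t \<le> r M" "r M \<le> r (Suc M)" using r(1)[of M] by (auto simp: r_def)
      then have "indicator {t<..r (Suc M)} s = (indicator {t<..r M} s + indicator {r M<..r (Suc M)} s :: real)"
        by (auto simp: indicator_def)
      then show ?case using Suc by simp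
    qed (simp add: r_def)
    have "truncated_transform \<Theta> t f x = (\<integral>y. indicator {t<..r N} (norm y) *\<^sub>R (?k y * f (x - y)) \<partial>lborel)"
      by (rule truncated_transform_eq_shell) (rule zero)
    also have "\<dots> = (\<integral>y. (\<Sum>i<N. indicator {r i<..r (Suc i)} (norm y) *\<^sub>R (?k y * f (x - y))) \<partial>lborel)"
      unfolding shells scaleR_sum_left ..
    also have "\<dots> = (\<Sum>i<N. J i)"
      unfolding J_def by (intro Bochner_Integration.integral_sum integrable_shell_mult[OF T r(1) cont' B])
    finally have tr: "truncated_transform \<Theta> t f x = (\<Sum>i<N. J i)" .
    define q where "q = (\<lambda>i. cube (x - r (Suc i) *\<^sub>R One) (2 * r (Suc i)) :: 'a set)"
    have qm [measurable]: "q i \<in> sets borel" for i by (simp add: q_def)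
    have xq: "x \<in> q i" for i using r[of i] by (simp add: q_def mem_cube inner_diff_left)
    have Jle: "ennreal (norm (J i)) \<le> ennreal (C2 * r (Suc i) powr - (?n - 1)) * (\<integral>\<^sup>+y\<in>q i. G y \<partial>lborel)" for i
    proof -
      let ?R = "r (Suc i)"
      have "2 * ?R > 0" using r by simp
      from C1[OF f cont \<open>G \<in> borel_measurable borel\<close> this]
      obtain c where c: "(\<integral>\<^sup>+t\<in>{0<..}. ennreal (measure lborel {z\<in>q i. t < norm (f z - c)} powr (1 - 1 / DIM('a))) \<partial>lborel)
          \<le> ennreal C1 * (\<integral>\<^sup>+y\<in>q i. G y \<partial>lborel)" unfolding q_def by blast
      have "J i = (\<integral>y. indicator {r i<..?R} (norm y) *\<^sub>R (?k y * (f (x - y) - c)) \<partial>lborel)"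
        unfolding J_def by (rule shell_integral_subtract_const[OF T mean r(1) cont' B])
      also have "ennreal (norm \<dots>) \<le> (\<integral>\<^sup>+y. ennreal (norm (indicator {r i<..?R} (norm y) *\<^sub>R (?k y * (f (x - y) - c)))) \<partial>lborel)"
        by (rule ennreal_norm_integral_le)
      also have "\<dots> \<le> (\<integral>\<^sup>+y. ennreal (1 / r i ^ DIM('a)) * (ennreal (norm (\<Theta> y)) * ennreal (norm (f (x - y) - c)) * indicator (cball 0 ?R) y) \<partial>lborel)"
      proof (rule nn_integral_mono)
        fix y :: 'a
        show "ennreal (norm (indicator {r i<..?R} (norm y) *\<^sub>R (?k y * (f (x - y) - c)))) \<le>
          ennreal (1 / r i ^ DIM('a)) * (ennreal (norm (\<Theta> y)) * ennreal (norm (f (x - y) - c)) * indicator (cball 0 ?R) y)"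
        proof (cases "r i < norm y \<and> norm y \<le> ?R")
          case True
          have "norm (?k y * (f (x - y) - c)) = (1 / norm y ^ DIM('a)) * (norm (\<Theta> y) * norm (f (x - y) - c))"
            by (simp add: norm_mult norm_divide del: of_real_power)
          also have "\<dots> \<le> (1 / r i ^ DIM('a)) * (norm (\<Theta> y) * norm (f (x - y) - c))"
            using True r(1)[of i] by (intro mult_right_mono divide_left_mono power_mono mult_pos_pos zero_less_power) auto
          finally show ?thesis using True r(1)[of i] by (simp add: ennreal_leI del: of_real_power flip: ennreal_mult)
        qed (auto simp: indicator_def)
      qed
      also have "\<dots> = ennreal (1 / r i ^ DIM('a)) * (\<integral>\<^sup>+y\<in>cball 0 ?R. ennreal (norm (\<Theta> y)) * ennreal (norm (f (x - y) - c)) \<partial>lborel)"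
      proof -
        have [measurable]: "(\<lambda>y. norm (f (x - y) - c)) \<in> borel_measurable borel"
          by (intro borel_measurable_continuous_onI continuous_intros cont')
        show ?thesis by (rule nn_integral_cmult) measurable
      qed
      also have "\<dots> \<le> ennreal (1 / r i ^ DIM('a)) * (ennreal (K * ?R) * lorentz_integral (\<lambda>z. f z - c) (q i))"
        unfolding q_def
        by (intro mult_left_mono integral_rough_kernel_le_lorentz_integral dim T' continuous_intros cont r(1)) auto
      also have "\<dots> \<le> ennreal (1 / r i ^ DIM('a)) * (ennreal (K * ?R) * (ennreal C1 * (\<integral>\<^sup>+y\<in>q i. G y \<partial>lborel)))"
        unfolding lorentz_integral_def by (intro mult_left_mono c) auto
      also have "\<dots> = ennreal (C2 * ?R powr - (?n - 1)) * (\<integral>\<^sup>+y\<in>q i. G y \<partial>lborel)"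
      proof -
        have "1 / r i ^ DIM('a) * (K * ?R) * C1 = C2 * ?R powr - (?n - 1)"
          using r(1)[of i] by (simp add: r(2) C2_def powr_diff powr_realpow power_mult_distrib)
        moreover have "ennreal (1 / r i ^ DIM('a)) * (ennreal (K * ?R) * (ennreal C1 * (\<integral>\<^sup>+y\<in>q i. G y \<partial>lborel)))
          = ennreal (1 / r i ^ DIM('a) * (K * ?R) * C1) * (\<integral>\<^sup>+y\<in>q i. G y \<partial>lborel)"
          using r(1)[of i] r(1)[of "Suc i"] T'(3) \<open>C1 > 0\<close>
          by (subst ennreal_mult_mult, simp, simp, subst ennreal_mult_mult, simp_all)
        ultimately show ?thesis by simp
      qed
      finally show ?thesis .
    qed
    have "ennreal (norm (truncated_transform \<Theta> t f x)) \<le> (\<Sum>i<N. ennreal (norm (J i)))"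
      unfolding tr by (subst sum_ennreal) (auto intro!: ennreal_leI norm_sum)
    also have "\<dots> \<le> (\<Sum>i<N. ennreal (C2 * r (Suc i) powr - (?n - 1)) * (\<integral>\<^sup>+y\<in>q i. G y \<partial>lborel))"
      by (intro sum_mono Jle)
    also have "\<dots> = (\<integral>\<^sup>+y. (\<Sum>i<N. ennreal (C2 * r (Suc i) powr - (?n - 1)) * (G y * indicator (q i) y)) \<partial>lborel)"
      by (simp add: nn_integral_sum nn_integral_cmult)
    also have "\<dots> \<le> (\<integral>\<^sup>+y. ennreal C * (G y * riesz_kernel (x - y)) \<partial>lborel)"
    proof (rule nn_integral_mono_AE)
      show "AE y in lborel. (\<Sum>i<N. ennreal (C2 * r (Suc i) powr - (?n - 1)) * (G y * indicator (q i) y)) \<le> ennreal C * (G y * riesz_kernel (x - y))"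
        using AE_lborel_singleton[of x]
      proof eventually_elim
        case (elim y)
        define s where "s = norm (x - y) / (2 * ?n)"
        have "s > 0" using elim dim by (simp add: s_def)
        have le: "s \<le> (2 * t) * 2 ^ i" if "y \<in> q i" for i
        proof -
          have "norm (x - y) \<le> ?n * (2 * r (Suc i))" using norm_diff_cube_le that xq unfolding q_def by blast
          then have "s \<le> r (Suc i)" using dim by (simp add: s_def field_simps)
          then show ?thesis by (simp add: r_def mult_ac)
        qed
        have fac: "(\<Sum>i<N. ennreal (C2 * r (Suc i) powr - (?n - 1)) * (G y * indicator (q i) y))
          = G y * (\<Sum>i<N. ennreal (C2 * r (Suc i) powr - (?n - 1)) * indicator (q i) y)"
          unfolding sum_distrib_left by (rule sum.cong) (simp_all only: mult_ac)
        have "(\<Sum>i<N. ennreal (C2 * r (Suc i) powr - (?n - 1)) * indicator (q i) y) \<le>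
          (\<Sum>i<N. ennreal (C2 * (if s \<le> (2 * t) * 2 ^ i then ((2 * t) * 2 ^ i) powr - (?n - 1) else 0)))"
        proof (intro sum_mono)
          fix i
          show "ennreal (C2 * r (Suc i) powr - (?n - 1)) * indicator (q i) y \<le>
            ennreal (C2 * (if s \<le> (2 * t) * 2 ^ i then ((2 * t) * 2 ^ i) powr - (?n - 1) else 0))"
            using le[of i] by (auto simp: indicator_def r_def mult_ac)
        qed
        also have "\<dots> = ennreal (C2 * (\<Sum>i<N. if s \<le> (2 * t) * 2 ^ i then ((2 * t) * 2 ^ i) powr - (?n - 1) else 0))"
          using \<open>C2 > 0\<close> by (subst sum_ennreal) (auto simp: sum_distrib_left)
        also have "\<dots> \<le> ennreal (C2 * (2 * s powr - (?n - 1)))"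
          using \<open>C2 > 0\<close> \<open>t > 0\<close> \<open>s > 0\<close> dim by (intro ennreal_leI mult_left_mono sum_geometric_powr_above_le) auto
        also have "C2 * (2 * s powr - (?n - 1)) = C * norm (x - y) powr (1 - ?n)"
          using dim by (simp add: s_def C_def powr_divide powr_diff field_simps)
        also have "ennreal \<dots> = ennreal C * riesz_kernel (x - y)"
          using \<open>C > 0\<close> by (simp add: riesz_kernel_def ennreal_mult)
        finally have "G y * (\<Sum>i<N. ennreal (C2 * r (Suc i) powr - (?n - 1)) * indicator (q i) y) \<le> G y * (ennreal C * riesz_kernel (x - y))"
          by (rule mult_left_mono) simp
        then show ?case unfolding fac mult.left_commute[of "ennreal C"] .
      qed
    qed
    also have "\<dots> = ennreal C * riesz_potential G x"
      unfolding riesz_potential_def by (rule nn_integral_cmult) measurable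
    finally show "ennreal (norm (truncated_transform \<Theta> t f x)) \<le> ennreal C * riesz_potential G x" .
  qed
qed

text \<open>Inside the unit ball the mean value zero allows replacing \<open>f (x - y)\<close> by \<open>f (x - y) - f x\<close>. The Lipschitz
  bound makes \<open>norm (\<Theta> y) |y|\<^bsup>1-n\<^esup>\<close> an integrable majorant there.\<close>

lemma truncated_transform_converges:
  fixes \<Theta> :: "'a::euclidean_space \<Rightarrow> complex"
  assumes T: "rough_kernel \<Theta> K" and mean: "(\<integral>y. \<Theta> y \<partial>sphere_measure) = 0"
    and cont: "continuous_on UNIV f" and bd: "bounded {x. f x \<noteq> 0}"
    and lip: "\<And>y. norm y \<le> 1 \<Longrightarrow> norm (f (x - y) - f x) \<le> L * norm y"
  obtains l where "((\<lambda>t. truncated_transform \<Theta> t f x) \<longlongrightarrow> l) (at_right 0)"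
proof -
  let ?n = "real DIM('a)"
  note T' = rough_kernelD[OF T]
  note [measurable] = T'(1)
  let ?k = "\<lambda>y. \<Theta> y / of_real (norm y ^ DIM('a))"
  have cont': "continuous_on UNIV (\<lambda>y. f (x - y))"
    by (intro continuous_intros continuous_on_compose2[OF cont]) auto
  note [measurable] = borel_measurable_continuous_onI[OF cont']
  obtain B where B: "\<And>z. norm (f z) \<le> B" using bounded_range_of_bounded_support[OF cont bd] by blast
  obtain \<rho> where \<rho>: "\<And>z. f z \<noteq> 0 \<Longrightarrow> norm z \<le> \<rho>" using bd by (auto simp: bounded_iff)
  define b where "b = max 1 (norm x + \<rho>)"
  have zero: "f (x - y) = 0" if "b < norm y" for y
  proof (rule ccontr)
    assume "f (x - y) \<noteq> 0"
    then have "norm (x - y) \<le> \<rho>" by (rule \<rho>)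
    moreover have "norm y \<le> norm x + norm (x - y)" using norm_triangle_ineq4[of x "x - y"] by simp
    ultimately show False using that by (simp add: b_def)
  qed
  have "L \<ge> 0"
  proof -
    obtain e :: 'a where "e \<in> Basis" using nonempty_Basis by blast
    then have "norm (f (x - e) - f x) \<le> L" using lip[of e] by simp
    then show ?thesis by (rule order_trans[OF norm_ge_zero])
  qed
  define J where "J = (\<lambda>t y. indicator {t<..1} (norm y) *\<^sub>R (?k y * (f (x - y) - f x)))"
  define c0 where "c0 = (\<integral>y. indicator {1<..b} (norm y) *\<^sub>R (?k y * f (x - y)) \<partial>lborel)"
  have split: "truncated_transform \<Theta> t f x = c0 + (\<integral>y. J t y \<partial>lborel)" if "0 < t" "t < 1" for t
  proof -
    have "truncated_transform \<Theta> t f x = (\<integral>y. indicator {t<..b} (norm y) *\<^sub>R (?k y * f (x - y)) \<partial>lborel)"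
      by (rule truncated_transform_eq_shell) (rule zero)
    also have "\<dots> = (\<integral>y. indicator {1<..b} (norm y) *\<^sub>R (?k y * f (x - y)) + indicator {t<..1} (norm y) *\<^sub>R (?k y * f (x - y)) \<partial>lborel)"
      using that by (intro Bochner_Integration.integral_cong) (auto simp: indicator_def b_def)
    also have "\<dots> = c0 + (\<integral>y. indicator {t<..1} (norm y) *\<^sub>R (?k y * f (x - y)) \<partial>lborel)"
      unfolding c0_def using that by (intro Bochner_Integration.integral_add integrable_shell_mult[OF T _ cont' B]) auto
    also have "(\<integral>y. indicator {t<..1} (norm y) *\<^sub>R (?k y * f (x - y)) \<partial>lborel) = (\<integral>y. J t y \<partial>lborel)"
      unfolding J_def by (rule shell_integral_subtract_const[OF T mean \<open>0 < t\<close> cont' B])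
    finally show ?thesis .
  qed
  define D where "D = (\<lambda>y. L * (norm (\<Theta> y) * indicator {0<..1} (norm y) * norm y powr (1 - ?n)))"
  have Dint: "integrable lborel D"
  proof (rule integrableI_bounded)
    have "(\<integral>\<^sup>+y. ennreal (norm (D y)) \<partial>lborel) = (\<integral>\<^sup>+y. ennreal L * (ennreal (norm (\<Theta> (sgn y))) * indicator {0<..1} (norm y) * riesz_kernel y) \<partial>lborel)"
      unfolding D_def riesz_kernel_def T'(2) using \<open>L \<ge> 0\<close>
      by (intro nn_integral_cong) (auto simp: indicator_def ennreal_mult abs_mult)
    also have "\<dots> = ennreal L * (\<integral>\<^sup>+y. ennreal (norm (\<Theta> (sgn y))) * indicator {0<..1} (norm y) * riesz_kernel y \<partial>lborel)"
      by (rule nn_integral_cmult) measurable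
    also have "\<dots> = ennreal L * ((\<integral>\<^sup>+y. ennreal (norm (\<Theta> y)) \<partial>sphere_measure) * (\<integral>\<^sup>+s\<in>{0<..}. indicator {0<..1::real} s \<partial>lborel))"
      by (subst nn_integral_polar_product[of "\<lambda>y. ennreal (norm (\<Theta> y))"]) auto
    also have "(\<integral>\<^sup>+s\<in>{0<..}. indicator {0<..1::real} s \<partial>lborel) = (\<integral>\<^sup>+s. indicator {0<..1::real} s \<partial>lborel)"
      by (intro nn_integral_cong) (auto simp: indicator_def)
    also have "ennreal L * ((\<integral>\<^sup>+y. ennreal (norm (\<Theta> y)) \<partial>sphere_measure) * \<dots>) < \<infinity>"
      using rough_kernel_integrable_sphere[OF T] by (simp add: ennreal_mult_less_top)
    finally show "(\<integral>\<^sup>+y. ennreal (norm (D y)) \<partial>lborel) < \<infinity>" .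
  qed (simp add: D_def)
  have dom: "norm (J t y) \<le> D y" if "t \<ge> 0" for t y
  proof (cases "t < norm y \<and> norm y \<le> 1")
    case True
    then have y: "0 < norm y" using that by linarith
    have "norm (?k y * (f (x - y) - f x)) \<le> norm (\<Theta> y) / norm y ^ DIM('a) * (L * norm y)"
      unfolding norm_mult using True lip[of y] by (intro mult_mono) (auto simp: norm_divide norm_power)
    also have "\<dots> = L * (norm (\<Theta> y) * norm y powr (1 - ?n))"
      using y by (simp add: powr_diff powr_realpow)
    finally show ?thesis using True that by (simp add: J_def D_def indicator_def)
  qed (use \<open>L \<ge> 0\<close> in \<open>auto simp: J_def D_def indicator_def\<close>)
  have lim: "((\<lambda>t. \<integral>y. J t y \<partial>lborel) \<longlongrightarrow> (\<integral>y. J 0 y \<partial>lborel)) (at_right 0)"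
    unfolding tendsto_at_iff_sequentially comp_def
  proof (intro allI impI)
    fix X :: "nat \<Rightarrow> real" assume X: "\<forall>i. X i \<in> {0<..} - {0}" "X \<longlonglongrightarrow> 0"
    show "(\<lambda>i. \<integral>y. J (X i) y \<partial>lborel) \<longlonglongrightarrow> (\<integral>y. J 0 y \<partial>lborel)"
    proof (rule integral_dominated_convergence[where w = D])
      show "AE y in lborel. (\<lambda>i. J (X i) y) \<longlonglongrightarrow> J 0 y"
      proof (rule AE_I2)
        fix y
        show "(\<lambda>i. J (X i) y) \<longlonglongrightarrow> J 0 y"
        proof (cases "y = 0")
          case False
          then have "eventually (\<lambda>i. X i < norm y) sequentially"
            using X(2) by (intro order_tendstoD) auto
          then have "eventually (\<lambda>i. J (X i) y = J 0 y) sequentially"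
            by eventually_elim (use False in \<open>auto simp: J_def indicator_def\<close>)
          then show ?thesis by (rule tendsto_eventually)
        qed (simp add: J_def)
      qed
      show "AE y in lborel. norm (J (X i) y) \<le> D y" for i
      proof -
        have "X i \<ge> 0" using X(1) by (auto intro: less_imp_le)
        then show ?thesis using dom by auto
      qed
    qed (use Dint in \<open>auto simp: J_def\<close>)
  qed
  have "((\<lambda>t. c0 + (\<integral>y. J t y \<partial>lborel)) \<longlongrightarrow> c0 + (\<integral>y. J 0 y \<partial>lborel)) (at_right 0)"
    by (intro tendsto_intros lim)
  moreover have "eventually (\<lambda>t. truncated_transform \<Theta> t f x = c0 + (\<integral>y. J t y \<partial>lborel)) (at_right 0)"
    using eventually_at_right_real[OF zero_less_one] by eventually_elim (simp add: split)
  ultimately have "((\<lambda>t. truncated_transform \<Theta> t f x) \<longlongrightarrow> c0 + (\<integral>y. J 0 y \<partial>lborel)) (at_right 0)"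
    by (subst tendsto_cong)
  then show thesis by (rule that)
qed

section \<open>Powers and weights\<close>

lemma epowr_mono: "0 < a \<Longrightarrow> x \<le> y \<Longrightarrow> epowr x a \<le> epowr y a"
  by (cases x; cases y) (auto simp: epowr_def ennreal_eq_0_iff top_unique intro!: ennreal_leI powr_mono2)

lemma epowr_top: "0 < a \<Longrightarrow> epowr \<infinity> a = \<infinity>"
  by (simp add: epowr_def)

lemma epowr_mult:
  assumes "0 < a" "0 < c"
  shows "epowr (ennreal c * x) a = ennreal (c powr a) * epowr x a"
proof (cases x)
  case (real r)
  then show ?thesis using assms
    by (simp add: epowr_ennreal powr_mult flip: ennreal_mult)
next
  case top
  then show ?thesis using assms by (simp add: epowr_top[unfolded infinity_ennreal_def] ennreal_mult_top)
qed

lemma epowr_epowr: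
  assumes "0 < a" "0 < b"
  shows "epowr (epowr x a) b = epowr x (a * b)"
proof (cases x)
  case (real r)
  then show ?thesis using assms by (simp add: epowr_ennreal powr_powr)
next
  case top
  then show ?thesis using assms by (simp add: epowr_top[unfolded infinity_ennreal_def])
qed

lemma epowr_one: "epowr x 1 = x"
  by (cases x) (auto simp: epowr_ennreal epowr_top[unfolded infinity_ennreal_def])

lemma epowr_measurable [measurable]:
  assumes [measurable]: "f \<in> borel_measurable M"
  shows "(\<lambda>x. epowr (f x) a) \<in> borel_measurable M"
  unfolding epowr_def by measurable

lemma weight_measurable:
  fixes w :: "'a::euclidean_space \<Rightarrow> real"
  assumes "weight w"
  shows "w \<in> borel_measurable lebesgue"
proof (rule borel_measurable_LIMSEQ_real)
  show "(\<lambda>x. indicator (cball 0 (real n)) x *\<^sub>R w x) \<in> borel_measurable lebesgue" for n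
    using assms unfolding weight_def set_integrable_def by (intro borel_measurable_integrable) auto
  fix x :: 'a
  obtain N :: nat where N: "norm x \<le> real N" using real_arch_simple by blast
  show "(\<lambda>n. indicator (cball 0 (real n)) x *\<^sub>R w x) \<longlonglongrightarrow> w x"
  proof (rule tendsto_eventually)
    show "\<forall>\<^sub>F n in sequentially. indicator (cball 0 (real n)) x *\<^sub>R w x = w x"
      using eventually_ge_at_top[of N] by eventually_elim (use N in \<open>auto simp: indicator_def\<close>)
  qed
qed

text \<open>A Borel representative can be used with product measures and with the Borel measure; no integral against
  the weight changes.\<close>

lemma weight_borel_version:
  fixes w :: "'a::euclidean_space \<Rightarrow> real"
  assumes "weight w"
  obtains v where "v \<in> borel_measurable borel" "\<And>x. 0 \<le> v x" "AE x in lborel. w x = v x"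
    "\<And>a l. (\<integral>\<^sup>+x\<in>cube a l. ennreal (v x) \<partial>lborel) < \<infinity>"
proof -
  obtain v0 where v0: "v0 \<in> borel_measurable lborel" "AE x in lborel. w x = v0 x"
    using completion_ex_borel_measurable_real[OF weight_measurable[OF assms]] by blast
  define v where "v = (\<lambda>x. max 0 (v0 x))"
  have 1: "v \<in> borel_measurable borel" using v0(1) unfolding v_def by simp
  have w0: "0 \<le> w x" for x using assms by (simp add: weight_def)
  have 3: "AE x in lborel. w x = v x"
    using v0(2)
  proof eventually_elim
    case (elim x)
    then show ?case using w0[of x] by (simp add: v_def)
  qed
  have 4: "(\<integral>\<^sup>+x\<in>cube a l. ennreal (v x) \<partial>lborel) < \<infinity>" for a l
  proof -
    have "integrable lebesgue (\<lambda>x. indicator (cube a l) x *\<^sub>R w x)"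
      using assms unfolding weight_def set_integrable_def by (auto simp: cube_def)
    then have "(\<integral>\<^sup>+x. ennreal (norm (indicator (cube a l) x *\<^sub>R w x)) \<partial>lborel) < \<infinity>"
      by (simp add: integrable_iff_bounded nn_integral_completion)
    also have "(\<integral>\<^sup>+x. ennreal (norm (indicator (cube a l) x *\<^sub>R w x)) \<partial>lborel) = (\<integral>\<^sup>+x\<in>cube a l. ennreal (v x) \<partial>lborel)"
    proof (rule nn_integral_cong_AE)
      show "AE x in lborel. ennreal (norm (indicator (cube a l) x *\<^sub>R w x)) = ennreal (v x) * indicator (cube a l) x"
        using 3
      proof eventually_elim
        case (elim x)
        then show ?case using w0[of x] by (simp add: indicator_def)
      qed
    qed
    finally show ?thesis .
  qed
  show thesis by (rule that[OF 1 _ 3 4]) (simp add: v_def)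
qed

text \<open>For every \<open>\<mu> > 0\<close> either \<open>\<mu> w \<ge> 1\<close> or \<open>(\<mu> w)\<^bsup>1-s'\<^esup> \<ge> 1\<close>; integrating over \<open>E\<close> and choosing
  \<open>\<mu>\<close> such that the second term accounts for half of \<open>|E|\<close> bounds the mass of \<open>E\<close> from below.\<close>

lemma A_infinity_half_comparable:
  fixes w :: "'a::euclidean_space \<Rightarrow> real"
  assumes w: "w \<in> A_infinity" and v: "v \<in> borel_measurable borel" "\<And>x. 0 \<le> v x" "AE x in lborel. w x = v x"
    and vfin: "\<And>a l. (\<integral>\<^sup>+x\<in>cube a l. ennreal (v x) \<partial>lborel) < \<infinity>"
  obtains C :: real where "C > 0" "\<And>a l E. l > 0 \<Longrightarrow> E \<in> sets borel \<Longrightarrow> E \<subseteq> cube a l \<Longrightarrow>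
    ennreal (l ^ DIM('a) / 2) \<le> emeasure lborel E \<Longrightarrow>
    (\<integral>\<^sup>+x\<in>cube a l. ennreal (v x) \<partial>lborel) \<le> ennreal C * (\<integral>\<^sup>+x\<in>E. ennreal (v x) \<partial>lborel)"
proof -
  obtain s where s: "s > 1" "A_const s w < \<infinity>" using w unfolding A_infinity_def A_class_def by auto
  then obtain A where A: "A_const s w = ennreal A" "A \<ge> 0" by (cases "A_const s w") auto
  note [measurable] = v(1)
  define c where "c = 1 - conj_exponent s"
  have c: "c < 0" "c * (s - 1) = -1" using s(1) by (auto simp: c_def conj_exponent_def field_simps)
  show thesis
  proof (rule that[of "(A + 1) * 4 powr s"])
    show "(A + 1) * 4 powr s > 0" using A by simp
    fix a l and E :: "'a set" assume "l > 0" and [measurable]: "E \<in> sets borel" and E: "E \<subseteq> cube a l"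
      and half: "ennreal (l ^ DIM('a) / 2) \<le> emeasure lborel E"
    let ?Q = "cube a l :: 'a set"
    define q where "q = l ^ DIM('a)"
    have "q > 0" using \<open>l > 0\<close> by (simp add: q_def)
    define X where "X = (\<integral>\<^sup>+x\<in>?Q. ennreal (v x) \<partial>lborel)"
    define Y where "Y = (\<integral>\<^sup>+x\<in>E. ennreal (v x) \<partial>lborel)"
    define V where "V = (\<integral>\<^sup>+x\<in>?Q. epowr (ennreal (v x)) c \<partial>lborel)"
    have Ac: "X / ennreal q * epowr (V / ennreal q) (s - 1) \<le> ennreal A"
    proof -
      have avg: "average ?Q (\<lambda>x. ennreal (w x)) = X / ennreal q"
        unfolding average_cube[OF \<open>l > 0\<close>] X_def q_def using v(3)
        by (intro arg_cong2[where f = divide] nn_integral_cong_AE refl, eventually_elim) simp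
      have avg2: "average ?Q (\<lambda>x. epowr (ennreal (w x)) (1 - conj_exponent s)) = V / ennreal q"
        unfolding average_cube[OF \<open>l > 0\<close>] V_def q_def c_def using v(3)
        by (intro arg_cong2[where f = divide] nn_integral_cong_AE refl, eventually_elim) simp
      have "(case (a, l) of (a, l) \<Rightarrow> average (cube a l) (\<lambda>x. ennreal (w x)) *
        epowr (average (cube a l) (\<lambda>x. epowr (ennreal (w x)) (1 - conj_exponent s))) (s - 1)) \<le> A_const s w"
        unfolding A_const_def by (rule SUP_upper) (use \<open>l > 0\<close> in auto)
      then show ?thesis by (simp add: avg avg2 A)
    qed
    have "X < \<infinity>" unfolding X_def by (rule vfin)
    then obtain X' where X: "X = ennreal X'" "X' \<ge> 0" by (cases X) auto
    have "Y \<le> X" unfolding X_def Y_def using E by (intro nn_integral_mono) (auto simp: indicator_def)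
    then obtain Y' where Y: "Y = ennreal Y'" "Y' \<ge> 0" using \<open>X < \<infinity>\<close> by (cases Y) (auto simp: top_unique)
    have "X' \<le> (A + 1) * 4 powr s * Y'"
    proof (cases "X' = 0")
      case False
      then have "X' > 0" using X by simp
      have "V \<noteq> \<infinity>"
      proof
        assume "V = \<infinity>"
        then have "V / ennreal q = \<infinity>" using \<open>q > 0\<close> by (simp add: ennreal_top_divide)
        then have "X / ennreal q * \<infinity> \<le> ennreal A" using Ac s(1) by (simp add: epowr_top[unfolded infinity_ennreal_def])
        moreover have "X / ennreal q * \<infinity> = \<infinity>"
          using \<open>X' > 0\<close> \<open>q > 0\<close> by (simp add: X divide_ennreal ennreal_mult_top)
        ultimately show False by (simp add: top_unique)
      qed
      then obtain V' where V: "V = ennreal V'" "V' \<ge> 0" by (cases V) auto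
      have "emeasure lborel E \<le> emeasure lborel ?Q" using E by (intro emeasure_mono) auto
      then have "emeasure lborel E < \<infinity>" using \<open>l > 0\<close> by (simp add: emeasure_cube le_less_trans)
      then obtain e where e: "emeasure lborel E = ennreal e" "e \<ge> 0" by (cases "emeasure lborel E") auto
      have "e \<ge> q / 2" using half e by (simp add: q_def)
      then have "e > 0" using \<open>q > 0\<close> by simp
      have key: "e \<le> \<mu> * Y' + \<mu> powr c * V'" if "\<mu> > 0" for \<mu>
      proof -
        have "ennreal e = (\<integral>\<^sup>+x. indicator E x \<partial>lborel)" by (simp add: e)
        also have "\<dots> \<le> (\<integral>\<^sup>+x. ennreal \<mu> * (ennreal (v x) * indicator E x) + ennreal (\<mu> powr c) * (epowr (ennreal (v x)) c * indicator ?Q x) \<partial>lborel)"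
        proof (rule nn_integral_mono)
          fix x
          have "1 \<le> ennreal \<mu> * ennreal (v x) + ennreal (\<mu> powr c) * epowr (ennreal (v x)) c"
          proof (cases "v x = 0")
            case True
            then show ?thesis using c \<open>\<mu> > 0\<close> by (simp add: epowr_def ennreal_mult_top)
          next
            case False
            then have "v x > 0" using v(2)[of x] by simp
            then have ep: "epowr (ennreal (v x)) c = ennreal (v x powr c)" using c by (simp add: epowr_def)
            have "1 \<le> \<mu> * v x + (\<mu> * v x) powr c"
            proof (cases "\<mu> * v x \<ge> 1")
              case False
              then have "(\<mu> * v x) powr 0 \<le> (\<mu> * v x) powr c"
                using c \<open>\<mu> > 0\<close> \<open>v x > 0\<close> by (intro powr_mono') auto
              then show ?thesis using \<open>\<mu> > 0\<close> \<open>v x > 0\<close> by (simp add: add_increasing)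
            qed (simp add: add_increasing2)
            then have "ennreal 1 \<le> ennreal (\<mu> * v x + \<mu> powr c * v x powr c)"
              using \<open>\<mu> > 0\<close> \<open>v x > 0\<close> by (intro ennreal_leI) (simp add: powr_mult)
            then show ?thesis unfolding ep using \<open>\<mu> > 0\<close> \<open>v x > 0\<close> by (simp add: ennreal_mult)
          qed
          then show "indicator E x \<le> ennreal \<mu> * (ennreal (v x) * indicator E x) + ennreal (\<mu> powr c) * (epowr (ennreal (v x)) c * indicator ?Q x)"
            using E by (auto simp: indicator_def)
        qed
        also have "\<dots> = ennreal \<mu> * Y + ennreal (\<mu> powr c) * V"
          unfolding Y_def V_def by (subst nn_integral_add) (auto simp: nn_integral_cmult)
        also have "\<dots> = ennreal (\<mu> * Y' + \<mu> powr c * V')"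
          using \<open>\<mu> > 0\<close> X Y V by (simp add: ennreal_mult)
        finally show ?thesis using \<open>\<mu> > 0\<close> Y V by (simp add: add_nonneg_nonneg del: ennreal_plus)
      qed
      \<comment> \<open>Otherwise \<open>\<mu>\<close> could be taken so small that \<open>key\<close> contradicts \<open>e > 0\<close>.\<close>
      have "V' > 0"
      proof (rule ccontr)
        assume "\<not> V' > 0"
        then have "V' = 0" using V by simp
        then have "e \<le> e / (2 * (Y' + 1)) * Y'" using key[of "e / (2 * (Y' + 1))"] \<open>e > 0\<close> Y by simp
        also have "\<dots> = e * (Y' / (2 * (Y' + 1)))" by simp
        also have "\<dots> < e * 1" using \<open>e > 0\<close> Y by (intro mult_strict_left_mono) (auto simp: field_simps)
        finally show False by simp
      qed
      \<comment> \<open>This value makes the second term of \<open>key\<close> equal to \<open>e / 2\<close>.\<close>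
      define \<mu> where "\<mu> = (2 * V' / e) powr (s - 1)"
      have "\<mu> > 0" using \<open>V' > 0\<close> \<open>e > 0\<close> by (simp add: \<mu>_def)
      have "\<mu> powr c = (2 * V' / e) powr (-1)"
        unfolding \<mu>_def powr_powr using c(2) by (simp add: mult.commute)
      then have "\<mu> powr c * V' = e / 2" using \<open>V' > 0\<close> \<open>e > 0\<close> by (simp add: powr_minus)
      with key[OF \<open>\<mu> > 0\<close>] have "e / 2 \<le> \<mu> * Y'" by simp
      moreover have "q / 4 \<le> e / 2" using \<open>e \<ge> q / 2\<close> by simp
      moreover have "\<mu> \<le> (4 * V' / q) powr (s - 1)"
      proof -
        have "2 * V' / e \<le> 2 * V' / (q / 2)"
          using \<open>e \<ge> q / 2\<close> \<open>q > 0\<close> \<open>V' > 0\<close> by (intro divide_left_mono) auto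
        then show ?thesis unfolding \<mu>_def using s(1) \<open>V' > 0\<close> \<open>e > 0\<close> by (intro powr_mono2) auto
      qed
      ultimately have qY: "q / 4 \<le> (4 * V' / q) powr (s - 1) * Y'"
        using mult_right_mono[of \<mu> "(4 * V' / q) powr (s - 1)" Y'] Y by linarith
      have "X / ennreal q * epowr (V / ennreal q) (s - 1) = ennreal (X' / q * (V' / q) powr (s - 1))"
        using \<open>q > 0\<close> X V s(1) by (simp add: divide_ennreal epowr_ennreal flip: ennreal_mult)
      then have XV: "X' / q * (V' / q) powr (s - 1) \<le> A" using Ac A by simp
      define D where "D = (V' / q) powr (s - 1)"
      have "D > 0" using \<open>V' > 0\<close> \<open>q > 0\<close> by (simp add: D_def)
      have D4: "(4 * V' / q) powr (s - 1) = 4 powr (s - 1) * D"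
        using \<open>V' > 0\<close> \<open>q > 0\<close> powr_mult[of 4 "V' / q" "s - 1"] by (simp add: D_def)
      have "X' * D \<le> A * q" using XV \<open>q > 0\<close> by (simp add: D_def field_simps)
      also have "\<dots> \<le> A * (4 * (4 powr (s - 1) * D * Y'))" using qY A D4 by (intro mult_left_mono) auto
      also have "\<dots> = (A * 4 powr s * Y') * D" by (simp add: powr_diff)
      finally have "X' \<le> A * 4 powr s * Y'" using \<open>D > 0\<close> by simp
      also have "\<dots> \<le> (A + 1) * 4 powr s * Y'" using Y by (intro mult_right_mono) auto
      finally show ?thesis .
    qed (use Y A in simp)
    then have "ennreal X' \<le> ennreal ((A + 1) * 4 powr s) * ennreal Y'"
      using A Y by (subst ennreal_mult[symmetric]) (auto intro: ennreal_leI)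
    then show "(\<integral>\<^sup>+x\<in>?Q. ennreal (v x) \<partial>lborel) \<le> ennreal ((A + 1) * 4 powr s) * (\<integral>\<^sup>+x\<in>E. ennreal (v x) \<partial>lborel)"
      using X Y by (simp add: X_def Y_def)
  qed
qed

section \<open>Dyadic grids\<close>

text \<open>The least corner of the half-open cube of side \<open>h\<close> that contains \<open>x\<close>, in the grid with vertices \<open>h \<int>\<^sup>n\<close>. It
  stands for the cube, which avoids indexing cubes and makes nestedness of the grids of sides \<open>h\<close> and \<open>2 h\<close> an
  equation.\<close>

definition corner :: "real \<Rightarrow> 'a::euclidean_space \<Rightarrow> 'a" where
  "corner h x = (\<Sum>i\<in>Basis. (h * of_int \<lfloor>x \<bullet> i / h\<rfloor>) *\<^sub>R i)"

lemma corner_inner: "i \<in> Basis \<Longrightarrow> corner h x \<bullet> i = h * of_int \<lfloor>x \<bullet> i / h\<rfloor>"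
  by (simp add: corner_def)

lemma corner_bounds:
  assumes "h > 0" "i \<in> Basis"
  shows "corner h x \<bullet> i \<le> x \<bullet> i" "x \<bullet> i < corner h x \<bullet> i + h"
proof -
  have "h * of_int \<lfloor>x \<bullet> i / h\<rfloor> \<le> h * (x \<bullet> i / h)" "h * (x \<bullet> i / h) < h * (of_int \<lfloor>x \<bullet> i / h\<rfloor> + 1)"
    using assms by (intro mult_left_mono mult_strict_left_mono; linarith)+
  then show "corner h x \<bullet> i \<le> x \<bullet> i" "x \<bullet> i < corner h x \<bullet> i + h"
    using assms by (simp_all add: corner_inner distrib_left)
qed

lemma corner_corner: "h > 0 \<Longrightarrow> corner h (corner h x) = corner h x"
  by (rule euclidean_eqI) (simp add: corner_inner)

lemma corner_double_corner:
  assumes "h > 0"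
  shows "corner (2 * h) (corner h x) = corner (2 * h) x"
proof (rule euclidean_eqI)
  fix i :: 'a assume i: "i \<in> Basis"
  have "\<lfloor>h * of_int \<lfloor>x \<bullet> i / h\<rfloor> / (2 * h)\<rfloor> = \<lfloor>real_of_int \<lfloor>x \<bullet> i / h\<rfloor> / real_of_int 2\<rfloor>" using assms by simp
  also have "\<dots> = \<lfloor>x \<bullet> i / h\<rfloor> div 2" by (rule floor_divide_of_int_eq)
  also have "\<dots> = \<lfloor>x \<bullet> i / h / real_of_int 2\<rfloor>" by (rule floor_divide_real_eq_div[symmetric]) simp
  also have "\<dots> = \<lfloor>x \<bullet> i / (2 * h)\<rfloor>" by (simp add: mult.commute)
  finally show "corner (2 * h) (corner h x) \<bullet> i = corner (2 * h) x \<bullet> i"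
    using i by (simp add: corner_inner)
qed

lemma corner_measurable [measurable]: "corner h \<in> borel_measurable borel"
  unfolding corner_def[abs_def] by measurable

lemma countable_range_corner: "countable (range (corner h :: 'a::euclidean_space \<Rightarrow> 'a))"
proof -
  let ?I = "PiE (Basis :: 'a set) (\<lambda>_. UNIV :: int set)"
  have "countable ((\<lambda>k. \<Sum>i\<in>Basis. (h * of_int (k i)) *\<^sub>R i) ` ?I)"
    by (intro countable_image countable_PiE) auto
  moreover have "range (corner h) \<subseteq> (\<lambda>k. \<Sum>i\<in>Basis. (h * of_int (k i)) *\<^sub>R i) ` ?I"
  proof
    fix c assume "c \<in> range (corner h :: 'a \<Rightarrow> 'a)"
    then obtain x where "c = corner h x" by blast
    then have "c = (\<Sum>i\<in>Basis. (h * of_int (restrict (\<lambda>i. \<lfloor>x \<bullet> i / h\<rfloor>) Basis i)) *\<^sub>R i)"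
      by (simp add: corner_def)
    then show "c \<in> (\<lambda>k. \<Sum>i\<in>Basis. (h * of_int (k i)) *\<^sub>R i) ` ?I" by (rule image_eqI[where x = "restrict (\<lambda>i. \<lfloor>x \<bullet> i / h\<rfloor>) Basis"]) (simp only: restrict_PiE_iff, simp)
  qed
  ultimately show ?thesis by (rule countable_subset[rotated])
qed

definition cell :: "real \<Rightarrow> 'a::euclidean_space \<Rightarrow> 'a set" where
  "cell h c = {y. corner h y = c}"

lemma cell_measurable [measurable]: "cell h c \<in> sets borel"
  unfolding cell_def by measurable

lemma cell_subset_cube:
  assumes "h > 0"
  shows "cell h c \<subseteq> cube c h"
proof
  fix y assume "y \<in> cell h c"
  then show "y \<in> cube c h"
    using corner_bounds[OF assms, of _ y] by (auto simp: cell_def mem_cube intro: less_imp_le)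
qed

lemma emeasure_cell:
  assumes "h > 0"
  shows "emeasure lborel (cell h (corner h (x :: 'a::euclidean_space))) = ennreal (h ^ DIM('a))"
proof (rule antisym)
  let ?c = "corner h x"
  show "emeasure lborel (cell h ?c) \<le> ennreal (h ^ DIM('a))"
    using emeasure_mono[OF cell_subset_cube[OF assms, of ?c], of lborel] assms by (simp add: emeasure_cube)
  have "box ?c (?c + h *\<^sub>R One) \<subseteq> cell h ?c"
  proof
    fix y assume y: "y \<in> box ?c (?c + h *\<^sub>R One)"
    have "corner h y = ?c"
    proof (rule euclidean_eqI)
      fix i :: 'a assume i: "i \<in> Basis"
      have "?c \<bullet> i < y \<bullet> i" "y \<bullet> i < ?c \<bullet> i + h" using y i by (auto simp: mem_box inner_add_left)
      then have "\<lfloor>y \<bullet> i / h\<rfloor> = \<lfloor>x \<bullet> i / h\<rfloor>"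
        using assms i by (intro floor_unique) (auto simp: corner_inner field_simps)
      then show "corner h y \<bullet> i = ?c \<bullet> i" using i by (simp add: corner_inner)
    qed
    then show "y \<in> cell h ?c" by (simp add: cell_def)
  qed
  then have "emeasure lborel (box ?c (?c + h *\<^sub>R One)) \<le> emeasure lborel (cell h ?c)"
    by (intro emeasure_mono) auto
  then show "ennreal (h ^ DIM('a)) \<le> emeasure lborel (cell h ?c)"
    using assms by (simp add: emeasure_lborel_box_eq inner_add_left)
qed

text \<open>Constant on the cubes of the grid of side \<open>h\<close>.\<close>

definition adapted :: "real \<Rightarrow> ('a::euclidean_space \<Rightarrow> 'b) \<Rightarrow> bool" where
  "adapted h \<phi> \<longleftrightarrow> (\<forall>x. \<phi> (corner h x) = \<phi> x)"

lemma adapted_double: "h > 0 \<Longrightarrow> adapted (2 * h) \<phi> \<Longrightarrow> adapted h \<phi>"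
  unfolding adapted_def
proof
  fix x assume h: "h > 0" and a: "\<forall>x. \<phi> (corner (2 * h) x) = \<phi> x"
  have "\<phi> (corner h x) = \<phi> (corner (2 * h) (corner h x))" using a by simp
  also have "\<dots> = \<phi> x" using a by (simp add: corner_double_corner[OF h])
  finally show "\<phi> (corner h x) = \<phi> x" .
qed

lemma adapted_finer:
  assumes "h > 0" "adapted (h * 2 ^ k) \<phi>" "j \<le> k"
  shows "adapted (h * 2 ^ j) \<phi>"
  using \<open>j \<le> k\<close> \<open>adapted (h * 2 ^ k) \<phi>\<close>
proof (induction k)
  case (Suc k)
  show ?case
  proof (cases "j = Suc k")
    case False
    have "adapted (h * 2 ^ k) \<phi>"
      by (rule adapted_double) (use Suc.prems assms(1) in \<open>simp_all add: mult.left_commute\<close>)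
    then show ?thesis using Suc False by simp
  qed (use Suc in simp)
qed simp

lemma adapted_measurable:
  fixes \<phi> :: "'a::euclidean_space \<Rightarrow> 'b::topological_space"
  assumes "adapted h \<phi>"
  shows "\<phi> \<in> borel_measurable borel"
proof (rule measurableI)
  fix A :: "'b set" assume "A \<in> sets borel"
  have "\<phi> -` A \<inter> space borel = (\<Union>c\<in>range (corner h) \<inter> {c. \<phi> c \<in> A}. cell h c)"
  proof (intro equalityI subsetI)
    fix x assume "x \<in> \<phi> -` A \<inter> space borel"
    then show "x \<in> (\<Union>c\<in>range (corner h) \<inter> {c. \<phi> c \<in> A}. cell h c)"
      using assms by (intro UN_I[of "corner h x"]) (auto simp: adapted_def cell_def)
  next
    fix x assume "x \<in> (\<Union>c\<in>range (corner h) \<inter> {c. \<phi> c \<in> A}. cell h c)"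
    then obtain c where "\<phi> c \<in> A" "corner h x = c" by (auto simp: cell_def)
    moreover have "\<phi> (corner h x) = \<phi> x" using assms by (simp add: adapted_def)
    ultimately show "x \<in> \<phi> -` A \<inter> space borel" by simp
  qed
  moreover have "(\<Union>c\<in>range (corner h) \<inter> {c. \<phi> c \<in> A}. cell h c) \<in> sets borel"
    by (intro sets.countable_UN' countable_Int1 countable_range_corner) auto
  ultimately show "\<phi> -` A \<inter> space borel \<in> sets borel" by simp
qed simp

lemma nn_integral_cells:
  fixes f :: "'a::euclidean_space \<Rightarrow> ennreal"
  assumes [measurable]: "f \<in> borel_measurable borel"
  shows "(\<integral>\<^sup>+x. f x \<partial>lborel) = (\<integral>\<^sup>+c. (\<integral>\<^sup>+x\<in>cell h c. f x \<partial>lborel) \<partial>count_space (range (corner h)))"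
proof -
  have "(\<integral>\<^sup>+x. f x \<partial>lborel) = (\<integral>\<^sup>+x. (\<integral>\<^sup>+c. f x * indicator (cell h c) x \<partial>count_space (range (corner h))) \<partial>lborel)"
  proof (rule nn_integral_cong)
    fix x :: 'a
    have "(\<integral>\<^sup>+c. f x * indicator (cell h c) x \<partial>count_space (range (corner h))) = (\<integral>\<^sup>+c. f x * indicator {corner h x} c \<partial>count_space (range (corner h)))"
      by (intro nn_integral_cong) (auto simp: indicator_def cell_def)
    also have "\<dots> = f x * emeasure (count_space (range (corner h))) {corner h x}"
      by (rule nn_integral_cmult_indicator) auto
    finally show "f x = (\<integral>\<^sup>+c. f x * indicator (cell h c) x \<partial>count_space (range (corner h)))" by simp
  qed
  also have "\<dots> = (\<integral>\<^sup>+c. (\<integral>\<^sup>+x\<in>cell h c. f x \<partial>lborel) \<partial>count_space (range (corner h)))"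
    by (rule nn_integral_count_space_nn_integral[OF countable_range_corner]) measurable
  finally show ?thesis .
qed

lemma nn_integral_adapted_le:
  fixes v :: "'a::euclidean_space \<Rightarrow> ennreal"
  assumes "h > 0" "adapted h \<phi>" and [measurable]: "v \<in> borel_measurable borel" "E \<in> sets borel"
    and cmp: "\<And>x. (\<integral>\<^sup>+y\<in>cell h (corner h x). v y \<partial>lborel) \<le> C * (\<integral>\<^sup>+y\<in>cell h (corner h x) \<inter> E. v y \<partial>lborel)"
  shows "(\<integral>\<^sup>+x. \<phi> x * v x \<partial>lborel) \<le> C * (\<integral>\<^sup>+x\<in>E. \<phi> x * v x \<partial>lborel)"
proof -
  have [measurable]: "\<phi> \<in> borel_measurable borel" by (rule adapted_measurable[OF assms(2)])
  have const: "(\<integral>\<^sup>+x\<in>cell h c. \<phi> x * f x \<partial>lborel) = \<phi> c * (\<integral>\<^sup>+x\<in>cell h c. f x \<partial>lborel)"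
    if [measurable]: "f \<in> borel_measurable borel" for f c
  proof -
    have "(\<integral>\<^sup>+x\<in>cell h c. \<phi> x * f x \<partial>lborel) = (\<integral>\<^sup>+x. \<phi> c * (f x * indicator (cell h c) x) \<partial>lborel)"
    proof (rule nn_integral_cong)
      fix x
      have "\<phi> x = \<phi> c" if "x \<in> cell h c" using that assms(2) unfolding adapted_def cell_def by auto
      then show "\<phi> x * f x * indicator (cell h c) x = \<phi> c * (f x * indicator (cell h c) x)"
        by (auto simp: indicator_def)
    qed
    also have "\<dots> = \<phi> c * (\<integral>\<^sup>+x\<in>cell h c. f x \<partial>lborel)" by (rule nn_integral_cmult) measurable
    finally show ?thesis .
  qed
  have "(\<integral>\<^sup>+x. \<phi> x * v x \<partial>lborel) = (\<integral>\<^sup>+c. \<phi> c * (\<integral>\<^sup>+x\<in>cell h c. v x \<partial>lborel) \<partial>count_space (range (corner h)))"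
    by (subst nn_integral_cells[where h = h]) (auto simp: const)
  also have "\<dots> \<le> (\<integral>\<^sup>+c. C * (\<phi> c * (\<integral>\<^sup>+x\<in>cell h c. v x * indicator E x \<partial>lborel)) \<partial>count_space (range (corner h)))"
  proof (rule nn_integral_mono)
    fix c assume "c \<in> space (count_space (range (corner h :: 'a \<Rightarrow> 'a)))"
    then obtain x where c: "c = corner h x" by auto
    have "\<phi> c * (\<integral>\<^sup>+x\<in>cell h c. v x \<partial>lborel) \<le> \<phi> c * (C * (\<integral>\<^sup>+y\<in>cell h c \<inter> E. v y \<partial>lborel))"
      unfolding c by (intro mult_left_mono cmp) auto
    also have "(\<integral>\<^sup>+y\<in>cell h c \<inter> E. v y \<partial>lborel) = (\<integral>\<^sup>+x\<in>cell h c. v x * indicator E x \<partial>lborel)"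
      by (intro nn_integral_cong) (auto simp: indicator_def)
    finally show "\<phi> c * (\<integral>\<^sup>+x\<in>cell h c. v x \<partial>lborel) \<le> C * (\<phi> c * (\<integral>\<^sup>+x\<in>cell h c. v x * indicator E x \<partial>lborel))"
      by (simp only: mult_ac)
  qed
  also have "\<dots> = C * (\<integral>\<^sup>+c. \<phi> c * (\<integral>\<^sup>+x\<in>cell h c. v x * indicator E x \<partial>lborel) \<partial>count_space (range (corner h)))"
    by (rule nn_integral_cmult) simp
  also have "(\<integral>\<^sup>+c. \<phi> c * (\<integral>\<^sup>+x\<in>cell h c. v x * indicator E x \<partial>lborel) \<partial>count_space (range (corner h))) = (\<integral>\<^sup>+x. \<phi> x * (v x * indicator E x) \<partial>lborel)"
    by (subst (2) nn_integral_cells[where h = h]) (auto simp: const)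
  finally show ?thesis by (simp add: mult.assoc)
qed

section \<open>Sums over dyadic scales\<close>

text \<open>The closed cube of three times the side, concentric with the grid cube of \<open>x\<close>. It contains all points
  at distance at most \<open>h\<close> from \<open>x\<close>.\<close>

definition near_cube :: "real \<Rightarrow> 'a::euclidean_space \<Rightarrow> 'a set" where
  "near_cube h x = cube (corner h x - h *\<^sub>R One) (3 * h)"

text \<open>Up to a constant this majorises the part of the Riesz potential at \<open>x\<close> that comes from distances between
  \<open>h / 2\<close> and \<open>h\<close>.\<close>

definition dyadic_mass :: "('a::euclidean_space \<Rightarrow> ennreal) \<Rightarrow> real \<Rightarrow> 'a \<Rightarrow> real" where
  "dyadic_mass g h x = h powr (1 - real DIM('a)) * enn2real (\<integral>\<^sup>+y\<in>near_cube h x. g y \<partial>lborel)"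

lemma near_cube_measurable [measurable]: "near_cube h x \<in> sets borel"
  by (simp add: near_cube_def)

lemma mem_near_cube:
  "y \<in> near_cube h x \<longleftrightarrow> (\<forall>i\<in>Basis. corner h x \<bullet> i - h \<le> y \<bullet> i \<and> y \<bullet> i \<le> corner h x \<bullet> i + 2 * h)"
  by (auto simp: near_cube_def mem_cube inner_diff_left algebra_simps)

lemma dyadic_mass_nonneg: "0 \<le> dyadic_mass g h x"
  by (simp add: dyadic_mass_def)

lemma adapted_dyadic_mass: "h > 0 \<Longrightarrow> adapted h (dyadic_mass g h)"
  by (simp add: adapted_def dyadic_mass_def near_cube_def corner_corner)

lemma ennreal_dyadic_mass:
  fixes g :: "'a::euclidean_space \<Rightarrow> ennreal"
  assumes "h > 0" and bd: "\<And>y. g y \<le> ennreal B"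
  shows "ennreal (dyadic_mass g h x) = ennreal (h powr (1 - real DIM('a))) * (\<integral>\<^sup>+y\<in>near_cube h x. g y \<partial>lborel)"
    and "dyadic_mass g h x \<le> h powr (1 - real DIM('a)) * (\<bar>B\<bar> * (3 * h) ^ DIM('a))"
proof -
  have "(\<integral>\<^sup>+y\<in>near_cube h x. g y \<partial>lborel) \<le> (\<integral>\<^sup>+y. ennreal \<bar>B\<bar> * indicator (near_cube h x) y \<partial>lborel)"
  proof (intro nn_integral_mono mult_right_mono)
    fix y show "g y \<le> ennreal \<bar>B\<bar>" using bd[of y] by (rule order_trans) (auto intro: ennreal_leI)
  qed simp
  also have "\<dots> = ennreal (\<bar>B\<bar> * (3 * h) ^ DIM('a))"
    using \<open>h > 0\<close> by (simp add: nn_integral_cmult near_cube_def emeasure_cube ennreal_mult)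
  finally have le: "(\<integral>\<^sup>+y\<in>near_cube h x. g y \<partial>lborel) \<le> ennreal (\<bar>B\<bar> * (3 * h) ^ DIM('a))" .
  then have fin: "(\<integral>\<^sup>+y\<in>near_cube h x. g y \<partial>lborel) < \<infinity>" using le_less_trans by fastforce
  show "ennreal (dyadic_mass g h x) = ennreal (h powr (1 - real DIM('a))) * (\<integral>\<^sup>+y\<in>near_cube h x. g y \<partial>lborel)"
    unfolding dyadic_mass_def using fin by (subst ennreal_mult) auto
  show "dyadic_mass g h x \<le> h powr (1 - real DIM('a)) * (\<bar>B\<bar> * (3 * h) ^ DIM('a))"
    unfolding dyadic_mass_def using enn2real_mono[OF le] \<open>h > 0\<close> by (intro mult_left_mono) auto
qed

lemma dyadic_mass_le_fractional_maximal:
  fixes g :: "'a::euclidean_space \<Rightarrow> ennreal"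
  assumes "h > 0" and bd: "\<And>y. g y \<le> ennreal B"
  shows "ennreal (dyadic_mass g h x) \<le> ennreal (3 powr (real DIM('a) - 1)) * fractional_maximal_1 g x"
proof -
  let ?a = "corner h x - h *\<^sub>R One"
  have "x \<in> near_cube h x"
    using corner_bounds[OF assms(1), of _ x] assms(1) by (force simp: mem_near_cube)
  then have mem: "(?a, 3 * h) \<in> cubes_containing x"
    using assms(1) by (simp add: cubes_containing_def near_cube_def)
  have "(case (?a, 3 * h) of (a, l) \<Rightarrow> ennreal l * average (cube a l) g) \<le> fractional_maximal_1 g x"
    unfolding fractional_maximal_1_def by (rule SUP_upper[OF mem])
  then have M: "ennreal (3 * h) * average (near_cube h x) g \<le> fractional_maximal_1 g x"
    by (simp add: near_cube_def)
  have "ennreal (3 powr (real DIM('a) - 1)) * (ennreal (3 * h) * average (near_cube h x) g) =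
    ennreal (dyadic_mass g h x)"
  proof -
    have "average (near_cube h x) g = ennreal (1 / (3 * h) ^ DIM('a)) * (\<integral>\<^sup>+y\<in>near_cube h x. g y \<partial>lborel)"
      using assms(1) by (simp add: near_cube_def average_cube divide_ennreal_def inverse_ennreal mult.commute inverse_eq_divide)
    then have "ennreal (3 powr (real DIM('a) - 1)) * (ennreal (3 * h) * average (near_cube h x) g) =
      ennreal (3 powr (real DIM('a) - 1) * (3 * h) * (1 / (3 * h) ^ DIM('a))) * (\<integral>\<^sup>+y\<in>near_cube h x. g y \<partial>lborel)"
      using assms(1) by (subst ennreal_mult_mult, simp, simp) (simp only: ennreal_mult_mult mult_nonneg_nonneg powr_ge_zero less_imp_le zero_le_numeral zero_le_divide_1_iff zero_le_power)
    also have "3 powr (real DIM('a) - 1) * (3 * h) * (1 / (3 * h) ^ DIM('a)) = h powr (1 - real DIM('a))"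
      using assms(1) by (simp add: powr_diff powr_realpow power_mult_distrib field_simps)
    finally show ?thesis by (simp add: ennreal_dyadic_mass[OF assms])
  qed
  then show ?thesis using mult_left_mono[OF M, of "ennreal (3 powr (real DIM('a) - 1))"] by simp
qed

lemma near_cube_subset:
  fixes x :: "'a::euclidean_space"
  assumes "0 < h'" "h' = h \<or> 2 * h' \<le> h" "0 < h"
  shows "near_cube h' x \<subseteq> near_cube h x"
proof (cases "h' = h")
  case False
  then have le: "2 * h' \<le> h" using assms by simp
  show ?thesis
  proof
    fix y assume y: "y \<in> near_cube h' x"
    show "y \<in> near_cube h x"
      unfolding mem_near_cube
    proof
      fix i :: 'a assume i: "i \<in> Basis"
      have "corner h' x \<bullet> i - h' \<le> y \<bullet> i" "y \<bullet> i \<le> corner h' x \<bullet> i + 2 * h'" using y i by (auto simp: mem_near_cube)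
      then show "corner h x \<bullet> i - h \<le> y \<bullet> i \<and> y \<bullet> i \<le> corner h x \<bullet> i + 2 * h"
        using corner_bounds[OF assms(1) i, of x] corner_bounds[OF assms(3) i, of x] le by linarith
    qed
  qed
qed simp

lemma mem_near_cube_imp:
  fixes x :: "'a::euclidean_space"
  assumes "0 < h" "y \<in> near_cube h x"
  shows "x \<in> cube (y - (2 * h) *\<^sub>R One) (4 * h)"
  unfolding mem_cube
proof
  fix i :: 'a assume i: "i \<in> Basis"
  have "corner h x \<bullet> i - h \<le> y \<bullet> i" "y \<bullet> i \<le> corner h x \<bullet> i + 2 * h" using assms i by (auto simp: mem_near_cube)
  then show "(y - (2 * h) *\<^sub>R One) \<bullet> i \<le> x \<bullet> i \<and> x \<bullet> i \<le> (y - (2 * h) *\<^sub>R One) \<bullet> i + 4 * h"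
    using corner_bounds[OF assms(1) i, of x] i by (simp add: inner_diff_left)
qed

text \<open>A point \<open>y\<close> contributes to the terms at those \<open>z\<close> only that lie in a cube of side \<open>4 h'\<close> about \<open>y\<close>, so
  integrating over \<open>z\<close> gains the factor \<open>h'\<^sup>n\<close> over \<open>h'\<^bsup>1-n\<^esup>\<close>.\<close>

lemma integral_cell_dyadic_mass_le:
  fixes g :: "'a::euclidean_space \<Rightarrow> ennreal"
  assumes "0 < h'" "h' = h \<or> 2 * h' \<le> h" "0 < h" and [measurable]: "g \<in> borel_measurable borel" and bd: "\<And>y. g y \<le> ennreal B"
  shows "(\<integral>\<^sup>+z\<in>cell h (corner h x). ennreal (dyadic_mass g h' z) \<partial>lborel) \<le> ennreal (4 ^ DIM('a) * h') * (\<integral>\<^sup>+y\<in>near_cube h x. g y \<partial>lborel)"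
proof -
  let ?c = "corner h x" and ?p = "h' powr (1 - real DIM('a))"
  have pm: "Measurable.pred (borel \<Otimes>\<^sub>M borel) (\<lambda>p. snd p \<in> near_cube h' (fst p))"
    unfolding mem_near_cube by measurable
  have [measurable]: "(\<lambda>(z, y). g y * indicator (near_cube h' z) y * indicator (cell h ?c) z) \<in> borel_measurable (lborel \<Otimes>\<^sub>M lborel)"
  proof -
    have [measurable]: "{p \<in> space (borel \<Otimes>\<^sub>M borel). snd p \<in> near_cube h' (fst p)} \<in> sets (borel \<Otimes>\<^sub>M borel)"
      using pm by (simp add: pred_def)
    have "(\<lambda>p. g (snd p) * indicator {p \<in> space (borel \<Otimes>\<^sub>M borel). snd p \<in> near_cube h' (fst p)} p * indicator (cell h ?c) (fst p)) \<in> borel_measurable (borel \<Otimes>\<^sub>M borel)"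
      by measurable
    moreover have "(\<lambda>p. g (snd p) * indicator {p \<in> space (borel \<Otimes>\<^sub>M borel). snd p \<in> near_cube h' (fst p)} p * indicator (cell h ?c) (fst p)) =
      (\<lambda>(z, y). g y * indicator (near_cube h' z) y * indicator (cell h ?c) z)"
      by (auto simp: indicator_def space_pair_measure fun_eq_iff)
    ultimately show ?thesis by simp
  qed
  have m1: "(\<lambda>y. g y * indicator (near_cube h' z) y) \<in> borel_measurable borel" for z by measurable
  have "(\<integral>\<^sup>+z\<in>cell h ?c. ennreal (dyadic_mass g h' z) \<partial>lborel) =
    (\<integral>\<^sup>+z. ennreal ?p * (\<integral>\<^sup>+y. g y * indicator (near_cube h' z) y * indicator (cell h ?c) z \<partial>lborel) \<partial>lborel)"
  proof (rule nn_integral_cong)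
    fix z
    have "(\<integral>\<^sup>+y. g y * indicator (near_cube h' z) y * indicator (cell h ?c) z \<partial>lborel) =
      (\<integral>\<^sup>+y\<in>near_cube h' z. g y \<partial>lborel) * indicator (cell h ?c) z"
      by (rule nn_integral_multc) (use m1 in simp)
    then show "ennreal (dyadic_mass g h' z) * indicator (cell h ?c) z =
      ennreal ?p * (\<integral>\<^sup>+y. g y * indicator (near_cube h' z) y * indicator (cell h ?c) z \<partial>lborel)"
      by (simp only: ennreal_dyadic_mass(1)[OF assms(1) bd] mult.assoc[of "ennreal ?p"])
  qed
  also have "\<dots> = ennreal ?p * (\<integral>\<^sup>+z. (\<integral>\<^sup>+y. g y * indicator (near_cube h' z) y * indicator (cell h ?c) z \<partial>lborel) \<partial>lborel)"
    by (rule nn_integral_cmult) measurable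
  also have "(\<integral>\<^sup>+z. (\<integral>\<^sup>+y. g y * indicator (near_cube h' z) y * indicator (cell h ?c) z \<partial>lborel) \<partial>lborel)
    = (\<integral>\<^sup>+y. (\<integral>\<^sup>+z. g y * indicator (near_cube h' z) y * indicator (cell h ?c) z \<partial>lborel) \<partial>lborel)"
    using lborel_pair.Fubini'[of "\<lambda>z y. g y * indicator (near_cube h' z) y * indicator (cell h ?c) z"] by simp
  also have "\<dots> \<le> (\<integral>\<^sup>+y. ennreal ((4 * h') ^ DIM('a)) * (g y * indicator (near_cube h x) y) \<partial>lborel)"
  proof (rule nn_integral_mono)
    fix y :: 'a
    have "(\<integral>\<^sup>+z. g y * indicator (near_cube h' z) y * indicator (cell h ?c) z \<partial>lborel) \<le>
      (\<integral>\<^sup>+z. (g y * indicator (near_cube h x) y) * indicator (cube (y - (2 * h') *\<^sub>R One) (4 * h')) z \<partial>lborel)"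
    proof (rule nn_integral_mono)
      fix z :: 'a
      have "y \<in> near_cube h x \<and> z \<in> cube (y - (2 * h') *\<^sub>R One) (4 * h')" if "y \<in> near_cube h' z" "z \<in> cell h ?c"
        using mem_near_cube_imp[OF assms(1) that(1)] near_cube_subset[OF assms(1,2,3), of z] that
        by (auto simp: near_cube_def cell_def)
      then show "g y * indicator (near_cube h' z) y * indicator (cell h ?c) z \<le>
        (g y * indicator (near_cube h x) y) * indicator (cube (y - (2 * h') *\<^sub>R One) (4 * h')) z"
        by (auto simp: indicator_def)
    qed
    also have "\<dots> = ennreal ((4 * h') ^ DIM('a)) * (g y * indicator (near_cube h x) y)"
      using assms(1) by (subst nn_integral_cmult) (simp_all add: emeasure_cube mult.commute)
    finally show "(\<integral>\<^sup>+z. g y * indicator (near_cube h' z) y * indicator (cell h ?c) z \<partial>lborel) \<le> ennreal ((4 * h') ^ DIM('a)) * (g y * indicator (near_cube h x) y)" .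
  qed
  also have "\<dots> = ennreal ((4 * h') ^ DIM('a)) * (\<integral>\<^sup>+y\<in>near_cube h x. g y \<partial>lborel)"
    by (rule nn_integral_cmult) measurable
  finally have "(\<integral>\<^sup>+z\<in>cell h ?c. ennreal (dyadic_mass g h' z) \<partial>lborel) \<le> ennreal ?p * (ennreal ((4 * h') ^ DIM('a)) * (\<integral>\<^sup>+y\<in>near_cube h x. g y \<partial>lborel))"
    by (simp add: mult_left_mono)
  also have "\<dots> = ennreal (?p * (4 * h') ^ DIM('a)) * (\<integral>\<^sup>+y\<in>near_cube h x. g y \<partial>lborel)"
    using assms(1) by (intro ennreal_mult_mult) auto
  also have "?p * (4 * h') ^ DIM('a) = 4 ^ DIM('a) * h'"
    using assms(1) by (simp add: powr_diff powr_realpow power_mult_distrib)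
  finally show ?thesis .
qed

text \<open>The terms of the smaller scales decay geometrically in mean, so by Chebyshev's inequality the
  term of the largest scale dominates the whole sum on half of each cell.\<close>

lemma dyadic_mass_sum_half:
  fixes g :: "'a::euclidean_space \<Rightarrow> ennreal"
  assumes "0 < h" and [measurable]: "g \<in> borel_measurable borel" and bd: "\<And>y. g y \<le> ennreal B"
  shows "ennreal ((h * 2 ^ k) ^ DIM('a) / 2) \<le>
    emeasure lborel (cell (h * 2 ^ k) (corner (h * 2 ^ k) x) \<inter>
      {z. (\<Sum>j\<le>k. dyadic_mass g (h * 2 ^ j) z) \<le> 4 * 4 ^ DIM('a) * dyadic_mass g (h * 2 ^ k) z})"
proof -
  define H where "H = h * 2 ^ k"
  have "H > 0" using assms by (simp add: H_def)
  define D where "D = cell H (corner H x)"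
  define a where "a = dyadic_mass g H x"
  define S where "S = (\<lambda>z. \<Sum>j\<le>k. dyadic_mass g (h * 2 ^ j) z)"
  define A where "A = (4 * 4 ^ DIM('a) :: real)"
  have "A > 0" by (simp add: A_def)
  have [measurable]: "D \<in> sets borel" by (simp add: D_def)
  have dm [measurable]: "dyadic_mass g (h * 2 ^ j) \<in> borel_measurable borel" for j
    using adapted_dyadic_mass[of "h * 2 ^ j" g] assms(1) by (intro adapted_measurable) auto
  have Sm [measurable]: "S \<in> borel_measurable borel" unfolding S_def by measurable
  have S0: "S z \<ge> 0" for z by (simp add: S_def sum_nonneg dyadic_mass_nonneg)
  have a0: "a \<ge> 0" by (simp add: a_def dyadic_mass_nonneg)
  have const: "dyadic_mass g H z = a" if "z \<in> D" for z
    using that by (simp add: D_def cell_def a_def dyadic_mass_def near_cube_def)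
  have H1: "H powr (real DIM('a) - 1) * H = H ^ DIM('a)" using \<open>H > 0\<close> by (simp add: powr_diff powr_realpow)
  have mass: "(\<integral>\<^sup>+y\<in>near_cube H x. g y \<partial>lborel) = ennreal (H powr (real DIM('a) - 1)) * ennreal a"
  proof -
    have "ennreal (H powr (real DIM('a) - 1)) * (ennreal (H powr (1 - real DIM('a))) * (\<integral>\<^sup>+y\<in>near_cube H x. g y \<partial>lborel))
      = ennreal (H powr (real DIM('a) - 1) * H powr (1 - real DIM('a))) * (\<integral>\<^sup>+y\<in>near_cube H x. g y \<partial>lborel)"
      by (rule ennreal_mult_mult) auto
    also have "H powr (real DIM('a) - 1) * H powr (1 - real DIM('a)) = 1"
      using \<open>H > 0\<close> by (simp flip: powr_add)
    finally show ?thesis unfolding a_def ennreal_dyadic_mass(1)[OF \<open>H > 0\<close> bd] by simp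
  qed
  have int: "(\<integral>\<^sup>+z\<in>D. ennreal (S z) \<partial>lborel) \<le> ennreal (2 * 4 ^ DIM('a) * H ^ DIM('a) * a)"
  proof -
    have "(\<integral>\<^sup>+z\<in>D. ennreal (S z) \<partial>lborel) = (\<integral>\<^sup>+z. (\<Sum>j\<le>k. ennreal (dyadic_mass g (h * 2 ^ j) z) * indicator D z) \<partial>lborel)"
      unfolding S_def by (intro nn_integral_cong) (simp add: sum_distrib_right[symmetric] dyadic_mass_nonneg)
    also have "\<dots> = (\<Sum>j\<le>k. \<integral>\<^sup>+z\<in>D. ennreal (dyadic_mass g (h * 2 ^ j) z) \<partial>lborel)"
      by (rule nn_integral_sum) measurable
    also have "\<dots> \<le> (\<Sum>j\<le>k. ennreal (4 ^ DIM('a) * (h * 2 ^ j)) * (\<integral>\<^sup>+y\<in>near_cube H x. g y \<partial>lborel))"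
    proof (rule sum_mono)
      fix j assume "j \<in> {..k}"
      then consider "j = k" | "Suc j \<le> k" by fastforce
      then have "h * 2 ^ j = H \<or> 2 * (h * 2 ^ j) \<le> H"
      proof cases
        case 2
        have "(2::real) ^ Suc j \<le> 2 ^ k" using 2 by (intro power_increasing) auto
        then show ?thesis using assms(1) by (simp add: H_def)
      qed (simp add: H_def)
      then show "(\<integral>\<^sup>+z\<in>D. ennreal (dyadic_mass g (h * 2 ^ j) z) \<partial>lborel) \<le> ennreal (4 ^ DIM('a) * (h * 2 ^ j)) * (\<integral>\<^sup>+y\<in>near_cube H x. g y \<partial>lborel)"
        unfolding D_def using assms(1) \<open>H > 0\<close> by (intro integral_cell_dyadic_mass_le[OF _ _ _ assms(2) bd]) auto
    qed
    also have "\<dots> = ennreal (\<Sum>j\<le>k. 4 ^ DIM('a) * (h * 2 ^ j)) * (\<integral>\<^sup>+y\<in>near_cube H x. g y \<partial>lborel)"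
      using assms(1) by (simp add: sum_distrib_right[symmetric])
    also have "\<dots> \<le> ennreal (4 ^ DIM('a) * (2 * H)) * (\<integral>\<^sup>+y\<in>near_cube H x. g y \<partial>lborel)"
    proof (intro mult_right_mono ennreal_leI)
      have "(\<Sum>j\<le>k. 2 ^ j) \<le> (2 * 2 ^ k :: real)"
        by (induction k) auto
      then have "h * (\<Sum>j\<le>k. 2 ^ j) \<le> h * (2 * 2 ^ k)" using assms(1) by (intro mult_left_mono) auto
      moreover have "(\<Sum>j\<le>k. 4 ^ DIM('a) * (h * 2 ^ j)) = 4 ^ DIM('a) * (h * (\<Sum>j\<le>k. 2 ^ j))"
        by (simp only: sum_distrib_left)
      moreover have "4 ^ DIM('a) * (2 * H) = 4 ^ DIM('a) * (h * (2 * 2 ^ k))" by (simp add: H_def)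
      ultimately show "(\<Sum>j\<le>k. 4 ^ DIM('a) * (h * 2 ^ j)) \<le> 4 ^ DIM('a) * (2 * H)"
        by (simp only: mult_left_mono zero_le_power zero_le_numeral)
    qed simp
    also have "\<dots> = ennreal (2 * 4 ^ DIM('a) * H ^ DIM('a) * a)"
    proof -
      have e: "4 ^ DIM('a) * (2 * H) * H powr (real DIM('a) - 1) = 2 * 4 ^ DIM('a) * H ^ DIM('a)"
        unfolding H1[symmetric] by simp
      have "ennreal (4 ^ DIM('a) * (2 * H)) * (ennreal (H powr (real DIM('a) - 1)) * ennreal a) = ennreal (2 * 4 ^ DIM('a) * H ^ DIM('a)) * ennreal a"
        unfolding e[symmetric] using \<open>H > 0\<close> by (intro ennreal_mult_mult) auto
      then show ?thesis unfolding mass using \<open>H > 0\<close> a0 by (simp add: ennreal_mult'')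
    qed
    finally show ?thesis .
  qed
  define bad where "bad = {z\<in>D. A * a < S z}"
  have [measurable]: "bad \<in> sets borel" unfolding bad_def by measurable
  have bad_le: "emeasure lborel bad \<le> ennreal (H ^ DIM('a) / 2)"
  proof (cases "a = 0")
    case True
    then have "(\<integral>\<^sup>+z\<in>D. ennreal (S z) \<partial>lborel) = 0" using int by simp
    then have "AE z in lborel. ennreal (S z) * indicator D z = 0" by (subst (asm) nn_integral_0_iff_AE) auto
    then have "AE z in lborel. z \<notin> bad"
      by eventually_elim (auto simp: bad_def True indicator_def split: if_splits)
    then have "emeasure lborel bad = 0" using AE_iff_measurable[of bad lborel "\<lambda>z. z \<notin> bad"] by simp
    then show ?thesis by simp
  next
    case False
    then have "a > 0" using a0 by simp
    have "ennreal (A * a) * emeasure lborel bad = (\<integral>\<^sup>+z. ennreal (A * a) * indicator bad z \<partial>lborel)"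
      by (simp add: nn_integral_cmult)
    also have "\<dots> \<le> (\<integral>\<^sup>+z\<in>D. ennreal (S z) \<partial>lborel)"
      by (intro nn_integral_mono) (auto simp: indicator_def bad_def intro!: ennreal_leI)
    also note int
    also have "2 * 4 ^ DIM('a) * H ^ DIM('a) * a = A * a * (H ^ DIM('a) / 2)" by (simp add: A_def)
    finally have "ennreal (1 / (A * a)) * (ennreal (A * a) * emeasure lborel bad) \<le> ennreal (1 / (A * a)) * ennreal (A * a * (H ^ DIM('a) / 2))"
      by (rule mult_left_mono) simp
    moreover have "ennreal (1 / (A * a)) * (ennreal (A * a) * emeasure lborel bad) = emeasure lborel bad"
      using \<open>a > 0\<close> \<open>A > 0\<close> by (subst ennreal_mult_mult) auto
    moreover have "ennreal (1 / (A * a)) * ennreal (A * a * (H ^ DIM('a) / 2)) = ennreal (H ^ DIM('a) / 2)"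
      using \<open>a > 0\<close> \<open>A > 0\<close> \<open>H > 0\<close> by (subst ennreal_mult[symmetric]) auto
    ultimately show ?thesis by simp
  qed
  define good where "good = D \<inter> {z. S z \<le> A * dyadic_mass g H z}"
  have [measurable]: "good \<in> sets borel" unfolding good_def H_def by measurable
  have "D = good \<union> bad" by (auto simp: good_def bad_def const not_le)
  then have "ennreal (H ^ DIM('a)) \<le> emeasure lborel good + emeasure lborel bad"
    using emeasure_cell[OF \<open>H > 0\<close>, of x] emeasure_subadditive[of good lborel bad] by (simp add: D_def)
  also have "\<dots> \<le> emeasure lborel good + ennreal (H ^ DIM('a) / 2)" using bad_le by (rule add_left_mono)
  also have "ennreal (H ^ DIM('a)) = ennreal (H ^ DIM('a) / 2) + ennreal (H ^ DIM('a) / 2)"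
    using \<open>H > 0\<close> by (subst ennreal_plus[symmetric]) auto
  finally have "ennreal (H ^ DIM('a) / 2) \<le> emeasure lborel good"
    by (simp add: add.commute[of "emeasure lborel good"])
  then show ?thesis by (simp add: good_def D_def S_def A_def H_def)
qed

lemma adapted_set_measurable:
  assumes "adapted h (\<lambda>x. x \<in> F)"
  shows "F \<in> sets (borel :: 'a::euclidean_space measure)"
proof -
  have "adapted h (indicator F :: 'a \<Rightarrow> real)" using assms by (simp add: adapted_def indicator_def)
  from adapted_measurable[OF this] show ?thesis by (simp add: borel_measurable_indicator_iff)
qed

lemma last_true_before:
  fixes P :: "nat \<Rightarrow> bool"
  assumes "P 0" "\<not> P k"
  shows "\<exists>j<k. P j \<and> \<not> P (Suc j)"
  using assms(2)
proof (induction k)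
  case (Suc k)
  show ?case
  proof (cases "P k")
    case True
    then show ?thesis using Suc.prems by blast
  next
    case False
    then show ?thesis using Suc.IH less_SucI by blast
  qed
qed (use assms(1) in simp)

text \<open>Induction on the scale \<open>k\<close>. On the set where the sum is at most \<open>A\<close> times its top term \<open>a\<^sub>k\<close> that
  term is charged to \<open>Nf\<close>. The remaining points are sorted by the largest scale \<open>j < k\<close> at which the partial
  sum from \<open>k\<close> down to \<open>j\<close> exceeds \<open>A a\<^sub>k\<close>: the terms above \<open>j\<close> are again at most \<open>A a\<^sub>k\<close> there, and
  the terms up to \<open>j\<close> are handled by the induction hypothesis. Since these sets are disjoint the constant
  does not grow.\<close>

lemma sum_adapted_le_maximal:
  fixes a :: "nat \<Rightarrow> 'a::euclidean_space \<Rightarrow> real" and v Nf :: "'a \<Rightarrow> ennreal"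
  assumes "h > 0" and ad: "\<And>j. adapted (h * 2 ^ j) (a j)" and a0: "\<And>j x. 0 \<le> a j x" and "A \<ge> 1"
    and [measurable]: "v \<in> borel_measurable borel" "Nf \<in> borel_measurable borel"
    and Nf: "\<And>j x. j \<le> N \<Longrightarrow> ennreal (a j x) \<le> Nf x"
    and cmp: "\<And>k \<phi>. k \<le> N \<Longrightarrow> adapted (h * 2 ^ k) \<phi> \<Longrightarrow>
      (\<integral>\<^sup>+x. \<phi> x * v x \<partial>lborel) \<le> C * (\<integral>\<^sup>+x\<in>{x. (\<Sum>j\<le>k. a j x) \<le> A * a k x}. \<phi> x * v x \<partial>lborel)"
    and "k \<le> N" "adapted (h * 2 ^ k) (\<lambda>x. x \<in> F)"
  shows "(\<integral>\<^sup>+x\<in>F. ennreal (\<Sum>j\<le>k. a j x) * v x \<partial>lborel) \<le> ennreal A * C * (\<integral>\<^sup>+x\<in>F. Nf x * v x \<partial>lborel)"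
  using \<open>k \<le> N\<close> \<open>adapted (h * 2 ^ k) (\<lambda>x. x \<in> F)\<close>
proof (induction k arbitrary: F rule: less_induct)
  case (less k)
  have am [measurable]: "a j \<in> borel_measurable borel" for j by (rule adapted_measurable[OF ad])
  have Fm [measurable]: "F \<in> sets borel" by (rule adapted_set_measurable[OF less.prems(2)])
  define T where "T = (\<lambda>j x. \<Sum>i\<in>{j..k}. a i x)"
  have Tm [measurable]: "T j \<in> borel_measurable borel" for j unfolding T_def by measurable
  have T0: "(\<Sum>j\<le>k. a j x) = T 0 x" for x by (simp add: T_def atMost_atLeast0)
  have Tk: "T k x = a k x" for x by (simp add: T_def)
  have Tmono: "T j x \<le> T i x" if "i \<le> j" for i j x
    unfolding T_def using that a0 by (intro sum_mono2) auto
  have Tsplit: "T 0 x = (\<Sum>i\<le>j. a i x) + T (Suc j) x" if lt: "j < k" for j x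
  proof -
    obtain p where "k = j + p" using le_Suc_ex[OF less_imp_le[OF lt]] by blast
    then show ?thesis using sum.ub_add_nat[of 0 j "\<lambda>i. a i x" p] by (simp add: T_def atMost_atLeast0)
  qed
  define E where "E = {x. T 0 x \<le> A * a k x}"
  \<comment> \<open>The points of \<open>F\<close> for which \<open>j\<close> is the stopping scale.\<close>
  define Fj where "Fj = (\<lambda>j. {x\<in>F. A * a k x < T j x \<and> T (Suc j) x \<le> A * a k x})"
  have [measurable]: "E \<in> sets borel" unfolding E_def by measurable
  have Fjm [measurable]: "Fj j \<in> sets borel" for j unfolding Fj_def by measurable
  have Fjad: "adapted (h * 2 ^ j) (\<lambda>x. x \<in> Fj j)" if "j < k" for j
  proof -
    have al: "a l (corner (h * 2 ^ j) x) = a l x" if "j \<le> l" for l x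
      using adapted_finer[OF \<open>h > 0\<close> ad that] by (simp add: adapted_def)
    have "T i (corner (h * 2 ^ j) x) = T i x" if "j \<le> i" for i x
      unfolding T_def using that al by (intro sum.cong) auto
    moreover have "corner (h * 2 ^ j) x \<in> F \<longleftrightarrow> x \<in> F" for x
      using adapted_finer[OF \<open>h > 0\<close> less.prems(2) less_imp_le[OF \<open>j < k\<close>]] by (simp add: adapted_def)
    ultimately show ?thesis using al[of k] \<open>j < k\<close> by (simp add: adapted_def Fj_def)
  qed
  have point: "ennreal (T 0 x) * indicator F x \<le> ennreal A * (ennreal (a k x) * indicator F x) + (\<Sum>j<k. ennreal (\<Sum>i\<le>j. a i x) * indicator (Fj j) x)" for x
  proof (cases "x \<in> F \<and> x \<notin> E")
    case True
    have "\<exists>j<k. A * a k x < T j x \<and> \<not> A * a k x < T (Suc j) x"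
      using True a0[of k x] \<open>A \<ge> 1\<close> mult_right_mono[of 1 A "a k x"]
      by (intro last_true_before) (auto simp: E_def Tk)
    then obtain j where j: "j < k" "A * a k x < T j x" "T (Suc j) x \<le> A * a k x" by auto
    have "T 0 x \<le> A * a k x + (\<Sum>i\<le>j. a i x)" using Tsplit[OF j(1), of x] j by simp
    then have "ennreal (T 0 x) \<le> ennreal A * ennreal (a k x) + ennreal (\<Sum>i\<le>j. a i x)"
      using a0 \<open>A \<ge> 1\<close> by (simp add: ennreal_leI sum_nonneg flip: ennreal_mult ennreal_plus)
    also have "ennreal (\<Sum>i\<le>j. a i x) = ennreal (\<Sum>i\<le>j. a i x) * indicator (Fj j) x" using j True by (simp add: Fj_def)
    also have "\<dots> \<le> (\<Sum>j<k. ennreal (\<Sum>i\<le>j. a i x) * indicator (Fj j) x)"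
      using j(1) by (intro member_le_sum) auto
    finally show ?thesis using True by (simp add: add_left_mono)
  next
    case False
    then have "ennreal (T 0 x) * indicator F x \<le> ennreal A * (ennreal (a k x) * indicator F x)"
      using a0 \<open>A \<ge> 1\<close> by (auto simp: E_def indicator_def ennreal_leI simp flip: ennreal_mult)
    then show ?thesis by (simp add: add_increasing2)
  qed
  have disj: "indicator (F \<inter> E) x + (\<Sum>j<k. indicator (Fj j) x) \<le> (indicator F x :: ennreal)" for x
  proof (cases "\<exists>j<k. x \<in> Fj j")
    case True
    then obtain j where j: "j < k" "x \<in> Fj j" by blast
    have uniq: "i = j" if "x \<in> Fj i" for i
    proof (rule ccontr)
      assume "i \<noteq> j"
      then consider "Suc i \<le> j" | "Suc j \<le> i" by linarith
      then show False
        using Tmono[of "Suc i" j x] Tmono[of "Suc j" i x] that j(2) by cases (auto simp: Fj_def)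
    qed
    have "x \<notin> E" using Tmono[of 0 j x] j(2) by (auto simp: E_def Fj_def)
    moreover have "(\<Sum>l<k. indicator (Fj l) x) = (\<Sum>l<k. if l = j then 1 else 0 :: ennreal)"
    proof (intro sum.cong refl)
      fix l
      show "indicator (Fj l) x = (if l = j then 1 else 0 :: ennreal)"
        using uniq[of l] j(2) by (cases "l = j") (auto simp: indicator_def)
    qed
    ultimately show ?thesis using j by (simp add: Fj_def)
  next
    case False
    then have "(\<Sum>j<k. indicator (Fj j) x) = (0::ennreal)" by (intro sum.neutral) (auto simp: indicator_def)
    then show ?thesis by (simp add: indicator_def)
  qed
  have IH: "(\<integral>\<^sup>+x\<in>Fj j. ennreal (\<Sum>i\<le>j. a i x) * v x \<partial>lborel) \<le> ennreal A * C * (\<integral>\<^sup>+x\<in>Fj j. Nf x * v x \<partial>lborel)" if "j < k" for j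
    using less.IH[OF that _ Fjad[OF that]] less.prems(1) that by simp
  have "(\<integral>\<^sup>+x\<in>F. ennreal (\<Sum>j\<le>k. a j x) * v x \<partial>lborel) \<le>
    (\<integral>\<^sup>+x. ennreal A * (ennreal (a k x) * indicator F x * v x) + (\<Sum>j<k. ennreal (\<Sum>i\<le>j. a i x) * v x * indicator (Fj j) x) \<partial>lborel)"
  proof (rule nn_integral_mono)
    fix x
    have "ennreal (\<Sum>j\<le>k. a j x) * v x * indicator F x = ennreal (T 0 x) * indicator F x * v x"
      by (simp add: T0 mult_ac)
    also have "\<dots> \<le> (ennreal A * (ennreal (a k x) * indicator F x) + (\<Sum>j<k. ennreal (\<Sum>i\<le>j. a i x) * indicator (Fj j) x)) * v x"
      by (intro mult_right_mono point) simp
    also have "\<dots> = ennreal A * (ennreal (a k x) * indicator F x * v x) + (\<Sum>j<k. ennreal (\<Sum>i\<le>j. a i x) * v x * indicator (Fj j) x)"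
      unfolding distrib_right sum_distrib_right by (simp only: mult_ac)
    finally show "ennreal (\<Sum>j\<le>k. a j x) * v x * indicator F x \<le> ennreal A * (ennreal (a k x) * indicator F x * v x) + (\<Sum>j<k. ennreal (\<Sum>i\<le>j. a i x) * v x * indicator (Fj j) x)" .
  qed
  also have "\<dots> = ennreal A * (\<integral>\<^sup>+x. ennreal (a k x) * indicator F x * v x \<partial>lborel) + (\<Sum>j<k. \<integral>\<^sup>+x\<in>Fj j. ennreal (\<Sum>i\<le>j. a i x) * v x \<partial>lborel)"
    by (subst nn_integral_add, measurable, subst nn_integral_cmult, measurable, subst nn_integral_sum, measurable)
  also have "\<dots> \<le> ennreal A * (C * (\<integral>\<^sup>+x\<in>F \<inter> E. Nf x * v x \<partial>lborel)) + (\<Sum>j<k. ennreal A * C * (\<integral>\<^sup>+x\<in>Fj j. Nf x * v x \<partial>lborel))"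
  proof (intro add_mono mult_left_mono sum_mono)
    have "adapted (h * 2 ^ k) (\<lambda>x. ennreal (a k x) * indicator F x)"
      using ad[of k] less.prems(2) by (simp add: adapted_def indicator_def)
    from cmp[OF less.prems(1) this]
    have "(\<integral>\<^sup>+x. ennreal (a k x) * indicator F x * v x \<partial>lborel) \<le> C * (\<integral>\<^sup>+x\<in>E. ennreal (a k x) * indicator F x * v x \<partial>lborel)"
      by (simp only: E_def T0)
    also have "\<dots> \<le> C * (\<integral>\<^sup>+x\<in>F \<inter> E. Nf x * v x \<partial>lborel)"
      using Nf[OF less.prems(1)] by (intro mult_left_mono nn_integral_mono) (auto simp: indicator_def intro!: mult_right_mono)
    finally show "(\<integral>\<^sup>+x. ennreal (a k x) * indicator F x * v x \<partial>lborel) \<le> C * (\<integral>\<^sup>+x\<in>F \<inter> E. Nf x * v x \<partial>lborel)" .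
  qed (use IH in auto)
  also have "\<dots> = ennreal A * C * (\<integral>\<^sup>+x. Nf x * v x * (indicator (F \<inter> E) x + (\<Sum>j<k. indicator (Fj j) x)) \<partial>lborel)"
    by (simp add: distrib_left sum_distrib_left nn_integral_add nn_integral_sum mult.assoc)
  also have "\<dots> \<le> ennreal A * C * (\<integral>\<^sup>+x. Nf x * v x * indicator F x \<partial>lborel)"
    by (intro mult_left_mono nn_integral_mono disj) auto
  finally show ?case .
qed

section \<open>Passing to powers\<close>

lemma powr_diff_le_deriv:
  fixes x y p :: real
  assumes "1 \<le> p" "0 \<le> x" "x \<le> y"
  shows "y powr p - x powr p \<le> p * (y - x) * y powr (p - 1)"
proof (cases "x = 0 \<or> x = y")
  case True
  have "y * y powr (p - 1) = y powr p" using assms by (cases "y = 0") (auto simp: powr_diff)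
  then have "1 * y powr p \<le> p * (y * y powr (p - 1))" using assms mult_right_mono[of 1 p "y powr p"] by simp
  then show ?thesis using True assms by (auto simp: mult.assoc)
next
  case False
  then have xy: "0 < x" "x < y" using assms by auto
  obtain z where z: "x < z" "z < y" "y powr p - x powr p = (y - x) * (p * z powr (p - 1))"
    using MVT2[OF xy(2), of "\<lambda>t. t powr p" "\<lambda>t. p * t powr (p - 1)"] xy
    by (metis (no_types, lifting) has_real_derivative_powr order_less_le_trans)
  have "(y - x) * (p * z powr (p - 1)) \<le> (y - x) * (p * y powr (p - 1))"
    using z xy assms by (intro mult_left_mono powr_mono2) auto
  then show ?thesis using z(3) by (simp add: mult_ac)
qed

lemma powr_concave_on:
  assumes "0 < p" "p \<le> 1"
  shows "concave_on {0<..} (\<lambda>x::real. x powr p)"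
proof (rule f''_le0_imp_concave)
  fix x :: real assume "x \<in> {0<..}"
  then have "x > 0" by simp
  show "((\<lambda>x. x powr p) has_real_derivative p * x powr (p - 1)) (at x)"
    using \<open>x > 0\<close> by (rule has_real_derivative_powr)
  show "((\<lambda>x. p * x powr (p - 1)) has_real_derivative p * ((p - 1) * x powr (p - 1 - 1))) (at x)"
    using \<open>x > 0\<close> by (intro DERIV_cmult has_real_derivative_powr)
  show "p * ((p - 1) * x powr (p - 1 - 1)) \<le> 0"
    using assms by (intro mult_nonneg_nonpos mult_nonpos_nonneg) auto
qed simp

text \<open>For \<open>p \<le> 1\<close> this is concavity of the power. For \<open>p \<ge> 1\<close> the increment on the left is
  at most a multiple of \<open>a (b + a)\<^bsup>p-1\<^esup>\<close> by the mean value theorem, and this is at most the other increment.\<close>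

lemma powr_increment_dominated:
  fixes a b s A p :: real
  assumes "0 < p" "1 \<le> A" "0 \<le> a" "0 \<le> b" "0 \<le> s" "s \<le> A * a"
  shows "(b + s) powr p - b powr p \<le> max A (p * A powr p) * ((b + a) powr p - b powr p)"
proof -
  have pos: "0 \<le> (b + a) powr p - b powr p" using assms by (simp add: powr_mono2)
  have "(b + s) powr p \<le> (b + A * a) powr p" using assms by (intro powr_mono2) auto
  moreover have "(b + A * a) powr p - b powr p \<le> max A (p * A powr p) * ((b + a) powr p - b powr p)"
  proof (cases "p \<le> 1")
    case True
    have "(b + A * a) powr p - b powr p \<le> A * ((b + a) powr p - b powr p)"
    proof (cases "b = 0")
      case True
      have "A powr p \<le> A powr 1" using \<open>p \<le> 1\<close> assms by (intro powr_mono) auto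
      then have "A powr p * a powr p \<le> A * a powr p" using assms by (intro mult_right_mono) auto
      then show ?thesis using True assms by (simp add: powr_mult)
    next
      case False
      have cv: "(1 - 1/A) * b powr p + (1/A) * (b + A * a) powr p \<le> ((1 - 1/A) *\<^sub>R b + (1/A) *\<^sub>R (b + A * a)) powr p"
        using assms False by (intro concave_onD[OF powr_concave_on[OF \<open>0 < p\<close> \<open>p \<le> 1\<close>]]) (auto simp: add_pos_nonneg)
      have "(1 - 1/A) *\<^sub>R b + (1/A) *\<^sub>R (b + A * a) = b + a" using assms by (simp add: field_simps)
      with cv have "A * ((1 - 1/A) * b powr p + (1/A) * (b + A * a) powr p) \<le> A * (b + a) powr p"
        using assms by (intro mult_left_mono) auto
      moreover have "A * ((1 - 1/A) * b powr p + (1/A) * (b + A * a) powr p) = (A - 1) * b powr p + (b + A * a) powr p"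
        using assms by (simp add: field_simps)
      ultimately show ?thesis by (simp add: algebra_simps)
    qed
    also have "\<dots> \<le> max A (p * A powr p) * ((b + a) powr p - b powr p)" using pos by (intro mult_right_mono) auto
    finally show ?thesis .
  next
    case False
    then have p: "1 \<le> p" by simp
    have "(b + A * a) powr p - b powr p \<le> p * (b + A * a - b) * (b + A * a) powr (p - 1)"
      using p assms by (intro powr_diff_le_deriv) auto
    also have "\<dots> \<le> p * (b + A * a - b) * (A * (b + a)) powr (p - 1)"
      using p assms mult_right_mono[of 1 A b] by (intro mult_left_mono powr_mono2) (auto simp: distrib_left)
    also have "\<dots> = p * A powr p * (a * (b + a) powr (p - 1))"
      using assms by (simp add: powr_mult powr_diff)
    also have "\<dots> \<le> p * A powr p * ((b + a) powr p - b powr p)"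
    proof (intro mult_left_mono)
      have "b * b powr (p - 1) = b powr p" "(b + a) * (b + a) powr (p - 1) = (b + a) powr p"
        using assms by (auto simp: powr_diff)
      moreover have "b * b powr (p - 1) \<le> b * (b + a) powr (p - 1)"
        using p assms by (intro mult_left_mono powr_mono2) auto
      ultimately show "a * (b + a) powr (p - 1) \<le> (b + a) powr p - b powr p" by (simp add: distrib_right)
    qed (use p in auto)
    also have "\<dots> \<le> max A (p * A powr p) * ((b + a) powr p - b powr p)" using pos by (intro mult_right_mono) auto
    finally show ?thesis .
  qed
  ultimately show ?thesis by linarith
qed

text \<open>The increments of the powers \<open>(a\<^sub>j + \<dots> + a\<^sub>N)\<^sup>p\<close> again form an adapted sequence that is
  controlled by its top term on the same sets, so the linear estimate applies to them. For \<open>p > 1\<close> it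
  bounds the integral of \<open>S\<^sup>p\<close> by that of \<open>Nf S\<^bsup>p-1\<^esup>\<close>, from which \<open>S\<^sup>p\<close> is absorbed; this is
  where the finiteness assumption enters.\<close>

lemma powr_sum_adapted_le_maximal:
  fixes a :: "nat \<Rightarrow> 'a::euclidean_space \<Rightarrow> real" and v :: "'a \<Rightarrow> ennreal" and Nf :: "'a \<Rightarrow> real"
  assumes "h > 0" and ad: "\<And>j. adapted (h * 2 ^ j) (a j)" and a0: "\<And>j x. 0 \<le> a j x" and "A \<ge> 1"
    and [measurable]: "v \<in> borel_measurable borel" "Nf \<in> borel_measurable borel"
    and Nf: "\<And>j x. j \<le> N \<Longrightarrow> a j x \<le> Nf x"
    and cmp: "\<And>k \<phi>. k \<le> N \<Longrightarrow> adapted (h * 2 ^ k) \<phi> \<Longrightarrow>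
      (\<integral>\<^sup>+x. \<phi> x * v x \<partial>lborel) \<le> ennreal C * (\<integral>\<^sup>+x\<in>{x. (\<Sum>j\<le>k. a j x) \<le> A * a k x}. \<phi> x * v x \<partial>lborel)"
    and F: "adapted (h * 2 ^ N) (\<lambda>x. x \<in> F)" and "0 < p" "0 < C"
    and fin: "(\<integral>\<^sup>+x\<in>F. ennreal ((\<Sum>j\<le>N. a j x) powr p) * v x \<partial>lborel) < \<infinity>"
  shows "(\<integral>\<^sup>+x\<in>F. ennreal ((\<Sum>j\<le>N. a j x) powr p) * v x \<partial>lborel) \<le>
    ennreal (max A (p * A powr p) * C + (2 * (max A (p * A powr p) * C * p)) powr p) * (\<integral>\<^sup>+x\<in>F. ennreal (Nf x powr p) * v x \<partial>lborel)"
proof -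
  define A' where "A' = max A (p * A powr p)"
  have A': "A' \<ge> 1" using \<open>A \<ge> 1\<close> by (simp add: A'_def)
  have am [measurable]: "a j \<in> borel_measurable borel" for j by (rule adapted_measurable[OF ad])
  have Fm [measurable]: "F \<in> sets borel" by (rule adapted_set_measurable[OF F])
  define S where "S = (\<lambda>j x. \<Sum>i\<in>{j..N}. a i x)"
  have Sm [measurable]: "S j \<in> borel_measurable borel" for j unfolding S_def by measurable
  have S0: "(\<Sum>j\<le>N. a j x) = S 0 x" for x by (simp add: S_def atMost_atLeast0)
  have Snn: "0 \<le> S j x" for j x by (simp add: S_def sum_nonneg a0)
  have Santi: "S j x \<le> S i x" if "i \<le> j" for i j x
    unfolding S_def using that a0 by (intro sum_mono2) auto
  have Sstep: "S j x = S (Suc j) x + a j x" if "j \<le> N" for j x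
    using that sum.atLeast_Suc_atMost[of j N "\<lambda>i. a i x"] by (simp add: S_def)
  have Stop: "S (Suc N) x = 0" for x by (simp add: S_def)
  have Nf0: "0 \<le> Nf x" for x using a0[of 0 x] Nf[of 0 x] by simp
  define a' where "a' = (\<lambda>j x. S j x powr p - S (Suc j) x powr p)"
  have tele: "(\<Sum>j\<le>k. a' j x) = S 0 x powr p - S (Suc k) x powr p" for k x
    by (induction k) (auto simp: a'_def)
  have a'0: "0 \<le> a' j x" for j x
    unfolding a'_def using Santi[of j "Suc j" x] Snn \<open>0 < p\<close> by (simp add: powr_mono2)
  have a'ad: "adapted (h * 2 ^ j) (a' j)" for j
  proof -
    have "S i (corner (h * 2 ^ j) x) = S i x" if "j \<le> i" for i x
      unfolding S_def using that adapted_finer[OF \<open>h > 0\<close> ad] by (intro sum.cong) (auto simp: adapted_def)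
    then show ?thesis by (simp add: adapted_def a'_def)
  qed
  have a'le: "a' j x \<le> (if p \<le> 1 then Nf x powr p else p * (Nf x * S 0 x powr (p - 1)))" if "j \<le> N" for j x
  proof (cases "p \<le> 1")
    case True
    have "a' j x \<le> a j x powr p"
      unfolding a'_def Sstep[OF that] using powr_add_le_add_powr[of "S (Suc j) x" "a j x" p] Snn a0 True \<open>0 < p\<close> by simp
    also have "\<dots> \<le> Nf x powr p" using Nf[OF that] a0 \<open>0 < p\<close> by (intro powr_mono2) auto
    finally show ?thesis using True by simp
  next
    case False
    have "a' j x \<le> p * (S j x - S (Suc j) x) * S j x powr (p - 1)"
      unfolding a'_def using False Santi[of j "Suc j" x] Snn by (intro powr_diff_le_deriv) auto
    also have "\<dots> = p * (a j x * S j x powr (p - 1))" by (simp add: Sstep[OF that])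
    also have "\<dots> \<le> p * (Nf x * S 0 x powr (p - 1))"
      using Nf[OF that] a0 Nf0 False Santi[of 0 j x] Snn by (intro mult_left_mono mult_mono powr_mono2) auto
    finally show ?thesis using False by simp
  qed
  have cmp': "(\<integral>\<^sup>+x. \<phi> x * v x \<partial>lborel) \<le> ennreal C * (\<integral>\<^sup>+x\<in>{x. (\<Sum>j\<le>k. a' j x) \<le> A' * a' k x}. \<phi> x * v x \<partial>lborel)"
    if k: "k \<le> N" "adapted (h * 2 ^ k) \<phi>" for k \<phi>
  proof (rule order_trans[OF cmp[OF k]])
    have "(\<Sum>j\<le>k. a' j x) \<le> A' * a' k x" if "(\<Sum>j\<le>k. a j x) \<le> A * a k x" for x
    proof -
      have S0k: "S 0 x = S (Suc k) x + (\<Sum>j\<le>k. a j x)"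
      proof -
        obtain q where "N = k + q" using le_Suc_ex[OF k(1)] by blast
        then show ?thesis using sum.ub_add_nat[of 0 k "\<lambda>i. a i x" q] by (simp add: S_def atMost_atLeast0)
      qed
      show ?thesis
        unfolding tele unfolding a'_def A'_def S0k Sstep[OF k(1)]
        using that \<open>0 < p\<close> \<open>A \<ge> 1\<close> a0 Snn by (intro powr_increment_dominated) (auto simp: sum_nonneg)
    qed
    then show "ennreal C * (\<integral>\<^sup>+x\<in>{x. (\<Sum>j\<le>k. a j x) \<le> A * a k x}. \<phi> x * v x \<partial>lborel) \<le>
      ennreal C * (\<integral>\<^sup>+x\<in>{x. (\<Sum>j\<le>k. a' j x) \<le> A' * a' k x}. \<phi> x * v x \<partial>lborel)"
      by (intro mult_left_mono nn_integral_mono) (auto simp: indicator_def)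
  qed
  define Q where "Q = (\<lambda>x. ennreal (if p \<le> 1 then Nf x powr p else p * (Nf x * S 0 x powr (p - 1))))"
  have [measurable]: "Q \<in> borel_measurable borel" unfolding Q_def by measurable
  define X where "X = (\<integral>\<^sup>+x\<in>F. ennreal (S 0 x powr p) * v x \<partial>lborel)"
  define Y where "Y = (\<integral>\<^sup>+x\<in>F. ennreal (Nf x powr p) * v x \<partial>lborel)"
  have XQ: "X \<le> ennreal (A' * C) * (\<integral>\<^sup>+x\<in>F. Q x * v x \<partial>lborel)"
  proof -
    have "(\<integral>\<^sup>+x\<in>F. ennreal (\<Sum>j\<le>N. a' j x) * v x \<partial>lborel) \<le> ennreal A' * ennreal C * (\<integral>\<^sup>+x\<in>F. Q x * v x \<partial>lborel)"
    proof (rule sum_adapted_le_maximal[OF \<open>h > 0\<close> a'ad a'0 A' _ _ _ cmp' order_refl F])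
      show "ennreal (a' j x) \<le> Q x" if "j \<le> N" for j x
        unfolding Q_def by (intro ennreal_leI a'le that)
    qed auto
    moreover have "(\<Sum>j\<le>N. a' j x) = S 0 x powr p" for x by (simp add: tele Stop)
    moreover have "ennreal A' * ennreal C = ennreal (A' * C)" using A' \<open>0 < C\<close> by (simp add: ennreal_mult)
    ultimately show ?thesis by (simp add: X_def)
  qed
  have "X \<le> ennreal (A' * C + (2 * (A' * C * p)) powr p) * Y"
  proof (cases "p \<le> 1")
    case True
    then have "X \<le> ennreal (A' * C) * Y" using XQ by (simp add: Q_def Y_def)
    also have "\<dots> \<le> ennreal (A' * C + (2 * (A' * C * p)) powr p) * Y"
      by (intro mult_right_mono ennreal_leI) auto
    finally show ?thesis .
  next
    case False
    define M where "M = A' * C * p"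
    have "M > 0" using A' \<open>0 < C\<close> \<open>0 < p\<close> by (simp add: M_def)
    define L where "L = (2 * M) powr p"
    have L0: "L \<ge> 0" by (simp add: L_def)
    have young: "M * (Nf x * S 0 x powr (p - 1)) \<le> S 0 x powr p / 2 + L * Nf x powr p / 2" for x
    proof (cases "2 * M * Nf x \<le> S 0 x")
      case True
      have "M * (Nf x * S 0 x powr (p - 1)) = (2 * M * Nf x) * S 0 x powr (p - 1) / 2" by simp
      also have "\<dots> \<le> S 0 x * S 0 x powr (p - 1) / 2" using True by (intro divide_right_mono mult_right_mono) auto
      also have "S 0 x * S 0 x powr (p - 1) = S 0 x powr p" using Snn[of 0 x] by (cases "S 0 x = 0") (auto simp: powr_diff)
      finally show ?thesis using L0 by (simp add: add_increasing2)
    next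
      case False
      have "M * (Nf x * S 0 x powr (p - 1)) \<le> M * (Nf x * (2 * M * Nf x) powr (p - 1))"
        using False \<open>\<not> p \<le> 1\<close> \<open>M > 0\<close> Nf0 Snn by (intro mult_left_mono powr_mono2) auto
      also have "\<dots> = (2 * M * Nf x) * (2 * M * Nf x) powr (p - 1) / 2" by simp
      also have "(2 * M * Nf x) * (2 * M * Nf x) powr (p - 1) = (2 * M * Nf x) powr p"
        using \<open>M > 0\<close> Nf0[of x] by (cases "Nf x = 0") (auto simp: powr_diff)
      also have "\<dots> = L * Nf x powr p" unfolding L_def using \<open>M > 0\<close> Nf0 by (simp add: powr_mult)
      finally show ?thesis by (simp add: add_increasing)
    qed
    have "ennreal (A' * C) * (\<integral>\<^sup>+x\<in>F. Q x * v x \<partial>lborel) = (\<integral>\<^sup>+x. ennreal (A' * C) * (Q x * v x * indicator F x) \<partial>lborel)"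
      by (rule nn_integral_cmult[symmetric]) measurable
    also have "\<dots> \<le> (\<integral>\<^sup>+x. ennreal (1/2) * (ennreal (S 0 x powr p) * v x * indicator F x) + ennreal (L / 2) * (ennreal (Nf x powr p) * v x * indicator F x) \<partial>lborel)"
    proof (rule nn_integral_mono)
      fix x
      have "ennreal (A' * C) * Q x = ennreal (M * (Nf x * S 0 x powr (p - 1)))"
        using False A' \<open>0 < C\<close> \<open>0 < p\<close> Nf0[of x] by (simp add: Q_def M_def mult.assoc flip: ennreal_mult)
      also have "\<dots> \<le> ennreal (1/2 * S 0 x powr p + L / 2 * Nf x powr p)"
        using young[of x] by (intro ennreal_leI) simp
      also have "\<dots> = ennreal (1/2) * ennreal (S 0 x powr p) + ennreal (L / 2) * ennreal (Nf x powr p)"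
        using L0 by (subst ennreal_plus, simp, simp) (intro arg_cong2[where f = "(+)"] ennreal_mult; simp)
      finally have "(ennreal (A' * C) * Q x) * (v x * indicator F x) \<le>
        (ennreal (1/2) * ennreal (S 0 x powr p) + ennreal (L / 2) * ennreal (Nf x powr p)) * (v x * indicator F x)"
        by (rule mult_right_mono) simp
      then show "ennreal (A' * C) * (Q x * v x * indicator F x) \<le>
        ennreal (1/2) * (ennreal (S 0 x powr p) * v x * indicator F x) + ennreal (L / 2) * (ennreal (Nf x powr p) * v x * indicator F x)"
        by (simp only: distrib_right mult.assoc)
    qed
    also have "\<dots> = ennreal (1/2) * X + ennreal (L / 2) * Y"
      unfolding X_def Y_def by (subst nn_integral_add, measurable, subst nn_integral_cmult, measurable, subst nn_integral_cmult, measurable)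
    finally have XX: "X \<le> ennreal (1/2) * X + ennreal (L / 2) * Y" using XQ by (rule order_trans[rotated])
    have "X \<le> ennreal L * Y"
    proof (cases Y)
      case (real y)
      have "X < \<infinity>" using fin by (simp add: X_def S0)
      then obtain r where r: "X = ennreal r" "r \<ge> 0" by (cases X) auto
      have "ennreal (1/2 * r + L / 2 * y) = ennreal (1/2) * X + ennreal (L / 2) * Y"
        unfolding r(1) real(2) using r(2) real(1) L0
        by (subst ennreal_plus, simp, simp) (intro arg_cong2[where f = "(+)"] ennreal_mult; simp)
      with XX have "ennreal r \<le> ennreal (1/2 * r + L / 2 * y)" by (simp only: r(1))
      then have "r \<le> 1/2 * r + L / 2 * y"
        using r(2) real(1) L0 by (subst (asm) ennreal_le_iff) auto
      then have "r \<le> L * y" by simp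
      then show ?thesis using r real L0 by (simp add: ennreal_leI flip: ennreal_mult)
    next
      case top
      have "L > 0" unfolding L_def using \<open>M > 0\<close> by simp
      then show ?thesis using top by (simp add: ennreal_mult_top)
    qed
    also have "\<dots> \<le> ennreal (A' * C + (2 * (A' * C * p)) powr p) * Y"
      using A' \<open>0 < C\<close> by (intro mult_right_mono ennreal_leI) (auto simp: L_def M_def)
    finally show ?thesis .
  qed
  then show ?thesis by (simp add: X_def Y_def S0 A'_def)
qed

section \<open>The inequality of Muckenhoupt and Wheeden\<close>

definition centered_box :: "real \<Rightarrow> 'a::euclidean_space set" where
  "centered_box H = {x. \<forall>i\<in>Basis. - H \<le> x \<bullet> i \<and> x \<bullet> i < H}"

lemma adapted_centered_box:
  assumes "H > 0"
  shows "adapted H (\<lambda>x :: 'a::euclidean_space. x \<in> centered_box H)"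
proof -
  have iff: "(- H \<le> t \<and> t < H) \<longleftrightarrow> (- 1 \<le> \<lfloor>t / H\<rfloor> \<and> \<lfloor>t / H\<rfloor> < 1)" for t
    using assms by (simp add: le_floor_iff floor_less_iff field_simps)
  have "\<lfloor>corner H x \<bullet> i / H\<rfloor> = \<lfloor>x \<bullet> i / H\<rfloor>" if "i \<in> Basis" for x i :: 'a
    using that assms by (simp add: corner_inner)
  moreover have "x \<in> centered_box H \<longleftrightarrow> (\<forall>i\<in>Basis. - 1 \<le> \<lfloor>x \<bullet> i / H\<rfloor> \<and> \<lfloor>x \<bullet> i / H\<rfloor> < 1)" for x :: 'a
    unfolding centered_box_def by (simp only: mem_Collect_eq iff)
  ultimately show ?thesis unfolding adapted_def by (simp only: simp_thms cong: ball_cong)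
qed

lemma centered_box_subset_cube: "centered_box H \<subseteq> cube (- H *\<^sub>R (One :: 'a::euclidean_space)) (2 * H)"
proof
  fix x :: 'a assume "x \<in> centered_box H"
  then have "- H \<le> x \<bullet> i" "x \<bullet> i < H" if "i \<in> Basis" for i using that by (auto simp: centered_box_def)
  then show "x \<in> cube (- H *\<^sub>R One) (2 * H)" by (simp add: mem_cube less_imp_le)
qed

text \<open>If the distance of \<open>x\<close> and \<open>y\<close> lies between two consecutive scales, then \<open>y\<close> lies in the near cube of the
  larger scale \<open>h'\<close>, and the kernel at \<open>x - y\<close> is comparable to \<open>h'\<^bsup>1-n\<^esup>\<close>.\<close>

lemma truncated_potential_le_dyadic_sum:
  fixes g :: "'a::euclidean_space \<Rightarrow> ennreal"
  assumes "h > 0" and [measurable]: "g \<in> borel_measurable borel" and bd: "\<And>y. g y \<le> ennreal B"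
  shows "(\<integral>\<^sup>+y. g y * riesz_kernel (x - y) * indicator {h<..h * 2 ^ N} (norm (x - y)) \<partial>lborel) \<le>
    ennreal (2 powr (real DIM('a) - 1) * (\<Sum>j\<le>N. dyadic_mass g (h * 2 ^ j) x))"
proof -
  let ?n = "real DIM('a)"
  have "(\<integral>\<^sup>+y. g y * riesz_kernel (x - y) * indicator {h<..h * 2 ^ N} (norm (x - y)) \<partial>lborel) \<le>
    (\<integral>\<^sup>+y. (\<Sum>j\<le>N. ennreal (2 powr (?n - 1) * (h * 2 ^ j) powr (1 - ?n)) * (g y * indicator (near_cube (h * 2 ^ j) x) y)) \<partial>lborel)"
  proof (rule nn_integral_mono)
    fix y :: 'a
    show "g y * riesz_kernel (x - y) * indicator {h<..h * 2 ^ N} (norm (x - y)) \<le>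
      (\<Sum>j\<le>N. ennreal (2 powr (?n - 1) * (h * 2 ^ j) powr (1 - ?n)) * (g y * indicator (near_cube (h * 2 ^ j) x) y))"
    proof (cases "norm (x - y) \<in> {h<..h * 2 ^ N}")
      case True
      then have "norm (x - y) \<in> (\<Union>i. {h * 2 ^ i<..h * 2 ^ Suc i})"
        unfolding UN_dyadic_intervals[OF \<open>h > 0\<close>] by simp
      then obtain i where i: "h * 2 ^ i < norm (x - y)" "norm (x - y) \<le> h * 2 ^ Suc i" by auto
      have "h * 2 ^ i < h * 2 ^ N" using i(1) True by simp
      then have "i < N" using \<open>h > 0\<close> by simp
      then have iN: "Suc i \<in> {..N}" by simp
      let ?h = "h * 2 ^ Suc i"
      have "?h > 0" using \<open>h > 0\<close> by simp
      have near: "y \<in> near_cube ?h x"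
        unfolding mem_near_cube
      proof
        fix b :: 'a assume b: "b \<in> Basis"
        have "\<bar>(x - y) \<bullet> b\<bar> \<le> ?h" using Basis_le_norm[OF b, of "x - y"] i(2) by linarith
        then show "corner ?h x \<bullet> b - ?h \<le> y \<bullet> b \<and> y \<bullet> b \<le> corner ?h x \<bullet> b + 2 * ?h"
          using corner_bounds[OF \<open>?h > 0\<close> b, of x] unfolding inner_diff_left by linarith
      qed
      have "riesz_kernel (x - y) \<le> ennreal ((h * 2 ^ i) powr (1 - ?n))"
        using i(1) \<open>h > 0\<close> by (intro riesz_kernel_le) auto
      also have "(h * 2 ^ i) powr (1 - ?n) = 2 powr (?n - 1) * ?h powr (1 - ?n)"
      proof -
        have "?h powr (1 - ?n) = 2 powr (1 - ?n) * (h * 2 ^ i) powr (1 - ?n)"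
          using \<open>h > 0\<close> powr_mult[of 2 "h * 2 ^ i" "1 - ?n"] by (simp add: mult.left_commute)
        moreover have "2 powr (?n - 1) * 2 powr (1 - ?n) = (1::real)" by (simp flip: powr_add)
        ultimately show ?thesis by (simp add: mult.assoc[symmetric])
      qed
      finally have "g y * riesz_kernel (x - y) \<le> g y * ennreal (2 powr (?n - 1) * ?h powr (1 - ?n))" by (rule mult_left_mono) simp
      also have "\<dots> = ennreal (2 powr (?n - 1) * ?h powr (1 - ?n)) * (g y * indicator (near_cube ?h x) y)"
        using near by (simp add: mult.commute)
      also have "\<dots> \<le> (\<Sum>j\<le>N. ennreal (2 powr (?n - 1) * (h * 2 ^ j) powr (1 - ?n)) * (g y * indicator (near_cube (h * 2 ^ j) x) y))"
        using iN by (intro member_le_sum[where f = "\<lambda>j. ennreal (2 powr (?n - 1) * (h * 2 ^ j) powr (1 - ?n)) * (g y * indicator (near_cube (h * 2 ^ j) x) y)"]) auto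
      finally show ?thesis using True by simp
    qed simp
  qed
  also have "\<dots> = (\<Sum>j\<le>N. ennreal (2 powr (?n - 1) * (h * 2 ^ j) powr (1 - ?n)) * (\<integral>\<^sup>+y\<in>near_cube (h * 2 ^ j) x. g y \<partial>lborel))"
    by (subst nn_integral_sum) (auto intro!: sum.cong nn_integral_cmult)
  also have "\<dots> = (\<Sum>j\<le>N. ennreal (2 powr (?n - 1) * dyadic_mass g (h * 2 ^ j) x))"
  proof (rule sum.cong)
    fix j
    have "h * 2 ^ j > 0" using \<open>h > 0\<close> by simp
    show "ennreal (2 powr (?n - 1) * (h * 2 ^ j) powr (1 - ?n)) * (\<integral>\<^sup>+y\<in>near_cube (h * 2 ^ j) x. g y \<partial>lborel) = ennreal (2 powr (?n - 1) * dyadic_mass g (h * 2 ^ j) x)"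
      using ennreal_dyadic_mass(1)[OF \<open>h * 2 ^ j > 0\<close> bd, where x = x] by (simp add: ennreal_mult dyadic_mass_nonneg mult.assoc)
  qed simp
  also have "\<dots> = ennreal (2 powr (?n - 1) * (\<Sum>j\<le>N. dyadic_mass g (h * 2 ^ j) x))"
    by (simp add: sum_distrib_left dyadic_mass_nonneg)
  finally show ?thesis .
qed

text \<open>The power \<open>1 / p\<close> inverts the power \<open>p\<close> and both are monotone, so the supremum can be moved through the
  power without a discussion of continuity at infinity.\<close>

lemma epowr_SUP_le:
  assumes "0 < p"
  shows "epowr (SUP i. X i) p \<le> (SUP i :: nat. epowr (X i) p)"
proof -
  let ?Z = "SUP i. epowr (X i) p"
  have "X i \<le> epowr ?Z (1 / p)" for i
  proof -
    have "X i = epowr (epowr (X i) p) (1 / p)" using assms by (simp add: epowr_epowr epowr_one)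
    also have "\<dots> \<le> epowr ?Z (1 / p)" using assms by (intro epowr_mono SUP_upper) auto
    finally show ?thesis .
  qed
  then have "(SUP i. X i) \<le> epowr ?Z (1 / p)" by (intro SUP_least)
  then have "epowr (SUP i. X i) p \<le> epowr (epowr ?Z (1 / p)) p" using assms by (intro epowr_mono)
  then show ?thesis using assms by (simp add: epowr_epowr epowr_one)
qed

text \<open>The inequality of Muckenhoupt and Wheeden. Exhausting space by the boxes of side \<open>2\<^bsup>m+1\<^esup>\<close> and the
  kernel by its truncations reduces it to finite dyadic sums.\<close>

lemma muckenhoupt_wheeden:
  fixes w :: "'a::euclidean_space \<Rightarrow> real"
  assumes w: "w \<in> A_infinity" and "0 < p"
  obtains C :: real where "C > 0" "\<And>(g :: 'a \<Rightarrow> ennreal) B. g \<in> borel_measurable borel \<Longrightarrow> (\<And>y. g y \<le> ennreal B) \<Longrightarrow>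
    (\<integral>\<^sup>+x. epowr (riesz_potential g x) p * ennreal (w x) \<partial>lebesgue) \<le>
      ennreal C * (\<integral>\<^sup>+x. epowr (fractional_maximal_1 g x) p * ennreal (w x) \<partial>lebesgue)"
proof -
  let ?n = "real DIM('a)"
  have "weight w" using w by (auto simp: A_infinity_def A_class_def)
  then obtain v where v: "v \<in> borel_measurable borel" "\<And>x. 0 \<le> v x" "AE x in lborel. w x = v x"
    "\<And>a l. (\<integral>\<^sup>+x\<in>cube a l. ennreal (v x) \<partial>lborel) < \<infinity>"
    using weight_borel_version by blast
  note [measurable] = v(1)
  obtain C0 :: real where "C0 > 0" and C0: "\<And>a l E. l > 0 \<Longrightarrow> E \<in> sets borel \<Longrightarrow> E \<subseteq> cube a l \<Longrightarrow>
    ennreal (l ^ DIM('a) / 2) \<le> emeasure lborel E \<Longrightarrow>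
    (\<integral>\<^sup>+x\<in>cube a l. ennreal (v x) \<partial>lborel) \<le> ennreal C0 * (\<integral>\<^sup>+x\<in>E. ennreal (v x) \<partial>lborel)"
    using A_infinity_half_comparable[OF w v] by blast
  define A where "A = (4 * 4 ^ DIM('a) :: real)"
  have "(1::real) \<le> 4 ^ DIM('a)" by simp
  then have A: "A \<ge> 1" unfolding A_def by linarith
  define K where "K = max A (p * A powr p) * C0 + (2 * (max A (p * A powr p) * C0 * p)) powr p"
  have "K > 0" unfolding K_def using A \<open>C0 > 0\<close> by (intro add_pos_nonneg mult_pos_pos) auto
  define b where "b = (2::real) powr (?n - 1)"
  define c where "c = (3::real) powr (?n - 1)"
  have bc: "b > 0" "c > 0" by (simp_all add: b_def c_def)
  define C where "C = b powr p * (K * c powr p)"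
  show thesis
  proof (rule that[of C])
    show "C > 0" using \<open>K > 0\<close> bc by (simp add: C_def)
    fix g :: "'a \<Rightarrow> ennreal" and B
    assume [measurable]: "g \<in> borel_measurable borel" and bd: "\<And>y. g y \<le> ennreal B"
    define Z where "Z = (\<integral>\<^sup>+x. epowr (fractional_maximal_1 g x) p * ennreal (v x) \<partial>lborel)"
    \<comment> \<open>The \<open>2 m + 1\<close> scales from \<open>h m\<close> to \<open>2\<^sup>m\<close> and a box made of cells of the largest scale.\<close>
    define h where "h = (\<lambda>m::nat. 1 / 2 ^ m :: real)"
    have h0: "h m > 0" for m by (simp add: h_def)
    have hN: "h m * 2 ^ (2 * m) = 2 ^ m" for m
      by (simp add: h_def mult_2 power_add)
    define F where "F = (\<lambda>m::nat. centered_box (2 ^ m) :: 'a set)"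
    have Fad: "adapted (h m * 2 ^ (2 * m)) (\<lambda>x. x \<in> F m)" for m
      unfolding F_def hN by (rule adapted_centered_box) simp
    have Fm [measurable]: "F m \<in> sets borel" for m by (rule adapted_set_measurable[OF Fad])
    define a where "a = (\<lambda>m j x. dyadic_mass g (h m * 2 ^ j) x)"
    have hj: "h m * 2 ^ j > 0" for m j using h0 by simp
    have aad: "adapted (h m * 2 ^ j) (a m j)" for m j
      unfolding a_def by (rule adapted_dyadic_mass[OF hj])
    have am [measurable]: "a m j \<in> borel_measurable borel" for m j by (rule adapted_measurable[OF aad])
    have a0: "0 \<le> a m j x" for m j x by (simp add: a_def dyadic_mass_nonneg)
    have dyadic: "(\<integral>\<^sup>+x\<in>F m. ennreal ((\<Sum>j\<le>2 * m. a m j x) powr p) * ennreal (v x) \<partial>lborel) \<le> ennreal (K * c powr p) * Z" for m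
    proof -
      let ?N = "2 * m"
      define Nf where "Nf = (\<lambda>x. Max ((\<lambda>j. a m j x) ` {..?N}))"
      have Nfm [measurable]: "Nf \<in> borel_measurable borel" unfolding Nf_def by measurable
      have Nfin: "\<exists>j. Nf x = a m j x" for x
      proof -
        have "Nf x \<in> (\<lambda>j. a m j x) ` {..?N}" unfolding Nf_def by (intro Max_in) auto
        then show ?thesis by blast
      qed
      have cmp: "(\<integral>\<^sup>+x. \<phi> x * ennreal (v x) \<partial>lborel) \<le> ennreal C0 * (\<integral>\<^sup>+x\<in>{x. (\<Sum>j\<le>k. a m j x) \<le> A * a m k x}. \<phi> x * ennreal (v x) \<partial>lborel)"
        if "adapted (h m * 2 ^ k) \<phi>" for k \<phi>
      proof (rule nn_integral_adapted_le[OF hj that])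
        let ?E = "{x. (\<Sum>j\<le>k. a m j x) \<le> A * a m k x}"
        show Em: "?E \<in> sets borel" by measurable
        fix x :: 'a
        let ?D = "cell (h m * 2 ^ k) (corner (h m * 2 ^ k) x)"
        have "(\<integral>\<^sup>+y\<in>?D. ennreal (v y) \<partial>lborel) \<le> (\<integral>\<^sup>+y\<in>cube (corner (h m * 2 ^ k) x) (h m * 2 ^ k). ennreal (v y) \<partial>lborel)"
          using cell_subset_cube[OF hj[of m k]] by (intro nn_integral_mono) (auto simp: indicator_def)
        also have "\<dots> \<le> ennreal C0 * (\<integral>\<^sup>+y\<in>?D \<inter> ?E. ennreal (v y) \<partial>lborel)"
        proof (rule C0[OF hj])
          show "?D \<inter> ?E \<subseteq> cube (corner (h m * 2 ^ k) x) (h m * 2 ^ k)" using cell_subset_cube[OF hj[of m k]] by blast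
          show "ennreal ((h m * 2 ^ k) ^ DIM('a) / 2) \<le> emeasure lborel (?D \<inter> ?E)"
            unfolding a_def A_def by (rule dyadic_mass_sum_half[OF h0 _ bd]) measurable
          show "?D \<inter> ?E \<in> sets borel" using Em by (intro sets.Int) auto
        qed
        finally show "(\<integral>\<^sup>+y\<in>?D. ennreal (v y) \<partial>lborel) \<le> ennreal C0 * (\<integral>\<^sup>+y\<in>?D \<inter> ?E. ennreal (v y) \<partial>lborel)" .
      qed measurable
      define D where "D = (\<Sum>j\<le>?N. (h m * 2 ^ j) powr (1 - ?n) * (\<bar>B\<bar> * (3 * (h m * 2 ^ j)) ^ DIM('a)))"
      have fin: "(\<integral>\<^sup>+x\<in>F m. ennreal ((\<Sum>j\<le>?N. a m j x) powr p) * ennreal (v x) \<partial>lborel) < \<infinity>"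
      proof -
        have "(\<integral>\<^sup>+x\<in>F m. ennreal ((\<Sum>j\<le>?N. a m j x) powr p) * ennreal (v x) \<partial>lborel) \<le>
          (\<integral>\<^sup>+x. ennreal (D powr p) * (ennreal (v x) * indicator (cube (- (2 ^ m) *\<^sub>R One) (2 * 2 ^ m)) x) \<partial>lborel)"
        proof (rule nn_integral_mono)
          fix x :: 'a
          have "(\<Sum>j\<le>?N. a m j x) \<le> D"
            unfolding D_def a_def by (intro sum_mono ennreal_dyadic_mass(2)[OF hj bd])
          then have "ennreal ((\<Sum>j\<le>?N. a m j x) powr p) \<le> ennreal (D powr p)"
            using \<open>0 < p\<close> a0 by (intro ennreal_leI powr_mono2) (auto simp: sum_nonneg)
          then have "ennreal ((\<Sum>j\<le>?N. a m j x) powr p) * ennreal (v x) \<le> ennreal (D powr p) * ennreal (v x)"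
            by (rule mult_right_mono) simp
          moreover have "x \<in> cube (- (2 ^ m) *\<^sub>R One) (2 * 2 ^ m)" if "x \<in> F m"
            using that centered_box_subset_cube[of "2 ^ m"] by (auto simp: F_def)
          ultimately show "ennreal ((\<Sum>j\<le>?N. a m j x) powr p) * ennreal (v x) * indicator (F m) x \<le>
            ennreal (D powr p) * (ennreal (v x) * indicator (cube (- (2 ^ m) *\<^sub>R One) (2 * 2 ^ m)) x)"
            by (cases "x \<in> F m") simp_all
        qed
        also have "\<dots> = ennreal (D powr p) * (\<integral>\<^sup>+x\<in>cube (- (2 ^ m) *\<^sub>R One) (2 * 2 ^ m). ennreal (v x) \<partial>lborel)"
          by (rule nn_integral_cmult) measurable
        also have "\<dots> < \<infinity>" using v(4) by (simp add: ennreal_mult_less_top)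
        finally show ?thesis .
      qed
      have "(\<integral>\<^sup>+x\<in>F m. ennreal ((\<Sum>j\<le>?N. a m j x) powr p) * ennreal (v x) \<partial>lborel) \<le>
        ennreal K * (\<integral>\<^sup>+x\<in>F m. ennreal (Nf x powr p) * ennreal (v x) \<partial>lborel)"
        unfolding K_def
      proof (rule powr_sum_adapted_le_maximal[OF h0 aad a0 A _ Nfm _ cmp Fad \<open>0 < p\<close> \<open>C0 > 0\<close> fin])
        show "a m j x \<le> Nf x" if "j \<le> ?N" for j x unfolding Nf_def using that by (intro Max_ge) auto
      qed auto
      also have "(\<integral>\<^sup>+x\<in>F m. ennreal (Nf x powr p) * ennreal (v x) \<partial>lborel) \<le> (\<integral>\<^sup>+x. ennreal (c powr p) * (ennreal ((Nf x / c) powr p) * ennreal (v x)) \<partial>lborel)"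
      proof (rule nn_integral_mono)
        fix x
        have "0 \<le> Nf x" using Nfin[of x] a0 by auto
        then have "ennreal (Nf x powr p) = ennreal (c powr p) * ennreal ((Nf x / c) powr p)"
          using bc by (simp add: powr_divide flip: ennreal_mult)
        then show "ennreal (Nf x powr p) * ennreal (v x) * indicator (F m) x \<le> ennreal (c powr p) * (ennreal ((Nf x / c) powr p) * ennreal (v x))"
          by (cases "x \<in> F m") (simp_all add: mult.assoc)
      qed
      also have "\<dots> = ennreal (c powr p) * (\<integral>\<^sup>+x. ennreal ((Nf x / c) powr p) * ennreal (v x) \<partial>lborel)"
        by (rule nn_integral_cmult) measurable
      also have "(\<integral>\<^sup>+x. ennreal ((Nf x / c) powr p) * ennreal (v x) \<partial>lborel) \<le> Z"
        unfolding Z_def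
      proof (intro nn_integral_mono mult_right_mono)
        fix x
        obtain j where j: "Nf x = a m j x" using Nfin by blast
        have "ennreal (1 / c) * ennreal (a m j x) \<le> ennreal (1 / c) * (ennreal c * fractional_maximal_1 g x)"
          unfolding a_def c_def by (intro mult_left_mono dyadic_mass_le_fractional_maximal[OF hj bd]) auto
        also have "\<dots> = fractional_maximal_1 g x" using bc by (subst ennreal_mult_mult) auto
        also have "ennreal (1 / c) * ennreal (a m j x) = ennreal (Nf x / c)"
          using bc a0[of m j x] by (simp add: j flip: ennreal_mult)
        finally have "epowr (ennreal (Nf x / c)) p \<le> epowr (fractional_maximal_1 g x) p"
          using \<open>0 < p\<close> by (intro epowr_mono)
        then show "ennreal ((Nf x / c) powr p) \<le> epowr (fractional_maximal_1 g x) p"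
          using bc a0[of m j x] \<open>0 < p\<close> by (simp add: epowr_ennreal j)
      qed simp
      finally have "(\<integral>\<^sup>+x\<in>F m. ennreal ((\<Sum>j\<le>?N. a m j x) powr p) * ennreal (v x) \<partial>lborel) \<le> ennreal K * (ennreal (c powr p) * Z)"
        by (simp add: mult_left_mono)
      also have "\<dots> = ennreal (K * c powr p) * Z" using \<open>K > 0\<close> by (intro ennreal_mult_mult) auto
      finally show ?thesis .
    qed
    define R where "R = (\<lambda>m x. \<integral>\<^sup>+y. g y * riesz_kernel (x - y) * indicator {h m<..2 ^ m} (norm (x - y)) * indicator (F m) x \<partial>lborel)"
    have Rm [measurable]: "R m \<in> borel_measurable borel" for m unfolding R_def by measurable
    have Rle: "(\<integral>\<^sup>+x. epowr (R m x) p * ennreal (v x) \<partial>lborel) \<le> ennreal C * Z" for m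
    proof -
      have "(\<integral>\<^sup>+x. epowr (R m x) p * ennreal (v x) \<partial>lborel) \<le>
        (\<integral>\<^sup>+x. ennreal (b powr p) * (ennreal ((\<Sum>j\<le>2 * m. a m j x) powr p) * ennreal (v x) * indicator (F m) x) \<partial>lborel)"
      proof (rule nn_integral_mono)
        fix x :: 'a
        show "epowr (R m x) p * ennreal (v x) \<le> ennreal (b powr p) * (ennreal ((\<Sum>j\<le>2 * m. a m j x) powr p) * ennreal (v x) * indicator (F m) x)"
        proof (cases "x \<in> F m")
          case True
          have "R m x \<le> ennreal (b * (\<Sum>j\<le>2 * m. a m j x))"
            using truncated_potential_le_dyadic_sum[OF h0[of m] \<open>g \<in> borel_measurable borel\<close> bd, where x = x and N = "2 * m"] True
            unfolding R_def a_def b_def hN by simp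
          then have "epowr (R m x) p \<le> epowr (ennreal (b * (\<Sum>j\<le>2 * m. a m j x))) p"
            using \<open>0 < p\<close> by (intro epowr_mono)
          also have "\<dots> = ennreal (b powr p) * ennreal ((\<Sum>j\<le>2 * m. a m j x) powr p)"
            using bc a0 \<open>0 < p\<close> by (simp add: epowr_ennreal sum_nonneg epowr_mult ennreal_mult)
          finally have "epowr (R m x) p * ennreal (v x) \<le> ennreal (b powr p) * ennreal ((\<Sum>j\<le>2 * m. a m j x) powr p) * ennreal (v x)"
            by (rule mult_right_mono) simp
          then show ?thesis using True by (simp add: mult.assoc)
        next
          case False
          then have "R m x = 0" by (simp add: R_def)
          then show ?thesis using \<open>0 < p\<close> by (simp add: epowr_def)
        qed
      qed
      also have "\<dots> = ennreal (b powr p) * (\<integral>\<^sup>+x\<in>F m. ennreal ((\<Sum>j\<le>2 * m. a m j x) powr p) * ennreal (v x) \<partial>lborel)"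
        by (rule nn_integral_cmult) measurable
      also have "\<dots> \<le> ennreal (b powr p) * (ennreal (K * c powr p) * Z)" by (intro mult_left_mono dyadic) simp
      also have "\<dots> = ennreal C * Z" unfolding C_def using \<open>K > 0\<close> by (intro ennreal_mult_mult) auto
      finally show ?thesis .
    qed
    have ind_mono: "indicator {h m<..2 ^ m} r * indicator (F m) x \<le> (indicator {h m'<..2 ^ m'} r * indicator (F m') x :: ennreal)"
      if "m \<le> m'" for m m' :: nat and r x
    proof -
      have p2: "(2::real) ^ m \<le> 2 ^ m'" using that by (intro power_increasing) auto
      then have "h m' \<le> h m" unfolding h_def by (intro divide_left_mono) auto
      then have "{h m<..2 ^ m} \<subseteq> {h m'<..2 ^ m'}"
        using p2 unfolding subset_iff greaterThanAtMost_iff by (meson le_less_trans order_trans)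
      moreover have "F m \<subseteq> F m'"
      proof
        fix x assume x: "x \<in> F m"
        show "x \<in> F m'"
          unfolding F_def centered_box_def
        proof (intro CollectI ballI)
          fix i :: 'a assume "i \<in> Basis"
          then have "- (2 ^ m) \<le> x \<bullet> i" "x \<bullet> i < 2 ^ m" using x by (auto simp: F_def centered_box_def)
          then show "- (2 ^ m') \<le> x \<bullet> i \<and> x \<bullet> i < 2 ^ m'" using p2 by linarith
        qed
      qed
      ultimately show ?thesis by (auto simp: indicator_def)
    qed
    have SUPR: "riesz_potential g x = (SUP m. R m x)" for x
    proof -
      let ?f = "\<lambda>m y. g y * riesz_kernel (x - y) * indicator {h m<..2 ^ m} (norm (x - y)) * indicator (F m) x"
      have inc: "incseq ?f"
        by (intro incseq_SucI le_funI) (simp only: mult.assoc, intro mult_left_mono ind_mono, auto)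
      have "(SUP m. R m x) = (\<integral>\<^sup>+y. (SUP m. ?f m y) \<partial>lborel)"
        unfolding R_def by (rule nn_integral_monotone_convergence_SUP[symmetric, OF inc]) measurable
      also have "\<dots> = riesz_potential g x"
        unfolding riesz_potential_def
      proof (rule nn_integral_cong)
        fix y :: 'a
        show "(SUP m. ?f m y) = g y * riesz_kernel (x - y)"
        proof (cases "x = y")
          case True
          then have "riesz_kernel (x - y) = 0" by (simp add: riesz_kernel_def)
          then show ?thesis by simp
        next
          case False
          define r where "r = norm (x - y)"
          have "r > 0" using False by (simp add: r_def)
          obtain m1 :: nat where m1: "1 / r < 2 ^ m1" using real_arch_pow[of 2] by auto
          obtain m2 :: nat where m2: "max r (norm x) < 2 ^ m2" using real_arch_pow[of 2 "max r (norm x)"] by auto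
          define m where "m = max m1 m2"
          have "(2::real) ^ m1 \<le> 2 ^ m" "(2::real) ^ m2 \<le> 2 ^ m" by (auto simp: m_def intro!: power_increasing)
          then have m: "1 / r < 2 ^ m" "r \<le> 2 ^ m" "norm x < 2 ^ m" using m1 m2 unfolding max_less_iff_conj by linarith+
          have "h m < r" using m(1) \<open>r > 0\<close> by (simp add: h_def field_simps)
          moreover have "x \<in> F m"
            unfolding F_def centered_box_def
          proof (intro CollectI ballI)
            fix i :: 'a assume "i \<in> Basis"
            from Basis_le_norm[OF this, of x] m(3) have "\<bar>x \<bullet> i\<bar> < 2 ^ m" by linarith
            then show "- (2 ^ m) \<le> x \<bullet> i \<and> x \<bullet> i < 2 ^ m" by linarith
          qed
          ultimately have "?f m y = g y * riesz_kernel (x - y)" using m(2) by (simp add: r_def)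
          moreover have "?f i y \<le> g y * riesz_kernel (x - y)" for i by (simp add: indicator_def)
          ultimately show ?thesis by (intro antisym SUP_least) (auto intro: SUP_upper2[of m])
        qed
      qed
      finally show ?thesis by simp
    qed
    have Rinc: "incseq (\<lambda>m x. epowr (R m x) p * ennreal (v x))"
    proof (intro incseq_SucI le_funI mult_right_mono epowr_mono \<open>0 < p\<close>)
      fix m x
      show "R m x \<le> R (Suc m) x"
        unfolding R_def by (rule nn_integral_mono) (simp only: mult.assoc, intro mult_left_mono ind_mono, auto)
    qed simp
    have "(\<integral>\<^sup>+x. epowr (riesz_potential g x) p * ennreal (w x) \<partial>lebesgue) = (\<integral>\<^sup>+x. epowr (riesz_potential g x) p * ennreal (v x) \<partial>lborel)"
      unfolding nn_integral_completion using v(3) by (intro nn_integral_cong_AE, eventually_elim) simp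
    also have "\<dots> \<le> (\<integral>\<^sup>+x. (SUP m. epowr (R m x) p * ennreal (v x)) \<partial>lborel)"
    proof (rule nn_integral_mono)
      fix x
      have "epowr (riesz_potential g x) p * ennreal (v x) \<le> (SUP m. epowr (R m x) p) * ennreal (v x)"
        unfolding SUPR by (intro mult_right_mono epowr_SUP_le \<open>0 < p\<close>) simp
      then show "epowr (riesz_potential g x) p * ennreal (v x) \<le> (SUP m. epowr (R m x) p * ennreal (v x))"
        by (simp add: SUP_mult_right_ennreal)
    qed
    also have "\<dots> = (SUP m. \<integral>\<^sup>+x. epowr (R m x) p * ennreal (v x) \<partial>lborel)"
      by (rule nn_integral_monotone_convergence_SUP[OF Rinc]) measurable
    also have "\<dots> \<le> ennreal C * Z" by (intro SUP_least Rle)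
    also have "Z = (\<integral>\<^sup>+x. epowr (fractional_maximal_1 g x) p * ennreal (w x) \<partial>lebesgue)"
      unfolding Z_def nn_integral_completion using v(3) by (intro nn_integral_cong_AE, eventually_elim) simp
    finally show "(\<integral>\<^sup>+x. epowr (riesz_potential g x) p * ennreal (w x) \<partial>lebesgue) \<le>
      ennreal C * (\<integral>\<^sup>+x. epowr (fractional_maximal_1 g x) p * ennreal (w x) \<partial>lebesgue)" .
  qed
qed

section \<open>Pointwise domination and the weighted inequalities\<close>

lemma gradient_norm_bounded:
  fixes f :: "'a::euclidean_space \<Rightarrow> 'b::real_normed_vector"
  assumes f: "smooth_compactly_supported f"
  obtains B where "B \<ge> 0" "\<And>x. gradient_norm f x \<le> B"
proof -
  have "gradient_norm f x = 0" if "x \<notin> closure {x. f x \<noteq> 0}" for x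
  proof -
    have "(f has_derivative (\<lambda>_. 0)) (at x)"
    proof (rule has_derivative_transform_within_open[where s = "- closure {x. f x \<noteq> 0}" and f = "\<lambda>_. 0"])
      show "0 = f y" if "y \<in> - closure {x. f x \<noteq> 0}" for y
        using that closure_subset[of "{x. f x \<noteq> 0}"] by auto
    qed (use that in auto)
    then have "frechet_derivative f (at x) = (\<lambda>_. 0)" by (rule frechet_derivative_at[symmetric])
    then show ?thesis by (simp add: gradient_norm_def)
  qed
  then have "{x. gradient_norm f x \<noteq> 0} \<subseteq> closure {x. f x \<noteq> 0}" by auto
  moreover have "bounded (closure {x. f x \<noteq> 0})"
    using f by (simp add: smooth_compactly_supported_def compact_imp_bounded)
  ultimately have "bounded {x. gradient_norm f x \<noteq> 0}" by (rule bounded_subset[rotated])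
  then obtain B where "B \<ge> 0" "\<And>x. norm (gradient_norm f x) \<le> B"
    using bounded_range_of_bounded_support[OF gradient_norm_continuous[OF f]] by blast
  then show thesis using that[of B] by (auto simp: abs_le_iff)
qed

text \<open>The only property of the operators that the weighted inequality depends on.\<close>

definition potential_bound :: "(('a::euclidean_space \<Rightarrow> complex) \<Rightarrow> 'a \<Rightarrow> ennreal) \<Rightarrow> bool" where
  "potential_bound T \<longleftrightarrow> (\<exists>C>0. \<forall>f x. smooth_compactly_supported f \<longrightarrow>
     T f x \<le> ennreal C * riesz_potential (\<lambda>x. ennreal (gradient_norm f x)) x)"

lemma potential_boundI:
  assumes "C > 0" "\<And>f G x. upper_gradient f G \<Longrightarrow> continuous_on UNIV f \<Longrightarrow> bounded {x. f x \<noteq> 0} \<Longrightarrow>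
    G \<in> borel_measurable borel \<Longrightarrow> smooth_compactly_supported f \<Longrightarrow> G = (\<lambda>x. ennreal (gradient_norm f x)) \<Longrightarrow>
    T f x \<le> ennreal C * riesz_potential G x"
  shows "potential_bound T"
  unfolding potential_bound_def
proof (intro exI[of _ C] conjI allI impI \<open>C > 0\<close>)
  fix f :: "'a \<Rightarrow> complex" and x :: 'a assume f: "smooth_compactly_supported f"
  have [measurable]: "gradient_norm f \<in> borel_measurable borel"
    by (intro borel_measurable_continuous_onI gradient_norm_continuous f)
  show "T f x \<le> ennreal C * riesz_potential (\<lambda>x. ennreal (gradient_norm f x)) x"
    by (rule assms(2)[OF upper_gradient_gradient_norm[OF f] smooth_continuous[OF f] smooth_bounded_support[OF f] _ f refl])
       measurable
qed

lemma potential_bound_norm: "potential_bound (\<lambda>f x. ennreal (norm (f x)))"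
proof -
  obtain C :: real where "C > 0" "\<And>(f :: 'a \<Rightarrow> complex) G x. upper_gradient f G \<Longrightarrow> continuous_on UNIV f \<Longrightarrow>
      bounded {x. f x \<noteq> 0} \<Longrightarrow> G \<in> borel_measurable borel \<Longrightarrow> ennreal (norm (f x)) \<le> ennreal C * riesz_potential G x"
    using norm_le_riesz_potential[where 'b = complex] by blast
  then show ?thesis by (intro potential_boundI[of C])
qed

lemma potential_bound_HL_maximal:
  assumes "potential_bound T"
  shows "potential_bound (\<lambda>f. HL_maximal (T f))"
proof -
  obtain C1 where C1: "C1 > 0" "\<And>f x. smooth_compactly_supported f \<Longrightarrow> T f x \<le> ennreal C1 * riesz_potential (\<lambda>x. ennreal (gradient_norm f x)) x"
    using assms unfolding potential_bound_def by blast
  obtain C2 :: real where "C2 > 0" and C2: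
    "\<And>(G :: 'a \<Rightarrow> ennreal) a l x. G \<in> borel_measurable borel \<Longrightarrow> l > 0 \<Longrightarrow> x \<in> cube a l \<Longrightarrow>
      (\<integral>\<^sup>+y\<in>cube a l. riesz_potential G y \<partial>lborel) \<le> ennreal (C2 * l ^ DIM('a)) * riesz_potential G x"
    using integral_cube_riesz_potential_le by blast
  show ?thesis
  proof (rule potential_boundI[of "C1 * C2"])
    show "C1 * C2 > 0" using C1(1) \<open>C2 > 0\<close> by simp
    fix f :: "'a \<Rightarrow> complex" and x :: 'a and G
    assume [measurable]: "G \<in> borel_measurable borel" and f: "smooth_compactly_supported f"
      and G: "G = (\<lambda>x. ennreal (gradient_norm f x))"
    show "HL_maximal (T f) x \<le> ennreal (C1 * C2) * riesz_potential G x"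
      unfolding HL_maximal_def
    proof (rule SUP_least)
      fix q assume "q \<in> cubes_containing x"
      then obtain a l where q: "q = (a, l)" "l > 0" "x \<in> cube a l" by (auto simp: cubes_containing_def)
      have "(\<integral>\<^sup>+y\<in>cube a l. T f y \<partial>lborel) \<le> (\<integral>\<^sup>+y. ennreal C1 * (riesz_potential G y * indicator (cube a l) y) \<partial>lborel)"
      proof (rule nn_integral_mono)
        fix y show "T f y * indicator (cube a l) y \<le> ennreal C1 * (riesz_potential G y * indicator (cube a l) y)"
          using C1(2)[OF f, of y] by (simp add: G indicator_def)
      qed
      also have "\<dots> = ennreal C1 * (\<integral>\<^sup>+y\<in>cube a l. riesz_potential G y \<partial>lborel)" by (rule nn_integral_cmult) measurable
      also have "\<dots> \<le> ennreal C1 * (ennreal (C2 * l ^ DIM('a)) * riesz_potential G x)"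
        by (intro mult_left_mono C2 q) auto
      also have "\<dots> = ennreal (l ^ DIM('a)) * (ennreal (C1 * C2) * riesz_potential G x)"
        using C1(1) \<open>C2 > 0\<close> q(2) by (subst (1 2) ennreal_mult_mult) (auto simp: mult_ac)
      finally show "(case q of (a, l) \<Rightarrow> average (cube a l) (T f)) \<le> ennreal (C1 * C2) * riesz_potential G x"
        using q by (simp add: average_cube divide_le_posI_ennreal)
    qed
  qed
qed

lemma potential_bound_HL_maximal_iterate:
  "potential_bound (\<lambda>f. (HL_maximal ^^ k) (\<lambda>x. ennreal (norm (f x))))"
proof (induction k)
  case 0
  then show ?case using potential_bound_norm by simp
next
  case (Suc k)
  from potential_bound_HL_maximal[OF this] show ?case by simp
qed

lemma potential_bound_lorentz_maximal:
  assumes dim: "DIM('a::euclidean_space) \<ge> 2"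
  shows "potential_bound (\<lambda>f :: 'a \<Rightarrow> complex. lorentz_maximal (conj_exponent (real DIM('a))) (\<lambda>x. ennreal (norm (f x))))"
proof -
  let ?n = "real DIM('a)"
  obtain C :: real where "C > 0" and C:
    "\<And>(f :: 'a \<Rightarrow> complex) G a l x. upper_gradient f G \<Longrightarrow> continuous_on UNIV f \<Longrightarrow>
      bounded {x. f x \<noteq> 0} \<Longrightarrow> G \<in> borel_measurable borel \<Longrightarrow> l > 0 \<Longrightarrow> x \<in> cube a l \<Longrightarrow>
      lorentz_integral f (cube a l) \<le> ennreal (C * l powr (real DIM('a) - 1)) * riesz_potential G x"
    using lorentz_integral_cube_le_riesz_potential[OF dim, where 'b = complex] by blast
  define q where "q = conj_exponent ?n"
  have "q > 0" using dim by (simp add: q_def conj_exponent_def)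
  show ?thesis
  proof (rule potential_boundI[of "q * C"])
    show "q * C > 0" using \<open>q > 0\<close> \<open>C > 0\<close> by simp
    fix f :: "'a \<Rightarrow> complex" and G and x :: 'a
    assume f: "upper_gradient f G" "continuous_on UNIV f" "bounded {x. f x \<noteq> 0}" "G \<in> borel_measurable borel"
    show "lorentz_maximal (conj_exponent ?n) (\<lambda>x. ennreal (norm (f x))) x \<le> ennreal (q * C) * riesz_potential G x"
      unfolding lorentz_maximal_def
    proof (rule SUP_least)
      fix r assume "r \<in> cubes_containing x"
      then obtain a l where r: "r = (a, l)" "l > 0" "x \<in> cube a l" by (auto simp: cubes_containing_def)
      have "lorentz_norm (conj_exponent ?n) (cube a l) (\<lambda>x. ennreal (norm (f x))) = ennreal (l powr (1 - ?n) * q) * lorentz_integral f (cube a l)"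
        unfolding q_def by (rule lorentz_norm_cube[OF dim f(2) r(2)])
      also have "\<dots> \<le> ennreal (l powr (1 - ?n) * q) * (ennreal (C * l powr (?n - 1)) * riesz_potential G x)"
        by (intro mult_left_mono C f r) auto
      also have "\<dots> = ennreal (l powr (1 - ?n) * q * (C * l powr (?n - 1))) * riesz_potential G x"
        using \<open>q > 0\<close> \<open>C > 0\<close> by (intro ennreal_mult_mult) auto
      also have "l powr (1 - ?n) * q * (C * l powr (?n - 1)) = q * C * (l powr (1 - ?n) * l powr (?n - 1))" by simp
      also have "l powr (1 - ?n) * l powr (?n - 1) = 1" using r(2) by (simp flip: powr_add)
      finally show "(case r of (a, l) \<Rightarrow> lorentz_norm (conj_exponent ?n) (cube a l) (\<lambda>x. ennreal (norm (f x)))) \<le> ennreal (q * C) * riesz_potential G x"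
        using r by simp
    qed
  qed
qed

lemma potential_bound_spherical_maximal: "potential_bound spherical_maximal"
  by (rule potential_boundI[of 1]) (auto intro: spherical_maximal_le_riesz_potential)

lemma potential_bound_rough_maximal:
  fixes \<Omega> :: "'a::euclidean_space \<Rightarrow> complex"
  assumes "DIM('a) \<ge> 2" "homogeneous_degree_0 \<Omega>" "\<Omega> \<in> weak_Lp_sphere (real DIM('a))"
  shows "potential_bound (rough_maximal \<Omega>)"
proof -
  obtain C :: real where "C > 0" "\<And>f G x. upper_gradient f G \<Longrightarrow> continuous_on UNIV f \<Longrightarrow>
      bounded {x. f x \<noteq> 0} \<Longrightarrow> G \<in> borel_measurable borel \<Longrightarrow> rough_maximal \<Omega> f x \<le> ennreal C * riesz_potential G x"
    using rough_maximal_le_riesz_potential[OF assms] by blast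
  then show ?thesis by (intro potential_boundI[of C])
qed

lemma upper_gradient_lipschitz:
  assumes f: "upper_gradient f G" and bd: "\<And>z. G z \<le> ennreal B" and "B \<ge> 0"
  shows "norm (f (x - y) - f x) \<le> B * norm y"
proof -
  have "ennreal (norm (f (x + 1 *\<^sub>R (-y)) - f (x + 0 *\<^sub>R (-y)))) \<le> (\<integral>\<^sup>+s\<in>{0<..<1}. G (x + s *\<^sub>R (-y)) * ennreal (norm (-y)) \<partial>lborel)"
    by (rule upper_gradientD[OF f]) simp
  also have "\<dots> \<le> (\<integral>\<^sup>+s. ennreal (B * norm y) * indicator {0<..<1} s \<partial>(lborel :: real measure))"
    using bd \<open>B \<ge> 0\<close> by (intro nn_integral_mono) (auto simp: indicator_def ennreal_mult intro!: mult_right_mono)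
  also have "\<dots> = ennreal (B * norm y)" by (simp add: nn_integral_cmult)
  finally show ?thesis using \<open>B \<ge> 0\<close> by simp
qed

lemma potential_bound_rough_singular:
  fixes \<Omega> :: "'a::euclidean_space \<Rightarrow> complex"
  assumes dim: "DIM('a) \<ge> 2" and hom: "homogeneous_degree_0 \<Omega>" and weak: "\<Omega> \<in> weak_Lp_sphere (real DIM('a))"
    and mean: "mean_zero_sphere \<Omega>"
  shows "potential_bound (rough_singular_maximal \<Omega>)"
    and "potential_bound (\<lambda>f x. ennreal (norm (rough_singular \<Omega> f x)))"
proof -
  obtain \<Theta> K where T: "rough_kernel \<Theta> K" and AE: "AE y in sphere_measure. \<Omega> y = \<Theta> y" "AE y in lborel. \<Omega> y = \<Theta> y"
    using weak_Lp_sphere_rough_kernel[OF dim hom weak] by blast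
  note Tm = rough_kernelD(1)[OF T]
  have mean': "(\<integral>y. \<Theta> y \<partial>sphere_measure) = 0"
  proof -
    have "(\<integral>y. \<Omega> y \<partial>sphere_measure) = (\<integral>y. \<Theta> y \<partial>sphere_measure)"
    proof (rule integral_cong_AE)
      show "\<Omega> \<in> borel_measurable sphere_measure" using weak by (simp add: weak_Lp_sphere_def)
      show "\<Theta> \<in> borel_measurable sphere_measure" by (rule borel_measurable_sphere_measure[OF Tm])
    qed (rule AE(1))
    then show ?thesis using mean by (simp add: mean_zero_sphere_def)
  qed
  obtain C :: real where "C > 0" and C: "\<And>f G x t. upper_gradient f G \<Longrightarrow> continuous_on UNIV f \<Longrightarrow>
      bounded {x. f x \<noteq> 0} \<Longrightarrow> G \<in> borel_measurable borel \<Longrightarrow> t > 0 \<Longrightarrow>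
      ennreal (norm (truncated_transform \<Theta> t f x)) \<le> ennreal C * riesz_potential G x"
    using truncated_transform_le_riesz_potential[OF dim T mean'] by blast
  show "potential_bound (rough_singular_maximal \<Omega>)"
  proof (rule potential_boundI[OF \<open>C > 0\<close>])
    fix f :: "'a \<Rightarrow> complex" and G and x :: 'a
    assume f: "upper_gradient f G" "continuous_on UNIV f" "bounded {x. f x \<noteq> 0}" "G \<in> borel_measurable borel"
    show "rough_singular_maximal \<Omega> f x \<le> ennreal C * riesz_potential G x"
      unfolding rough_singular_maximal_def truncated_integral_eq_truncated_transform[OF Tm AE(2) f(2)]
      by (intro SUP_least C f) auto
  qed
  show "potential_bound (\<lambda>f x. ennreal (norm (rough_singular \<Omega> f x)))"
  proof (rule potential_boundI[OF \<open>C > 0\<close>])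
    fix f :: "'a \<Rightarrow> complex" and G and x :: 'a
    assume f: "upper_gradient f G" "continuous_on UNIV f" "bounded {x. f x \<noteq> 0}" "G \<in> borel_measurable borel"
      and smooth: "smooth_compactly_supported f" and G: "G = (\<lambda>x. ennreal (gradient_norm f x))"
    obtain B where B: "B \<ge> 0" "\<And>x. gradient_norm f x \<le> B" using gradient_norm_bounded[OF smooth] by blast
    have lip: "norm (f (x - y) - f x) \<le> B * norm y" for y
      using B by (intro upper_gradient_lipschitz[OF f(1)]) (auto simp: G intro: ennreal_leI)
    obtain l where l: "((\<lambda>t. truncated_transform \<Theta> t f x) \<longlongrightarrow> l) (at_right 0)"
      using truncated_transform_converges[OF T mean' f(2,3) lip] by blast
    have "rough_singular \<Omega> f x = l"
      unfolding rough_singular_def truncated_integral_eq_truncated_transform[OF Tm AE(2) f(2)]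
      by (rule tendsto_Lim[OF _ l]) simp
    moreover have "ennreal (norm l) \<le> ennreal C * riesz_potential G x"
    proof (rule tendsto_upperbound)
      show "((\<lambda>t. ennreal (norm (truncated_transform \<Theta> t f x))) \<longlongrightarrow> ennreal (norm l)) (at_right 0)"
        by (intro tendsto_ennrealI tendsto_norm l)
      show "\<forall>\<^sub>F t in at_right 0. ennreal (norm (truncated_transform \<Theta> t f x)) \<le> ennreal C * riesz_potential G x"
        using eventually_at_right_less[of 0] by eventually_elim (intro C f)
    qed simp
    ultimately show "ennreal (norm (rough_singular \<Omega> f x)) \<le> ennreal C * riesz_potential G x" by simp
  qed
qed

text \<open>Monotonicity of the weighted norm, which also holds for functions that are not measurable, reduces the
  claim to the potential of the bounded function \<open>gradient_norm f\<close>.\<close>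

lemma weighted_norm_inequality_of_potential_bound:
  fixes T :: "('a::euclidean_space \<Rightarrow> complex) \<Rightarrow> 'a \<Rightarrow> ennreal"
  assumes T: "potential_bound T" and "0 < p" and w: "w \<in> A_infinity"
  shows "\<exists>C::real. C > 0 \<and> (\<forall>f. smooth_compactly_supported f \<longrightarrow>
    weighted_Lp_norm p w (T f) \<le> ennreal C * weighted_Lp_norm p w (fractional_maximal_1 (\<lambda>x. ennreal (gradient_norm f x))))"
proof -
  obtain C1 where C1: "C1 > 0" "\<And>f x. smooth_compactly_supported f \<Longrightarrow> T f x \<le> ennreal C1 * riesz_potential (\<lambda>x. ennreal (gradient_norm f x)) x"
    using T unfolding potential_bound_def by blast
  obtain C2 :: real where "C2 > 0" and C2: "\<And>(g :: 'a \<Rightarrow> ennreal) B. g \<in> borel_measurable borel \<Longrightarrow> (\<And>y. g y \<le> ennreal B) \<Longrightarrow>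
    (\<integral>\<^sup>+x. epowr (riesz_potential g x) p * ennreal (w x) \<partial>lebesgue) \<le>
      ennreal C2 * (\<integral>\<^sup>+x. epowr (fractional_maximal_1 g x) p * ennreal (w x) \<partial>lebesgue)"
    using muckenhoupt_wheeden[OF w \<open>0 < p\<close>] by blast
  define C where "C = (C1 powr p * C2) powr (1 / p)"
  have "weight w" using w by (auto simp: A_infinity_def A_class_def)
  note [measurable] = weight_measurable[OF this]
  show ?thesis
  proof (intro exI[of _ C] conjI allI impI)
    show "C > 0" using C1(1) \<open>C2 > 0\<close> by (simp add: C_def)
    fix f :: "'a \<Rightarrow> complex" assume f: "smooth_compactly_supported f"
    define g where "g = (\<lambda>x. ennreal (gradient_norm f x))"
    have [measurable]: "gradient_norm f \<in> borel_measurable borel"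
      by (intro borel_measurable_continuous_onI gradient_norm_continuous f)
    have gm [measurable]: "g \<in> borel_measurable borel" unfolding g_def by measurable
    obtain B where B: "\<And>x. gradient_norm f x \<le> B" using gradient_norm_bounded[OF f] by blast
    have rm: "riesz_potential g \<in> borel_measurable lebesgue"
      by (rule measurable_completion) simp
    have "(\<integral>\<^sup>+x. epowr (T f x) p * ennreal (w x) \<partial>lebesgue) \<le>
      (\<integral>\<^sup>+x. ennreal (C1 powr p) * (epowr (riesz_potential g x) p * ennreal (w x)) \<partial>lebesgue)"
    proof (rule nn_integral_mono)
      fix x
      have "epowr (T f x) p \<le> epowr (ennreal C1 * riesz_potential g x) p"
        unfolding g_def by (intro epowr_mono \<open>0 < p\<close> C1(2) f)
      also have "\<dots> = ennreal (C1 powr p) * epowr (riesz_potential g x) p"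
        by (rule epowr_mult[OF \<open>0 < p\<close> C1(1)])
      finally have "epowr (T f x) p * ennreal (w x) \<le> ennreal (C1 powr p) * epowr (riesz_potential g x) p * ennreal (w x)"
        by (rule mult_right_mono) simp
      then show "epowr (T f x) p * ennreal (w x) \<le> ennreal (C1 powr p) * (epowr (riesz_potential g x) p * ennreal (w x))"
        by (simp add: mult.assoc)
    qed
    also have "\<dots> = ennreal (C1 powr p) * (\<integral>\<^sup>+x. epowr (riesz_potential g x) p * ennreal (w x) \<partial>lebesgue)"
      by (intro nn_integral_cmult borel_measurable_times_ennreal epowr_measurable rm) measurable
    also have "\<dots> \<le> ennreal (C1 powr p) * (ennreal C2 * (\<integral>\<^sup>+x. epowr (fractional_maximal_1 g x) p * ennreal (w x) \<partial>lebesgue))"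
      using B by (intro mult_left_mono C2[OF gm, of B]) (auto simp: g_def intro: ennreal_leI)
    also have "\<dots> = ennreal (C1 powr p * C2) * (\<integral>\<^sup>+x. epowr (fractional_maximal_1 g x) p * ennreal (w x) \<partial>lebesgue)"
      using \<open>C2 > 0\<close> by (intro ennreal_mult_mult) auto
    finally have "weighted_Lp_norm p w (T f) \<le> epowr (ennreal (C1 powr p * C2) * (\<integral>\<^sup>+x. epowr (fractional_maximal_1 g x) p * ennreal (w x) \<partial>lebesgue)) (1 / p)"
      unfolding weighted_Lp_norm_def using \<open>0 < p\<close> by (intro epowr_mono) auto
    also have "\<dots> = ennreal C * weighted_Lp_norm p w (fractional_maximal_1 g)"
      unfolding weighted_Lp_norm_def C_def using \<open>0 < p\<close> C1(1) \<open>C2 > 0\<close> by (intro epowr_mult) auto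
    finally show "weighted_Lp_norm p w (T f) \<le> ennreal C * weighted_Lp_norm p w (fractional_maximal_1 (\<lambda>x. ennreal (gradient_norm f x)))"
      by (simp add: g_def)
  qed
qed

theorem corollary3p3:
  fixes T :: "(real ^ 'n \<Rightarrow> complex) \<Rightarrow> real ^ 'n \<Rightarrow> ennreal"
    and w :: "real ^ 'n \<Rightarrow> real" and p :: real
  assumes "CARD('n) \<ge> 2"
    and "T = (\<lambda>f. HL_maximal (\<lambda>x. ennreal (norm (f x))))
       \<or> (\<exists>k\<ge>1. T = (\<lambda>f. (HL_maximal ^^ k) (\<lambda>x. ennreal (norm (f x)))))
       \<or> T = (\<lambda>f. lorentz_maximal (conj_exponent (real CARD('n))) (\<lambda>x. ennreal (norm (f x))))
       \<or> T = spherical_maximal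
       \<or> (\<exists>\<Omega>. homogeneous_degree_0 \<Omega> \<and> \<Omega> \<in> weak_Lp_sphere (real CARD('n))
            \<and> T = rough_maximal \<Omega>)
       \<or> (\<exists>\<Omega>. homogeneous_degree_0 \<Omega> \<and> \<Omega> \<in> weak_Lp_sphere (real CARD('n)) \<and> mean_zero_sphere \<Omega>
            \<and> (T = (\<lambda>f x. ennreal (norm (rough_singular \<Omega> f x))) \<or> T = rough_singular_maximal \<Omega>))"
    and "0 < p" and "w \<in> A_infinity"
  shows "\<exists>C::real. C > 0 \<and> (\<forall>f :: real ^ 'n \<Rightarrow> complex. smooth_compactly_supported f \<longrightarrow>
           weighted_Lp_norm p w (T f)
             \<le> ennreal C * weighted_Lp_norm p w (fractional_maximal_1 (\<lambda>x. ennreal (gradient_norm f x))))"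
proof -
  have dim: "DIM(real ^ 'n) = CARD('n)" by simp
  have d2: "DIM(real ^ 'n) \<ge> 2" using assms(1) by simp
  have "potential_bound T"
    using assms(2) potential_bound_HL_maximal[OF potential_bound_norm] potential_bound_HL_maximal_iterate
      potential_bound_lorentz_maximal[OF d2] potential_bound_spherical_maximal
      potential_bound_rough_maximal[OF d2] potential_bound_rough_singular[OF d2]
    unfolding dim by blast
  then show ?thesis by (rule weighted_norm_inequality_of_potential_bound[OF _ \<open>0 < p\<close> \<open>w \<in> A_infinity\<close>])
qed

end
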